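(* Let $N\ge 1$ be a real number, and let $X$ be a geodesically complete Busemann space equipped with a measure $m$ satisfying the measure contraction property $\mathrm{MCP}(0,N)$. Then $X$ is isometric to a strictly convex Banach space of some finite dimension $n\le N$. Furthermore, $m$ is a constant multiple of the $n$-dimensional Hausdorff measure.
   Context: A shortest path is an isometric embedding of an interval into a metric space. A geodesic space is a metric space in which every two points can be joined by a shortest path. A geodesic is a curve whose restriction to each sufficiently small interval is a shortest path. A geodesic space is uniquely geodesic if the shortest path between any two given points is unique; it is geodesically complete if any geodesic extends to a geodesic defined on $\mathbb{R}$. In a uniquely geodesic space $(X,d)$, for $p,x\in X$ and $0\le t\le 1$ the $t$-intermediate point $x_t$ for $x$ with respect to $p$ is the point on the shortest path from $p$ to $x$ with $d(p,x_t)=t\,d(p,x)$. For $A\subset X$, $A_t:=\{x_t\mid x\in A\}$. A Busemann space is a complete uniquely geodesic space $X$ such that for every $p\in X$, all $x,y\in X$ and $0\le t\le 1$, $d(x_t,y_t)\le t\,d(x,y)$, where $x_t,y_t$ are the $t$-intermediate points with respect to $p$. A metric measure space $(X,d,m)$ is a complete separable geodesic space $(X,d)$ with a Borel measure $m$ that is locally finite and locally positive (nonempty open sets have positive measure). A uniquely geodesic metric measure space satisfies $\mathrm{MCP}(0,N)$ if for every $p\in X$, every measurable $A\subset X$ with $0<m(A)<\infty$, and every $0\le t\le 1$, one has $m(A_t)\ge t^N m(A)$, where $A_t$ is taken with respect to $p$. *)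

theory Defs
  imports "HOL-Analysis.Analysis"
begin

text \<open>Metric spaces are types of class \<^class>\<open>metric_space\<close>; properties of the whole space take
  the type as an argument, as in \<open>busemann_space TYPE('a)\<close>. A curve on an interval \<open>I\<close> is a
  function on \<^typ>\<open>real\<close> of which only the values on \<open>I\<close> matter.\<close>

section \<open>Geodesics\<close>

definition shortest_path_on :: "real set \<Rightarrow> (real \<Rightarrow> 'a::metric_space) \<Rightarrow> bool" where
  "shortest_path_on I \<gamma> \<longleftrightarrow>
     is_interval I \<and> (\<forall>s\<in>I. \<forall>t\<in>I. dist (\<gamma> s) (\<gamma> t) = \<bar>s - t\<bar>)"

text \<open>An isometric embedding of a compact interval with end points \<open>x\<close> and \<open>y\<close> has domain of length
  \<^term>\<open>dist x y\<close>; starting the domain at \<open>0\<close> removes the freedom of translating the parameter, so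
  that uniqueness of the shortest path is uniqueness of the parametrized one.\<close>

definition shortest_path_between :: "(real \<Rightarrow> 'a::metric_space) \<Rightarrow> 'a \<Rightarrow> 'a \<Rightarrow> bool" where
  "shortest_path_between \<gamma> x y \<longleftrightarrow>
     shortest_path_on {0..dist x y} \<gamma> \<and> \<gamma> 0 = x \<and> \<gamma> (dist x y) = y"

definition geodesic_space :: "'a::metric_space itself \<Rightarrow> bool" where
  "geodesic_space _ \<longleftrightarrow> (\<forall>x y :: 'a. \<exists>\<gamma>. shortest_path_between \<gamma> x y)"

definition uniquely_geodesic_space :: "'a::metric_space itself \<Rightarrow> bool" where
  "uniquely_geodesic_space _ \<longleftrightarrow>
     geodesic_space TYPE('a) \<and>
     (\<forall>(x::'a) y \<gamma> \<gamma>'. shortest_path_between \<gamma> x y \<longrightarrow> shortest_path_between \<gamma>' x y \<longrightarrow>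
        (\<forall>t\<in>{0..dist x y}. \<gamma> t = \<gamma>' t))"

text \<open>Geodesics live on intervals of any kind (open, closed, unbounded, ...) with more than one
  point. Were one-point intervals admitted as well, geodesic completeness would change for the
  one-point space only, which would cease to have it.\<close>

definition geodesic_on :: "real set \<Rightarrow> (real \<Rightarrow> 'a::metric_space) \<Rightarrow> bool" where
  "geodesic_on I \<gamma> \<longleftrightarrow>
     is_interval I \<and> (\<exists>a\<in>I. \<exists>b\<in>I. a < b) \<and> continuous_on I \<gamma> \<and>
     (\<forall>t\<in>I. \<exists>\<epsilon>>0. shortest_path_on (I \<inter> ball t \<epsilon>) \<gamma>)"

definition geodesically_complete :: "'a::metric_space itself \<Rightarrow> bool" where
  "geodesically_complete _ \<longleftrightarrow>
     (\<forall>I (\<gamma> :: real \<Rightarrow> 'a). geodesic_on I \<gamma> \<longrightarrow>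
        (\<exists>\<gamma>'. geodesic_on UNIV \<gamma>' \<and> (\<forall>t\<in>I. \<gamma>' t = \<gamma> t)))"

section \<open>Busemann spaces\<close>

definition intermediate_point :: "'a::metric_space \<Rightarrow> real \<Rightarrow> 'a \<Rightarrow> 'a" where
  "intermediate_point p t x =
     (THE z. \<exists>\<gamma>. shortest_path_between \<gamma> p x \<and> z \<in> \<gamma> ` {0..dist p x} \<and>
                 dist p z = t * dist p x)"

definition busemann_space :: "'a::metric_space itself \<Rightarrow> bool" where
  "busemann_space _ \<longleftrightarrow>
     complete (UNIV :: 'a set) \<and> uniquely_geodesic_space TYPE('a) \<and>
     (\<forall>(p::'a) x y. \<forall>t\<in>{0..1}.
        dist (intermediate_point p t x) (intermediate_point p t y) \<le> t * dist x y)"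

section \<open>Metric measure spaces\<close>

definition metric_measure_space :: "'a::metric_space measure \<Rightarrow> bool" where
  "metric_measure_space m \<longleftrightarrow>
     complete (UNIV :: 'a set) \<and> separable_space (euclidean :: 'a topology) \<and>
     geodesic_space TYPE('a) \<and>
     sets m = sets borel \<and>
     (\<forall>x. \<exists>U. open U \<and> x \<in> U \<and> emeasure m U < \<infinity>) \<and>
     (\<forall>U. open U \<longrightarrow> U \<noteq> {} \<longrightarrow> 0 < emeasure m U)"

text \<open>The set \<open>A\<^sub>t\<close> is an analytic set which need not be Borel, and \<^const>\<open>emeasure\<close> is \<open>0\<close> off the
  \<open>\<sigma>\<close>-algebra. Hence its measure is taken with \<^const>\<open>outer_measure_of\<close>, which agrees with
  \<open>m\<close> on Borel sets and with the completion of \<open>m\<close> on all sets measurable for it.\<close>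

definition MCP0 :: "real \<Rightarrow> 'a::metric_space measure \<Rightarrow> bool" where
  "MCP0 N m \<longleftrightarrow>
     (\<forall>p. \<forall>A\<in>sets m. 0 < emeasure m A \<longrightarrow> emeasure m A < \<infinity> \<longrightarrow>
        (\<forall>t\<in>{0..1}. outer_measure_of m (intermediate_point p t ` A)
                      \<ge> ennreal (t powr N) * emeasure m A))"

section \<open>Finite-dimensional Banach spaces\<close>

text \<open>An \<open>n\<close>-dimensional real Banach space is the coordinate space of real \<open>n\<close>-tuples with a
  complete norm. As in \<^const>\<open>Euclidean_space\<close>, tuples are sequences that vanish from
  index \<open>n\<close> on, so that \<open>n\<close> can be quantified; for \<open>n = 0\<close> this is the zero space.\<close>

definition coord_space :: "nat \<Rightarrow> (nat \<Rightarrow> real) set" where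
  "coord_space n = {v. \<forall>i\<ge>n. v i = 0}"

definition norm_on :: "nat \<Rightarrow> ((nat \<Rightarrow> real) \<Rightarrow> real) \<Rightarrow> bool" where
  "norm_on n \<nu> \<longleftrightarrow>
     (\<forall>v\<in>coord_space n. 0 \<le> \<nu> v \<and> (\<nu> v = 0 \<longleftrightarrow> v = (\<lambda>i. 0))) \<and>
     (\<forall>v\<in>coord_space n. \<forall>c. \<nu> (\<lambda>i. c * v i) = \<bar>c\<bar> * \<nu> v) \<and>
     (\<forall>v\<in>coord_space n. \<forall>w\<in>coord_space n. \<nu> (\<lambda>i. v i + w i) \<le> \<nu> v + \<nu> w)"

definition norm_dist :: "((nat \<Rightarrow> real) \<Rightarrow> real) \<Rightarrow> (nat \<Rightarrow> real) \<Rightarrow> (nat \<Rightarrow> real) \<Rightarrow> real" where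
  "norm_dist \<nu> v w = \<nu> (\<lambda>i. v i - w i)"

definition banach_norm_on :: "nat \<Rightarrow> ((nat \<Rightarrow> real) \<Rightarrow> real) \<Rightarrow> bool" where
  "banach_norm_on n \<nu> \<longleftrightarrow>
     norm_on n \<nu> \<and> Metric_space.mcomplete (coord_space n) (norm_dist \<nu>)"

definition strictly_convex_norm_on :: "nat \<Rightarrow> ((nat \<Rightarrow> real) \<Rightarrow> real) \<Rightarrow> bool" where
  "strictly_convex_norm_on n \<nu> \<longleftrightarrow>
     (\<forall>v\<in>coord_space n. \<forall>w\<in>coord_space n.
        \<nu> v = 1 \<longrightarrow> \<nu> w = 1 \<longrightarrow> v \<noteq> w \<longrightarrow> \<nu> (\<lambda>i. (v i + w i) / 2) < 1)"

definition isometric_to_normed :: "'a::metric_space itself \<Rightarrow> nat \<Rightarrow> ((nat \<Rightarrow> real) \<Rightarrow> real) \<Rightarrow> bool"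
  where
  "isometric_to_normed _ n \<nu> \<longleftrightarrow>
     (\<exists>f :: 'a \<Rightarrow> nat \<Rightarrow> real. bij_betw f UNIV (coord_space n) \<and>
        (\<forall>x y. norm_dist \<nu> (f x) (f y) = dist x y))"

section \<open>Hausdorff measure\<close>

text \<open>The normalization is the one without a dimensional constant factor. The empty set contributes
  \<open>0\<close> also for \<open>n = 0\<close>, where every other set contributes \<open>1\<close>. Boundedness is required since
  \<^const>\<open>diameter\<close> is meaningless for unbounded sets.\<close>

definition hausdorff_premeasure :: "nat \<Rightarrow> real \<Rightarrow> 'a::metric_space set \<Rightarrow> ennreal" where
  "hausdorff_premeasure n \<delta> A =
     (INF U \<in> {U :: nat \<Rightarrow> 'a set. A \<subseteq> (\<Union>i. U i) \<and> (\<forall>i. bounded (U i) \<and> diameter (U i) \<le> \<delta>)}.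
        \<Sum>i. if U i = {} then 0 else ennreal (diameter (U i) ^ n))"

definition hausdorff_measure :: "nat \<Rightarrow> 'a::metric_space set \<Rightarrow> ennreal" where
  "hausdorff_measure n A = (SUP \<delta> \<in> {0<..}. hausdorff_premeasure n \<delta> A)"

end

theory Submission
  imports Defs
begin

text \<open>Extend a line through \<open>p\<close> and flow all points by \<open>s\<close> towards its far end: this is the limit, as
  \<open>L\<close> tends to infinity, of the contractions by \<open>1 - s / L\<close> towards the point of the line at parameter
  \<open>L\<close>. Busemann convexity makes the flow nonexpansive, and the factor \<open>(1 - s / L)\<^sup>N\<close> of the
  measure contraction property tends to \<open>1\<close>, so the flow does not decrease the measure of compact
  sets. Flowing forth and back fixes \<open>p\<close> and hence maps each closed ball about \<open>p\<close> into, and by the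
  measure estimate onto, itself; a nonexpansive surjection of a compact space is an isometry. So all
  flows are isometries of bounded displacement. By convexity along lines, such isometries have
  constant displacement, commute, and act simply transitively, which turns the space into a normed
  space with a translation-invariant measure. The Bishop-Gromov inequality bounds the number of
  lattice points in large balls and so the dimension, strict convexity is uniqueness of midpoints,
  and the Hausdorff measure agrees with \<open>m\<close> by uniqueness of translation-invariant measures.\<close>

section \<open>Busemann spaces\<close>

text \<open>Nonexpansiveness alone allows collapse, and a measure estimate alone says nothing about
  distances. Together they are conclusive on a ball that is mapped into itself, which is why a map
  with a fixed point is needed before a single flow can be shown to be an isometry. Contracted sets
  need not be Borel, so measures are compared on compact sets, where the approximations lie in
  closed neighbourhoods of the limit image that shrink at an explicit rate. Compactness of closed
  balls is itself a consequence of volume growth and completeness. All rigidity after that comes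
  from one fact: a bounded convex function on a half-line does not increase. It makes displacements
  constant and identifies asymptotic lines with a common starting point. For the Hausdorff measure,
  finiteness is a count of cells, while positivity comes from the given measure by mass
  distribution: a set of small diameter d has measure at most a constant times d^n.\<close>

lemma discrete_convex_lower_bound:
  fixes f :: "nat \<Rightarrow> real"
  assumes "\<And>i. i + 2 \<le> k \<Longrightarrow> 2 * f (i + 1) \<le> f i + f (i + 2)" and "j \<le> k"
  shows "f 0 + real j * (f 1 - f 0) \<le> f j"
proof -
  have step: "f 1 - f 0 \<le> f (Suc i) - f i" if "Suc i \<le> k" for i
    using that
  proof (induction i)
    case (Suc i)
    then show ?case using assms(1)[of i] by (simp add: eval_nat_numeral)
  qed simp
  show ?thesis using \<open>j \<le> k\<close>
  proof (induction j)
    case (Suc j)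
    then show ?case using step[of j] by (simp add: algebra_simps)
  qed simp
qed

text \<open>A first increment upwards would force linear growth and exceed \<open>C\<close>.\<close>

lemma discrete_convex_bounded:
  fixes f :: "nat \<Rightarrow> real"
  assumes "\<And>i. 2 * f (i + 1) \<le> f i + f (i + 2)" and bdd: "\<And>i. f i \<le> C"
  shows "f 1 \<le> f 0"
proof (rule ccontr)
  assume "\<not> f 1 \<le> f 0"
  then have pos: "f 1 - f 0 > 0" by simp
  obtain k :: nat where "real k * (f 1 - f 0) > C - f 0"
    using reals_Archimedean3[OF pos] by blast
  moreover have "f 0 + real k * (f 1 - f 0) \<le> f k"
    by (rule discrete_convex_lower_bound[of k]) (use assms(1) in auto)
  ultimately show False using bdd[of k] by simp
qed

definition geodesic_line :: "(real \<Rightarrow> 'a::metric_space) \<Rightarrow> bool" where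
  "geodesic_line \<gamma> \<longleftrightarrow> (\<forall>s t. dist (\<gamma> s) (\<gamma> t) = \<bar>s - t\<bar>)"

lemma geodesic_lineD: "geodesic_line \<gamma> \<Longrightarrow> dist (\<gamma> s) (\<gamma> t) = \<bar>s - t\<bar>"
  by (simp add: geodesic_line_def)

lemma geodesic_line_reverse: "geodesic_line \<gamma> \<Longrightarrow> geodesic_line (\<lambda>t. \<gamma> (- t))"
  by (simp add: geodesic_line_def abs_minus_commute)

locale Busemann =
  fixes dummy :: "'a::metric_space itself"
  assumes busemann: "busemann_space TYPE('a)"
begin

section \<open>Intermediate points and convexity of the distance\<close>

lemma shortest_path_exists:
  obtains \<gamma> where "shortest_path_between \<gamma> (x::'a) y"
  using busemann unfolding busemann_space_def uniquely_geodesic_space_def geodesic_space_def by blast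

lemma shortest_path_unique:
  "shortest_path_between \<gamma> (x::'a) y \<Longrightarrow> shortest_path_between \<gamma>' x y \<Longrightarrow> t \<in> {0..dist x y} \<Longrightarrow> \<gamma> t = \<gamma>' t"
  using busemann unfolding busemann_space_def uniquely_geodesic_space_def by blast

text \<open>On a shortest path from \<open>p\<close> the parameter of a point is its distance from
  \<open>p\<close>, so any one such path evaluates the definite description.\<close>

lemma intermediate_point_shortest_path:
  assumes \<gamma>: "shortest_path_between \<gamma> (p::'a) x" and t: "0 \<le> t" "t \<le> 1"
  shows "intermediate_point p t x = \<gamma> (t * dist p x)"
proof -
  let ?D = "dist p x"
  have tD: "t * ?D \<in> {0..?D}" using t by (auto simp: mult_left_le_one_le)
  have dp: "dist p (\<eta> s) = s" if "shortest_path_between \<eta> p x" "s \<in> {0..?D}" for \<eta> s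
    using that unfolding shortest_path_between_def shortest_path_on_def
    by (metis abs_of_nonneg atLeastAtMost_iff diff_zero dist_commute order_refl zero_le_dist)
  show ?thesis unfolding intermediate_point_def
  proof (rule the_equality)
    show "\<exists>\<gamma>'. shortest_path_between \<gamma>' p x \<and> \<gamma> (t * ?D) \<in> \<gamma>' ` {0..?D} \<and> dist p (\<gamma> (t * ?D)) = t * ?D"
      using \<gamma> dp[OF \<gamma> tD] tD by blast
  next
    fix z assume "\<exists>\<gamma>'. shortest_path_between \<gamma>' p x \<and> z \<in> \<gamma>' ` {0..?D} \<and> dist p z = t * ?D"
    then show "z = \<gamma> (t * ?D)" using dp shortest_path_unique[OF _ \<gamma> tD] by fastforce
  qed
qed

lemma
  assumes t: "0 \<le> t" "t \<le> 1"
  shows dist_intermediate_left: "dist (p::'a) (intermediate_point p t x) = t * dist p x"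
    and dist_intermediate_right: "dist (intermediate_point p t x) x = (1 - t) * dist p x"
proof -
  obtain \<gamma> where \<gamma>: "shortest_path_between \<gamma> p x" by (rule shortest_path_exists)
  have tD: "t * dist p x \<in> {0..dist p x}" using t by (auto simp: mult_left_le_one_le)
  have *: "\<forall>s\<in>{0..dist p x}. \<forall>t\<in>{0..dist p x}. dist (\<gamma> s) (\<gamma> t) = \<bar>s - t\<bar>" "\<gamma> 0 = p" "\<gamma> (dist p x) = x"
    using \<gamma> unfolding shortest_path_between_def shortest_path_on_def by auto
  have "dist (\<gamma> 0) (\<gamma> (t * dist p x)) = t * dist p x" using *(1) tD by auto
  then show "dist p (intermediate_point p t x) = t * dist p x"
    using intermediate_point_shortest_path[OF \<gamma> t] * by simp
  have "dist (\<gamma> (t * dist p x)) (\<gamma> (dist p x)) = dist p x - t * dist p x" using *(1) tD by auto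
  then show "dist (intermediate_point p t x) x = (1 - t) * dist p x"
    using intermediate_point_shortest_path[OF \<gamma> t] * by (simp add: algebra_simps)
qed

text \<open>The shortest paths from \<open>p\<close> to \<open>z\<close> and from \<open>z\<close>
  to \<open>x\<close> concatenate to a shortest path because their lengths add up to
  \<open>dist p x\<close>; uniqueness does the rest. Two distances thus suffice to recognize an
  intermediate point.\<close>

lemma intermediate_point_eqI:
  assumes "dist (p::'a) z = t * dist p x" "dist z x = (1 - t) * dist p x" and t: "0 \<le> t" "t \<le> 1"
  shows "intermediate_point p t x = z"
proof -
  obtain \<alpha> where \<alpha>: "shortest_path_between \<alpha> p z" by (rule shortest_path_exists)
  obtain \<beta> where \<beta>: "shortest_path_between \<beta> z x" by (rule shortest_path_exists)
  define a D where "a = dist p z" and "D = dist p x"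
  have zx: "dist z x = D - a" using assms by (simp add: a_def D_def algebra_simps)
  have a: "0 \<le> a" "a \<le> D" using zx zero_le_dist[of z x] by (auto simp: a_def)
  have A: "\<And>s t. 0 \<le> s \<Longrightarrow> s \<le> a \<Longrightarrow> 0 \<le> t \<Longrightarrow> t \<le> a \<Longrightarrow> dist (\<alpha> s) (\<alpha> t) = \<bar>s - t\<bar>" "\<alpha> 0 = p" "\<alpha> a = z"
    using \<alpha> unfolding shortest_path_between_def shortest_path_on_def a_def by auto
  have B: "\<And>s t. 0 \<le> s \<Longrightarrow> s \<le> D - a \<Longrightarrow> 0 \<le> t \<Longrightarrow> t \<le> D - a \<Longrightarrow> dist (\<beta> s) (\<beta> t) = \<bar>s - t\<bar>" "\<beta> 0 = z" "\<beta> (D - a) = x"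
    using \<beta> unfolding shortest_path_between_def shortest_path_on_def zx by auto
  define \<gamma> where "\<gamma> s = (if s \<le> a then \<alpha> s else \<beta> (s - a))" for s
  have cross: "dist (\<alpha> s) (\<beta> (r - a)) = r - s" if "0 \<le> s" "s \<le> a" "a \<le> r" "r \<le> D" for s r
  proof (rule antisym)
    have "dist (\<alpha> s) (\<beta> (r - a)) \<le> dist (\<alpha> s) (\<alpha> a) + dist (\<beta> 0) (\<beta> (r - a))"
      unfolding A(3) B(2) by (rule dist_triangle)
    then show "dist (\<alpha> s) (\<beta> (r - a)) \<le> r - s" using A(1)[of s a] B(1)[of 0 "r - a"] that by simp
    \<comment> \<open>The way from \<open>p\<close> to \<open>x\<close> through both points cannot
      be shorter than \<open>D\<close>.\<close>
    have "D \<le> dist (\<alpha> 0) (\<alpha> s) + dist (\<alpha> s) (\<beta> (r - a)) + dist (\<beta> (r - a)) (\<beta> (D - a))"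
      unfolding A(2) B(3) using dist_triangle[of p x "\<alpha> s"] dist_triangle[of "\<alpha> s" x "\<beta> (r - a)"]
      by (simp add: D_def)
    then show "r - s \<le> dist (\<alpha> s) (\<beta> (r - a))" using A(1)[of 0 s] B(1)[of "r - a" "D - a"] that by simp
  qed
  have "shortest_path_between \<gamma> p x"
    unfolding shortest_path_between_def shortest_path_on_def D_def[symmetric]
  proof (intro conjI ballI)
    fix s r assume sr: "s \<in> {0..D}" "r \<in> {0..D}"
    show "dist (\<gamma> s) (\<gamma> r) = \<bar>s - r\<bar>"
      using sr A(1)[of s r] B(1)[of "s - a" "r - a"] cross[of s r] cross[of r s]
      by (auto simp: \<gamma>_def dist_commute)
  next
    show "\<gamma> 0 = p" "\<gamma> D = x" using a A B by (auto simp: \<gamma>_def)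
  qed (simp add: is_interval_cc)
  from intermediate_point_shortest_path[OF this t] show ?thesis
    using A(3) assms(1) by (simp add: \<gamma>_def a_def)
qed

lemma intermediate_point_commute:
  "0 \<le> t \<Longrightarrow> t \<le> 1 \<Longrightarrow> intermediate_point p (1 - t) x = intermediate_point (x::'a) t p"
  by (rule intermediate_point_eqI)
     (auto simp: dist_intermediate_left dist_intermediate_right dist_commute[of p] dist_commute[of _ x])

lemma intermediate_point_contraction:
  "0 \<le> t \<Longrightarrow> t \<le> 1 \<Longrightarrow> dist (intermediate_point (p::'a) t x) (intermediate_point p t y) \<le> t * dist x y"
  using busemann unfolding busemann_space_def by simp

text \<open>The defining contraction compares two segments with a common end. Arbitrary segments are
  compared through the diagonal from \<open>x\<close> to \<open>y'\<close>, which shares one end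
  with each of them.\<close>

lemma dist_intermediate_convex:
  assumes t: "0 \<le> t" "t \<le> 1"
  shows "dist (intermediate_point (x::'a) t y) (intermediate_point x' t y') \<le> (1 - t) * dist x x' + t * dist y y'"
proof -
  have "dist (intermediate_point x t y) (intermediate_point x' t y')
      \<le> dist (intermediate_point x t y) (intermediate_point x t y')
        + dist (intermediate_point x t y') (intermediate_point x' t y')" by (rule dist_triangle)
  also have "dist (intermediate_point x t y) (intermediate_point x t y') \<le> t * dist y y'"
    using t by (rule intermediate_point_contraction)
  also have "dist (intermediate_point x t y') (intermediate_point x' t y') \<le> (1 - t) * dist x x'"
    using intermediate_point_contraction[of "1 - t" y' x x'] t
      intermediate_point_commute[of t y' x] intermediate_point_commute[of t y' x'] by simp
  finally show ?thesis by simp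
qed

lemma intermediate_point_self: "0 \<le> t \<Longrightarrow> t \<le> 1 \<Longrightarrow> intermediate_point (x::'a) t x = x"
  by (rule intermediate_point_eqI) auto

text \<open>Subdivide so finely that any three consecutive points lie in a ball on which the curve
  is shortest. The middle one is then the midpoint of the others, so the distance from the first
  point is a convex sequence with initial slope \<open>h\<close>, and it is at least
  \<open>k * h\<close> at the end.\<close>

lemma geodesic_imp_geodesic_line:
  assumes "geodesic_on UNIV (\<gamma> :: real \<Rightarrow> 'a)"
  shows "geodesic_line \<gamma>"
proof -
  obtain \<epsilon> where \<epsilon>: "\<And>t. \<epsilon> t > 0" "\<And>t. shortest_path_on (ball t (\<epsilon> t)) \<gamma>"
    using assms unfolding geodesic_on_def by (simp add: ball_UNIV) metis
  have main: "dist (\<gamma> a) (\<gamma> b) = b - a" if "a < b" for a b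
  proof -
    \<comment> \<open>\<open>e\<close> is a Lebesgue number of the cover by balls on which the curve
      is shortest.\<close>
    obtain e where e: "e > 0" "\<And>x. x \<in> {a..b} \<Longrightarrow> \<exists>B\<in>range (\<lambda>t. ball t (\<epsilon> t)). ball x e \<subseteq> B"
    proof (rule Heine_Borel_lemma[of "{a..b}" "range (\<lambda>t. ball t (\<epsilon> t))"])
      show "{a..b} \<subseteq> (\<Union>t. ball t (\<epsilon> t))" using \<epsilon>(1) centre_in_ball by blast
    qed auto
    obtain k :: nat where k: "(b - a) / e < real k" using reals_Archimedean2 by blast
    have kpos: "k > 0" using k that e(1) by (metis divide_pos_pos diff_gt_0_iff_gt less_trans of_nat_0_less_iff)
    define h where "h = (b - a) / k"
    have h: "0 < h" "h < e" "k * h = b - a"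
      using k kpos that e(1) by (auto simp: h_def field_simps)
    have loc: "dist (\<gamma> r) (\<gamma> s) = \<bar>r - s\<bar>" if "x \<in> {a..b}" "\<bar>x - r\<bar> < e" "\<bar>x - s\<bar> < e" for x r s
    proof -
      from e(2)[OF that(1)] obtain t where "ball x e \<subseteq> ball t (\<epsilon> t)" by blast
      then have "r \<in> ball t (\<epsilon> t)" "s \<in> ball t (\<epsilon> t)" using that by (auto simp: dist_real_def)
      then show ?thesis using \<epsilon>(2)[of t] unfolding shortest_path_on_def by blast
    qed
    define x where "x i = \<gamma> (a + real i * h)" for i :: nat
    have inab: "a + real i * h \<in> {a..b}" if "i \<le> k" for i
      using that h mult_right_mono[of "real i" "real k" h] by auto
    have nb: "dist (x i) (x (Suc i)) = h" if "i \<le> k" for i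
      using loc[OF inab[OF that], of "a + real i * h" "a + real (Suc i) * h"] h
      by (simp add: x_def algebra_simps)
    \<comment> \<open>The window is centred at the middle point, so \<open>h < e\<close> is enough
      although the outer points are \<open>2 * h\<close> apart.\<close>
    have nb2: "dist (x i) (x (Suc (Suc i))) = 2 * h" if "Suc i \<le> k" for i
      using loc[OF inab[OF that], of "a + real i * h" "a + real (Suc (Suc i)) * h"] h
      by (simp add: x_def algebra_simps)
    have mid: "intermediate_point (x i) (1/2) (x (i + 2)) = x (i + 1)" if "i + 2 \<le> k" for i
      by (rule intermediate_point_eqI) (use nb[of i] nb[of "Suc i"] nb2[of i] that in \<open>auto simp: dist_commute\<close>)
    have "dist (x 0) (x 0) + real k * (dist (x 0) (x 1) - dist (x 0) (x 0)) \<le> dist (x 0) (x k)"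
    proof (rule discrete_convex_lower_bound[of k])
      fix i assume "i + 2 \<le> k"
      then show "2 * dist (x 0) (x (i + 1)) \<le> dist (x 0) (x i) + dist (x 0) (x (i + 2))"
        using dist_intermediate_convex[of "1/2" "x 0" "x 0" "x i" "x (i + 2)"] mid[of i]
        by (simp add: intermediate_point_self)
    qed simp
    then have lower: "b - a \<le> dist (x 0) (x k)" using nb[of 0] h by simp
    have "j \<le> k \<Longrightarrow> dist (x 0) (x j) \<le> real j * h" for j
    proof (induction j)
      case (Suc j)
      then show ?case using nb[of j] dist_triangle[of "x 0" "x (Suc j)" "x j"] by (simp add: algebra_simps)
    qed simp
    from this[of k] lower show ?thesis using h by (simp add: x_def)
  qed
  show ?thesis unfolding geodesic_line_def
  proof (intro allI)
    fix s t show "dist (\<gamma> s) (\<gamma> t) = \<bar>s - t\<bar>"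
      using main[of s t] main[of t s] by (cases s t rule: linorder_cases) (auto simp: dist_commute)
  qed
qed

lemma intermediate_point_geodesic_line:
  assumes "geodesic_line (\<gamma> :: real \<Rightarrow> 'a)" "0 \<le> t" "t \<le> 1"
  shows "intermediate_point (\<gamma> a) t (\<gamma> b) = \<gamma> (a + t * (b - a))"
proof (rule intermediate_point_eqI)
  show "dist (\<gamma> a) (\<gamma> (a + t * (b - a))) = t * dist (\<gamma> a) (\<gamma> b)"
    using assms by (simp add: geodesic_lineD abs_mult abs_minus_commute)
  have "a + t * (b - a) - b = (1 - t) * (a - b)" by (simp add: algebra_simps)
  then show "dist (\<gamma> (a + t * (b - a))) (\<gamma> b) = (1 - t) * dist (\<gamma> a) (\<gamma> b)"
    using assms by (simp add: geodesic_lineD abs_mult)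
qed (use assms in auto)

lemma dist_geodesic_lines_midpoint:
  assumes "geodesic_line (\<gamma> :: real \<Rightarrow> 'a)" "geodesic_line \<eta>"
  shows "2 * dist (\<gamma> ((r + s) / 2)) (\<eta> ((r + s) / 2)) \<le> dist (\<gamma> r) (\<eta> r) + dist (\<gamma> s) (\<eta> s)"
proof -
  have *: "r + 1/2 * (s - r) = (r + s) / 2" by (simp add: field_simps)
  show ?thesis
    using dist_intermediate_convex[of "1/2" "\<gamma> r" "\<gamma> s" "\<eta> r" "\<eta> s"] assms
    by (simp add: intermediate_point_geodesic_line) (simp add: field_simps *)
qed

text \<open>The distance between two lines is midpoint convex in the parameter. The bound is
  required only at the points \<open>a + i * c\<close>, where powers of a translation can be
  evaluated later.\<close>

lemma asymptotic_geodesic_lines_antimono: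
  assumes \<gamma>: "geodesic_line (\<gamma> :: real \<Rightarrow> 'a)" and \<eta>: "geodesic_line \<eta>"
    and bdd: "\<And>i::nat. dist (\<gamma> (a + i * c)) (\<eta> (a + i * c)) \<le> C"
  shows "dist (\<gamma> (a + c)) (\<eta> (a + c)) \<le> dist (\<gamma> a) (\<eta> a)"
proof -
  define f where "f i = dist (\<gamma> (a + real i * c)) (\<eta> (a + real i * c))" for i :: nat
  have "f 1 \<le> f 0"
  proof (rule discrete_convex_bounded)
    fix i
    have *: "((a + real i * c) + (a + real (i + 2) * c)) / 2 = a + real (i + 1) * c"
      by (simp add: field_simps)
    show "2 * f (i + 1) \<le> f i + f (i + 2)"
      using dist_geodesic_lines_midpoint[OF \<gamma> \<eta>, of "a + real i * c" "a + real (i + 2) * c"]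
      unfolding * f_def .
    show "f i \<le> C" using bdd by (simp add: f_def)
  qed
  then show ?thesis by (simp add: f_def)
qed

section \<open>Flows as limits of contractions\<close>

subsection \<open>The flow towards an end of a line\<close>

text \<open>Moving \<open>x\<close> towards \<open>\<gamma> n\<close> by the fraction
  \<open>s / n\<close> of the distance shifts it by roughly \<open>s\<close>, as
  \<open>dist x (\<gamma> n)\<close> differs from \<open>n\<close> by a bounded amount when \<gamma>
  is a line. The index \<open>0\<close> and fractions above 1 concern only finitely many
  terms.\<close>

definition line_flow :: "(real \<Rightarrow> 'a) \<Rightarrow> real \<Rightarrow> 'a \<Rightarrow> 'a" where
  "line_flow \<gamma> s x = lim (\<lambda>n. intermediate_point (\<gamma> (real n)) (1 - s / real n) x)"

text \<open>Seen from \<open>x\<close>, approximation \<open>n\<close> lies at fraction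
  \<open>s / n\<close> towards \<open>\<gamma> n\<close>. For \<open>k \<ge> n\<close> let
  \<open>w\<close> be at fraction \<open>n / k\<close> towards \<open>\<gamma> k\<close>:
  approximation \<open>k\<close> lies at fraction \<open>s / n\<close> towards \<open>w\<close>, and
  \<open>w\<close> is within \<open>dist x (\<gamma> 0)\<close> of \<open>\<gamma> n\<close>.
  Contraction about \<open>x\<close> gives a Cauchy sequence, with the error rate that the measure
  estimate uses.\<close>

lemma
  assumes \<gamma>: "geodesic_line (\<gamma> :: real \<Rightarrow> 'a)" and s: "0 \<le> s"
  shows line_flow_tendsto: "(\<lambda>n. intermediate_point (\<gamma> (real n)) (1 - s / real n) x) \<longlonglongrightarrow> line_flow \<gamma> s x"
    and dist_line_flow_approx: "n \<ge> 1 \<Longrightarrow> s \<le> real n \<Longrightarrow>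
      dist (intermediate_point (\<gamma> (real n)) (1 - s / real n) x) (line_flow \<gamma> s x) \<le> s * dist x (\<gamma> 0) / real n"
proof -
  define F where "F n = intermediate_point (\<gamma> (real n)) (1 - s / real n) x" for n :: nat
  define C where "C = s * dist x (\<gamma> 0)"
  have C: "0 \<le> C" using s by (simp add: C_def)
  have step: "dist (F n) (F k) \<le> C / real n" if "n \<ge> 1" "s \<le> real n" "n \<le> k" for n k
  proof -
    define y y' w where "y = \<gamma> (real n)" and "y' = \<gamma> (real k)" and
      "w = intermediate_point x (real n / real k) y'"
    have k: "k \<ge> 1" "s \<le> real k" using that by auto
    have r: "0 \<le> real n / real k" "real n / real k \<le> 1" using that by (auto simp: divide_le_eq)
    have sn: "0 \<le> s / real n" "s / real n \<le> 1" using that s by (auto simp: divide_le_eq)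
    have sk: "0 \<le> s / real k" "s / real k \<le> 1" using k s by (auto simp: divide_le_eq)
    have Fn: "F n = intermediate_point x (s / real n) y"
      using sn by (simp add: F_def y_def intermediate_point_commute)
    have Fk: "F k = intermediate_point x (s / real k) y'"
      using sk by (simp add: F_def y'_def intermediate_point_commute)
    \<comment> \<open>Fractions along one segment multiply:
      \<open>(s / n) * (n / k) = s / k\<close>.\<close>
    also have "\<dots> = intermediate_point x (s / real n) w"
    proof (rule intermediate_point_eqI)
      have dw: "dist x w = real n / real k * dist x y'" unfolding w_def using r by (rule dist_intermediate_left)
      have wy: "dist w y' = (1 - real n / real k) * dist x y'" unfolding w_def using r by (rule dist_intermediate_right)
      let ?z = "intermediate_point x (s / real n) w"
      have 1: "dist x ?z = s / real k * dist x y'"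
        using dist_intermediate_left[OF sn, of x w] dw that k by simp
      have 2: "dist ?z w = (1 - s / real n) * (real n / real k * dist x y')"
        using dist_intermediate_right[OF sn, of x w] dw by simp
      have "dist ?z y' \<le> dist ?z w + dist w y'" by (rule dist_triangle)
      also have "\<dots> = (1 - s / real k) * dist x y'" unfolding 2 wy using that k by (simp add: field_simps)
      finally have 3: "dist ?z y' \<le> (1 - s / real k) * dist x y'" .
      have "dist x y' \<le> dist x ?z + dist ?z y'" by (rule dist_triangle)
      then have 4: "dist ?z y' \<ge> (1 - s / real k) * dist x y'" using 1 by (simp add: algebra_simps)
      show "dist x ?z = s / real k * dist x y'" by (fact 1)
      show "dist ?z y' = (1 - s / real k) * dist x y'" using 3 4 by (rule antisym)
    qed (use sk in auto)
    finally have Fk: "F k = intermediate_point x (s / real n) w" .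
    \<comment> \<open>\<open>y\<close> and \<open>w\<close> divide two segments with the common end
      \<open>y'\<close> in the same ratio.\<close>
    have y: "y = intermediate_point (\<gamma> 0) (real n / real k) y'"
      unfolding y_def y'_def using \<gamma> r k by (simp add: intermediate_point_geodesic_line)
    have "dist y w \<le> (1 - real n / real k) * dist (\<gamma> 0) x"
      unfolding y w_def using dist_intermediate_convex[OF r, of "\<gamma> 0" y' x y'] by simp
    also have "\<dots> \<le> dist x (\<gamma> 0)" using r by (simp add: dist_commute mult_left_le_one_le)
    finally have yw: "dist y w \<le> dist x (\<gamma> 0)" .
    have "dist (F n) (F k) \<le> s / real n * dist y w"
      unfolding Fn Fk using sn by (rule intermediate_point_contraction)
    also have "\<dots> \<le> s / real n * dist x (\<gamma> 0)" using yw sn(1) by (rule mult_left_mono)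
    finally show ?thesis by (simp add: C_def)
  qed
  have "Cauchy F"
    unfolding Cauchy_altdef
  proof (intro allI impI)
    fix e :: real assume e: "e > 0"
    obtain M :: nat where M: "real M > max 1 (max s (C / e))" using reals_Archimedean2 by blast
    show "\<exists>M. \<forall>m\<ge>M. \<forall>n>m. dist (F m) (F n) < e"
    proof (intro exI allI impI)
      fix m n assume mn: "M \<le> m" "m < n"
      then have m: "real m > 1" "s \<le> real m" "C / e < real m" using M by linarith+
      have "dist (F m) (F n) \<le> C / real m" using step[of m n] m mn by auto
      also have "\<dots> < e" using m e by (simp add: field_simps)
      finally show "dist (F m) (F n) < e" .
    qed
  qed
  moreover have "complete (UNIV :: 'a set)" using busemann by (simp add: busemann_space_def)
  ultimately have "convergent F" unfolding complete_def convergent_def by blast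
  then have lim: "F \<longlonglongrightarrow> line_flow \<gamma> s x"
    unfolding line_flow_def F_def convergent_LIMSEQ_iff .
  then show "(\<lambda>n. intermediate_point (\<gamma> (real n)) (1 - s / real n) x) \<longlonglongrightarrow> line_flow \<gamma> s x"
    by (simp add: F_def[abs_def])
  show "dist (intermediate_point (\<gamma> (real n)) (1 - s / real n) x) (line_flow \<gamma> s x) \<le> s * dist x (\<gamma> 0) / real n"
    if n: "n \<ge> 1" "s \<le> real n"
  proof (rule tendsto_upperbound)
    show "(\<lambda>k. dist (F n) (F k)) \<longlonglongrightarrow> dist (intermediate_point (\<gamma> (real n)) (1 - s / real n) x) (line_flow \<gamma> s x)"
      using tendsto_dist[OF tendsto_const lim] by (simp add: F_def)
    show "\<forall>\<^sub>F k in sequentially. dist (F n) (F k) \<le> s * dist x (\<gamma> 0) / real n"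
      using eventually_ge_at_top[of n] by eventually_elim (use step n in \<open>simp add: C_def\<close>)
  qed simp
qed

lemma line_flow_nonexpansive:
  assumes "geodesic_line (\<gamma> :: real \<Rightarrow> 'a)" "0 \<le> s"
  shows "dist (line_flow \<gamma> s x) (line_flow \<gamma> s y) \<le> dist x y"
proof (rule tendsto_upperbound)
  show "(\<lambda>n. dist (intermediate_point (\<gamma> (real n)) (1 - s / real n) x) (intermediate_point (\<gamma> (real n)) (1 - s / real n) y))
     \<longlonglongrightarrow> dist (line_flow \<gamma> s x) (line_flow \<gamma> s y)"
    using assms by (intro tendsto_dist line_flow_tendsto)
  show "\<forall>\<^sub>F n in sequentially. dist (intermediate_point (\<gamma> (real n)) (1 - s / real n) x)
      (intermediate_point (\<gamma> (real n)) (1 - s / real n) y) \<le> dist x y"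
    using eventually_ge_at_top[of "nat \<lceil>max 1 s\<rceil>"]
  proof eventually_elim
    case (elim n)
    then have "0 \<le> s / real n" "s / real n \<le> 1" using assms(2) by (auto simp: divide_le_eq)
    then show ?case using intermediate_point_contraction[of "1 - s / real n" "\<gamma> (real n)" x y]
      by (smt (verit, best) mult_left_le_one_le zero_le_dist)
  qed
qed simp

lemma line_flow_bounded_displacement:
  assumes \<gamma>: "geodesic_line (\<gamma> :: real \<Rightarrow> 'a)" and s: "0 \<le> s"
  shows "dist x (line_flow \<gamma> s x) \<le> s"
proof (rule tendsto_le)
  show "(\<lambda>n. dist x (intermediate_point (\<gamma> (real n)) (1 - s / real n) x)) \<longlonglongrightarrow> dist x (line_flow \<gamma> s x)"
    using assms by (intro tendsto_dist line_flow_tendsto tendsto_const)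
  have "(\<lambda>n. s + s * dist x (\<gamma> 0) * (1 / real n)) \<longlonglongrightarrow> s + s * dist x (\<gamma> 0) * 0"
    by (intro tendsto_intros lim_1_over_n)
  then show "(\<lambda>n. s + s * dist x (\<gamma> 0) * (1 / real n)) \<longlonglongrightarrow> s" by simp
  show "\<forall>\<^sub>F n in sequentially. dist x (intermediate_point (\<gamma> (real n)) (1 - s / real n) x)
     \<le> s + s * dist x (\<gamma> 0) * (1 / real n)"
    using eventually_ge_at_top[of "nat \<lceil>max 1 s\<rceil>"]
  proof eventually_elim
    case (elim n)
    then have n: "n \<ge> 1" "s \<le> real n" by auto
    then have "0 \<le> s / real n" "s / real n \<le> 1" using s by (auto simp: divide_le_eq)
    then have "dist x (intermediate_point (\<gamma> (real n)) (1 - s / real n) x) = s / real n * dist (\<gamma> (real n)) x"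
      using dist_intermediate_right[of "1 - s / real n" "\<gamma> (real n)" x] by (simp add: dist_commute)
    also have "\<dots> \<le> s / real n * (real n + dist x (\<gamma> 0))"
      using dist_triangle[of "\<gamma> (real n)" x "\<gamma> 0"] s
      by (intro mult_left_mono) (auto simp: geodesic_lineD[OF \<gamma>] dist_commute)
    also have "\<dots> = s + s * dist x (\<gamma> 0) * (1 / real n)" using n by (simp add: field_simps)
    finally show ?case .
  qed
qed simp

text \<open>On the line the approximations are explicit: they have the parameters
  \<open>r + s - s * r / n\<close>.\<close>

lemma line_flow_line:
  assumes \<gamma>: "geodesic_line (\<gamma> :: real \<Rightarrow> 'a)" and s: "0 \<le> s"
  shows "line_flow \<gamma> s (\<gamma> r) = \<gamma> (r + s)"
proof (rule LIMSEQ_unique[OF line_flow_tendsto[OF assms]])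
  have "(\<lambda>n. r + s - s * r * (1 / real n)) \<longlonglongrightarrow> r + s - s * r * 0"
    by (intro tendsto_intros lim_1_over_n)
  then have "(\<lambda>n. r + s - s * r * (1 / real n)) \<longlonglongrightarrow> r + s" by simp
  moreover have "continuous_on UNIV \<gamma>"
    by (rule continuous_onI) (use \<gamma> in \<open>auto simp: geodesic_lineD dist_real_def\<close>)
  then have "isCont \<gamma> (r + s)" by (simp add: continuous_on_eq_continuous_at)
  ultimately have "(\<lambda>n. \<gamma> (r + s - s * r * (1 / real n))) \<longlonglongrightarrow> \<gamma> (r + s)"
    by (rule isCont_tendsto_compose[rotated])
  then show "(\<lambda>n. intermediate_point (\<gamma> (real n)) (1 - s / real n) (\<gamma> r)) \<longlonglongrightarrow> \<gamma> (r + s)"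
  proof (rule Lim_transform_eventually)
    show "\<forall>\<^sub>F n in sequentially. \<gamma> (r + s - s * r * (1 / real n)) =
        intermediate_point (\<gamma> (real n)) (1 - s / real n) (\<gamma> r)"
      using eventually_ge_at_top[of "nat \<lceil>max 1 s\<rceil>"]
    proof eventually_elim
      case (elim n)
      then have n: "n \<ge> 1" "s \<le> real n" by auto
      then have "0 \<le> s / real n" "s / real n \<le> 1" using s by (auto simp: divide_le_eq)
      moreover have "real n + (1 - s / real n) * (r - real n) = r + s - s * r * (1 / real n)"
        using n by (simp add: field_simps)
      ultimately show ?case using \<gamma> by (simp add: intermediate_point_geodesic_line)
    qed
  qed
qed

end

locale complete_Busemann = Busemann dummy for dummy :: "'a::metric_space itself" +
  assumes geodesically_complete: "geodesically_complete TYPE('a)"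
begin

text \<open>Completeness extends the segment only to a local geodesic; in a Busemann space that is a
  line. Distinct end points give a parameter interval of positive length, as
  \<open>geodesic_on\<close> demands.\<close>

lemma geodesic_line_through:
  assumes "(p::'a) \<noteq> q"
  obtains \<gamma> where "geodesic_line \<gamma>" "\<gamma> 0 = p" "\<gamma> (dist p q) = q"
proof -
  obtain \<gamma> where \<gamma>: "shortest_path_between \<gamma> p q" by (rule shortest_path_exists)
  let ?I = "{0..dist p q}"
  have iso: "\<forall>s\<in>?I. \<forall>t\<in>?I. dist (\<gamma> s) (\<gamma> t) = \<bar>s - t\<bar>"
    using \<gamma> by (auto simp: shortest_path_between_def shortest_path_on_def)
  have "geodesic_on ?I \<gamma>" unfolding geodesic_on_def
  proof (intro conjI ballI)
    show "\<exists>a\<in>?I. \<exists>b\<in>?I. a < b" using assms by (intro bexI[of _ 0] bexI[of _ "dist p q"]) auto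
    show "continuous_on ?I \<gamma>"
      by (rule continuous_onI) (use iso in \<open>auto simp: dist_real_def\<close>)
    fix t
    show "\<exists>\<epsilon>>0. shortest_path_on (?I \<inter> ball t \<epsilon>) \<gamma>"
      unfolding shortest_path_on_def using iso
      by (intro exI[of _ 1]) (auto intro!: is_interval_Int simp: is_interval_cc is_interval_ball_real)
  qed (simp add: is_interval_cc)
  then obtain \<gamma>' where \<gamma>': "geodesic_on UNIV \<gamma>'" "\<And>t. t \<in> ?I \<Longrightarrow> \<gamma>' t = \<gamma> t"
    using geodesically_complete unfolding geodesically_complete_def by blast
  show ?thesis
  proof
    show "geodesic_line \<gamma>'" using \<gamma>'(1) by (rule geodesic_imp_geodesic_line)
    show "\<gamma>' 0 = p" "\<gamma>' (dist p q) = q" using \<gamma>'(2) \<gamma> by (auto simp: shortest_path_between_def)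
  qed
qed

end

section \<open>Measure contraction in Busemann spaces\<close>

text \<open>Follow \<open>x\<close> and \<open>y\<close> backwards along preimages \<open>a\<close>
  and \<open>b\<close>: distances do not decrease. By compactness both backward orbits nearly return
  after a common number \<open>k\<close> of steps, so \<open>dist x y\<close>, which is at most the
  distance at index \<open>k\<close>, is nearly bounded by the distance at index \<open>0\<close>,
  that of the images.\<close>

lemma compact_surjective_nonexpansive_imp_isometry:
  fixes G :: "'a::metric_space \<Rightarrow> 'a"
  assumes B: "compact B" and surj: "G ` B = B"
    and le: "\<And>x y. x \<in> B \<Longrightarrow> y \<in> B \<Longrightarrow> dist (G x) (G y) \<le> dist x y"
    and xy: "x \<in> B" "y \<in> B"
  shows "dist (G x) (G y) = dist x y"
proof (rule antisym)
  show "dist (G x) (G y) \<le> dist x y" using le xy by blast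
  have orbit: "\<exists>a. a 0 = G z \<and> a 1 = z \<and> (\<forall>i. a i \<in> B) \<and> (\<forall>i. G (a (Suc i)) = a i)" if "z \<in> B" for z
  proof -
    define H where "H = inv_into B G"
    have H: "H u \<in> B" "G (H u) = u" if "u \<in> B" for u
      using that surj by (auto simp: H_def inv_into_into f_inv_into_f)
    have Hn: "(H ^^ i) z \<in> B" for i using that H by (induction i) auto
    define a where "a i = (case i of 0 \<Rightarrow> G z | Suc j \<Rightarrow> (H ^^ j) z)" for i
    have "G (a (Suc i)) = a i" for i by (cases i) (auto simp: a_def H Hn)
    moreover have "a i \<in> B" for i using that surj Hn by (cases i) (auto simp: a_def)
    ultimately show ?thesis by (intro exI[of _ a]) (auto simp: a_def)
  qed
  obtain a where a: "a 0 = G x" "a 1 = x" "\<And>i. a i \<in> B" "\<And>i. G (a (Suc i)) = a i"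
    using orbit[OF xy(1)] by blast
  obtain b where b: "b 0 = G y" "b 1 = y" "\<And>i. b i \<in> B" "\<And>i. G (b (Suc i)) = b i"
    using orbit[OF xy(2)] by blast
  have mono: "dist (a i) (b i) \<le> dist (a j) (b j)" if "i \<le> j" for i j
    by (rule lift_Suc_mono_le[OF _ that]) (metis a(3,4) b(3,4) le)
  \<comment> \<open>Applying \<open>G\<close> lowers both indices without increasing the distance,
    so a near-return at a late index is also one at index \<open>0\<close>.\<close>
  have descend: "dist (c i) (c (i + k)) \<ge> dist (c 0) (c k)"
    if "\<And>i. c i \<in> B" "\<And>i. G (c (Suc i)) = c i" for c :: "nat \<Rightarrow> 'a" and i k
  proof (induction i)
    case (Suc i)
    have "dist (c i) (c (i + k)) \<le> dist (c (Suc i)) (c (Suc i + k))"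
      using le[OF that(1) that(1), of "Suc i" "Suc i + k"] that(2) by simp
    then show ?case using Suc by simp
  qed simp
  show "dist x y \<le> dist (G x) (G y)"
  proof (rule field_le_epsilon)
    fix e :: real assume e: "e > 0"
    have "seq_compact (B \<times> B)" using B by (intro compact_imp_seq_compact compact_Times)
    moreover have "\<forall>i. (a i, b i) \<in> B \<times> B" using a b by simp
    ultimately obtain l r where r: "strict_mono r" "((\<lambda>i. (a i, b i)) \<circ> r) \<longlonglongrightarrow> l"
      by (rule seq_compactE[where f = "\<lambda>i. (a i, b i)"])
    then have "Cauchy ((\<lambda>i. (a i, b i)) \<circ> r)" by (intro LIMSEQ_imp_Cauchy)
    from metric_CauchyD[OF this, of "e / 2"] obtain M
      where "\<forall>i\<ge>M. \<forall>j\<ge>M. dist (((\<lambda>i. (a i, b i)) \<circ> r) i) (((\<lambda>i. (a i, b i)) \<circ> r) j) < e / 2"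
      using e by auto
    then have M: "\<And>i j. i \<ge> M \<Longrightarrow> j \<ge> M \<Longrightarrow> dist (a (r i), b (r i)) (a (r j), b (r j)) < e / 2"
      by simp
    define n k where "n = r M" and "k = r (Suc M) - r M"
    have k: "k \<ge> 1" "r (Suc M) = n + k" using strict_monoD[OF r(1), of M "Suc M"] by (auto simp: n_def k_def)
    have "dist (a n) (a (n + k)) < e / 2" "dist (b n) (b (n + k)) < e / 2"
      using M[of M "Suc M"] k(2) dist_fst_le[of "(a n, b n)" "(a (n + k), b (n + k))"]
        dist_snd_le[of "(a n, b n)" "(a (n + k), b (n + k))"] by (auto simp: n_def)
    then have "dist (a 0) (a k) < e / 2" "dist (b 0) (b k) < e / 2"
      using descend[where c = a and i = n and k = k, OF a(3,4)] descend[where c = b and i = n and k = k, OF b(3,4)] by linarith+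
    moreover have "dist x y \<le> dist (a k) (b k)" using mono[OF k(1)] a(2) b(2) by simp
    moreover have "dist (a k) (b k) \<le> dist (a 0) (a k) + dist (a 0) (b 0) + dist (b 0) (b k)"
      using dist_triangle[of "a k" "b k" "a 0"] dist_triangle[of "a 0" "b k" "b 0"] by (simp add: dist_commute)
    ultimately show "dist x y \<le> dist (G x) (G y) + e" using a(1) b(1) by simp
  qed
qed

section \<open>Finite measure and compactness of balls\<close>

locale MCP_Busemann = complete_Busemann dummy for dummy :: "'a::metric_space itself" +
  fixes m :: "'a measure" and N :: real
  assumes mms: "metric_measure_space m" and mcp: "MCP0 N m"
begin

lemma sets_m [measurable_cong, simp]: "sets m = sets borel"
  using mms by (simp add: metric_measure_space_def)

lemma space_m [simp]: "space m = UNIV"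
  using sets_eq_imp_space_eq[OF sets_m] by simp

lemma complete_UNIV: "complete (UNIV :: 'a set)"
  using mms by (simp add: metric_measure_space_def)

lemma countable_dense:
  obtains D :: "'a set" where "countable D" "\<And>x e. e > 0 \<Longrightarrow> \<exists>y\<in>D. dist y x < e"
proof -
  obtain D :: "'a set" where D: "countable D" "closure D = UNIV"
    using mms by (auto simp: metric_measure_space_def separable_space_def)
  show ?thesis
    by (rule that[OF D(1)]) (use D(2) in \<open>metis UNIV_I closure_approachable\<close>)
qed

lemma small_ball_finite:
  obtains r where "r > 0" "emeasure m (ball x r) < \<infinity>"
proof -
  obtain U where U: "open U" "x \<in> U" "emeasure m U < \<infinity>"
    using mms by (auto simp: metric_measure_space_def)
  then obtain r where r: "r > 0" "ball x r \<subseteq> U" by (meson open_contains_ball)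
  then have "emeasure m (ball x r) \<le> emeasure m U" using U by (intro emeasure_mono) auto
  then show ?thesis using that r U by (meson le_less_trans)
qed

lemma open_pos: "open U \<Longrightarrow> U \<noteq> {} \<Longrightarrow> 0 < emeasure m U"
  using mms by (simp add: metric_measure_space_def)

text \<open>Balls of finite measure with rational radii and dense centres are countably many and
  cover the space. This precedes finiteness of all balls, whose proof needs subsets of finite but
  large measure.\<close>

lemma sigma_finite: "sigma_finite_measure m"
proof
  obtain D :: "'a set" where D: "countable D" "\<And>x e. e > 0 \<Longrightarrow> \<exists>y\<in>D. dist y x < e"
    by (rule countable_dense) blast
  define A where "A = {B. \<exists>y\<in>D. \<exists>q\<in>\<rat>. B = ball y q \<and> emeasure m B < \<infinity>}"
  have "A \<subseteq> (\<lambda>(y, q). ball y q) ` (D \<times> \<rat>)" by (auto simp: A_def)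
  then have cntA: "countable A" by (rule countable_subset) (intro countable_image countable_SIGMA D countable_rat)
  have "x \<in> \<Union>A" for x
  proof -
    obtain r where r: "r > 0" "emeasure m (ball x r) < \<infinity>" by (rule small_ball_finite)
    obtain q where q: "q \<in> \<rat>" "0 < q" "q < r / 2"
      using Rats_dense_in_real[of 0 "r/2"] r by auto
    obtain y where y: "y \<in> D" "dist y x < q" using D(2) q by blast
    have "ball y q \<subseteq> ball x r" using y q by (auto simp: dist_commute) (smt (verit) dist_triangle dist_commute)
    then have "emeasure m (ball y q) \<le> emeasure m (ball x r)" by (intro emeasure_mono) auto
    then have "emeasure m (ball y q) < \<infinity>" using r(2) by (rule le_less_trans)
    then have "ball y q \<in> A" using y q by (auto simp: A_def)
    then show ?thesis using y by (intro UnionI[of "ball y q"]) (auto simp: dist_commute)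
  qed
  then have "\<Union>A = space m" by (metis UNIV_eq_I space_m)
  moreover have "A \<subseteq> sets m" "\<forall>a\<in>A. emeasure m a \<noteq> \<infinity>" by (auto simp: A_def less_top)
  ultimately show "\<exists>A. countable A \<and> A \<subseteq> sets m \<and> \<Union> A = space m \<and> (\<forall>a\<in>A. emeasure m a \<noteq> \<infinity>)"
    using cntA by blast
qed

lemma contraction_image_ball: "0 < t \<Longrightarrow> t \<le> 1 \<Longrightarrow>
    intermediate_point p t ` ball p R \<subseteq> ball (p::'a) (t * R)"
  by (auto simp: dist_intermediate_left)

lemma mcp_outer:
  assumes "A \<in> sets m" "emeasure m A < \<infinity>" "0 \<le> t" "t \<le> 1"
  shows "ennreal (t powr N) * emeasure m A \<le> outer_measure_of m (intermediate_point p t ` A)"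
  using mcp assms unfolding MCP0_def by (cases "emeasure m A = 0") (auto simp: zero_less_iff_neq_zero)

text \<open>Measure contraction applies only to sets of finite measure, so a ball of infinite
  measure is approximated from inside by such sets. One of them would be contracted into a small
  ball of finite measure while keeping too much of its own.\<close>

lemma emeasure_ball_finite: "emeasure m (ball p R) < \<infinity>"
proof (cases "R > 0")
  case True
  show ?thesis
  proof (rule ccontr)
    assume "\<not> emeasure m (ball p R) < \<infinity>"
    then have inf: "emeasure m (ball p R) = \<infinity>" by (metis infinity_ennreal_def top.not_eq_extremum)
    obtain r where r: "r > 0" "emeasure m (ball p r) < \<infinity>" by (rule small_ball_finite)
    \<comment> \<open>Chosen so that \<open>t * R < r\<close>; \<open>C\<close> is then the largest
      measure that can be contracted by \<open>t\<close> into \<open>ball p r\<close>.\<close>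
    define t where "t = r / (r + R)"
    have t: "0 < t" "t \<le> 1" "t * R < r" using r True by (auto simp: t_def field_simps)
    define C where "C = measure m (ball p r) / t powr N"
    interpret sigma_finite_measure m by (rule sigma_finite)
    obtain Z where Z: "Z \<in> sets m" "Z \<subseteq> ball p R" "emeasure m Z < \<infinity>" "emeasure m Z > C"
      using approx_PInf_emeasure_with_finite[OF _ inf, of C] by auto
    have "emeasure m (ball p r) = ennreal (t powr N) * ennreal C"
      using r(2) t by (simp add: C_def emeasure_eq_ennreal_measure ennreal_mult[symmetric])
    also have "\<dots> < ennreal (t powr N) * emeasure m Z"
      using Z(4) t by (intro ennreal_mult_strict_left_mono) auto
    also have "\<dots> \<le> outer_measure_of m (intermediate_point p t ` Z)"
      using Z t by (intro mcp_outer) auto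
    also have "\<dots> \<le> outer_measure_of m (ball p r)"
    proof (rule outer_measure_of_mono)
      have "intermediate_point p t ` Z \<subseteq> ball p (t * R)"
        using contraction_image_ball[of t p R] t Z(2) by auto
      also have "\<dots> \<subseteq> ball p r" using t by (intro subset_ball) auto
      finally show "intermediate_point p t ` Z \<subseteq> ball p r" .
    qed
    finally show False by simp
  qed
qed (simp add: not_less ball_empty)

lemma emeasure_bounded_finite: "bounded A \<Longrightarrow> emeasure m A < \<infinity>"
  by (metis bounded_subset_ballD emeasure_ball_finite emeasure_mono le_less_trans sets_m borel_open open_ball)

text \<open>Contraction about \<open>p\<close> by \<open>r / R\<close> maps the larger ball into the
  smaller one. This growth bound yields both compactness of balls and the bound on the
  dimension.\<close>

lemma Bishop_Gromov:
  assumes "0 < r" "r \<le> R"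
  shows "(r / R) powr N * measure m (ball p R) \<le> measure m (ball p r)"
proof -
  have t: "0 < r / R" "r / R \<le> 1" using assms by auto
  have "ennreal ((r / R) powr N) * emeasure m (ball p R) \<le> outer_measure_of m (intermediate_point p (r / R) ` ball p R)"
    using emeasure_ball_finite[of p R] t by (intro mcp_outer) auto
  also have "\<dots> \<le> outer_measure_of m (ball p r)"
    using contraction_image_ball[of "r / R" p R] t assms by (intro outer_measure_of_mono) auto
  finally show ?thesis
    using emeasure_ball_finite[of p R] emeasure_ball_finite[of p r]
    by (simp add: emeasure_eq_ennreal_measure less_top[symmetric] ennreal_mult[symmetric] ennreal_le_iff)
qed

lemma measure_ball_pos: "r > 0 \<Longrightarrow> measure m (ball p r) > 0"
  using open_pos[of "ball p r"] emeasure_ball_finite[of p r]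
  by (auto simp: measure_def enn2real_positive_iff less_top)

text \<open>Balls of radius \<open>e / 2\<close> about \<open>e\<close>-separated points are
  disjoint, and volume growth bounds their measures from below. Separated sets thus have bounded
  cardinality, a largest one is an \<open>e\<close>-net, and completeness gives compactness.\<close>

lemma compact_cball: "compact (cball (p::'a) R)"
proof (cases "R \<ge> 0")
  case True
  show ?thesis unfolding compact_eq_totally_bounded
  proof (intro conjI allI impI)
    show "complete (cball p R)"
      using complete_UNIV by (rule complete_closed_subset[rotated 2]) auto
    fix e :: real assume e: "e > 0"
    define M where "M = measure m (ball p (R + e))"
    \<comment> \<open>For \<open>x\<close> in the closed ball, \<open>ball x (2 * R + e)\<close>
      contains \<open>ball p (R + e)\<close>; \<open>c\<close> is the resulting lower bound for the
      measure of \<open>ball x (e / 2)\<close>.\<close>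
    define c where "c = (e / 2 / (2 * R + e)) powr N * M"
    have M: "M > 0" using True e by (simp add: M_def measure_ball_pos)
    then have c: "c > 0" using True e by (simp add: c_def)
    define sep where "sep S \<longleftrightarrow> finite S \<and> S \<subseteq> cball p R \<and> (\<forall>x\<in>S. \<forall>y\<in>S. x \<noteq> y \<longrightarrow> e \<le> dist x y)" for S
    have "real (card S) \<le> M / c" if "sep S" for S
    proof -
      have S: "finite S" "S \<subseteq> cball p R" "\<And>x y. x \<in> S \<Longrightarrow> y \<in> S \<Longrightarrow> x \<noteq> y \<Longrightarrow> e \<le> dist x y"
        using that by (auto simp: sep_def)
      have disj: "disjoint_family_on (\<lambda>x. ball x (e / 2)) S"
        unfolding disjoint_family_on_def
      proof (intro ballI impI)
        fix x y assume "x \<in> S" "y \<in> S" "x \<noteq> y"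
        then have "e \<le> dist x y" using S by blast
        then show "ball x (e / 2) \<inter> ball y (e / 2) = {}"
          by (intro disjoint_ballI) simp
      qed
      have "c \<le> measure m (ball x (e / 2))" if "x \<in> S" for x
      proof -
        have "dist p x \<le> R" using that S by auto
        then have "ball p (R + e) \<subseteq> ball x (2 * R + e)"
          by (auto simp: subset_iff) (smt (verit) dist_commute dist_triangle)
        then have "M \<le> measure m (ball x (2 * R + e))" unfolding M_def
          using emeasure_ball_finite[of x "2 * R + e"] by (intro measure_mono_fmeasurable) (auto simp: fmeasurable_def)
        then have "c \<le> (e / 2 / (2 * R + e)) powr N * measure m (ball x (2 * R + e))"
          unfolding c_def by (intro mult_left_mono) auto
        also have "\<dots> \<le> measure m (ball x (e / 2))" using True e by (intro Bishop_Gromov) auto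
        finally show ?thesis .
      qed
      then have "real (card S) * c \<le> (\<Sum>x\<in>S. measure m (ball x (e / 2)))"
        using sum_mono[of S "\<lambda>_. c" "\<lambda>x. measure m (ball x (e / 2))"] by simp
      also have "\<dots> = measure m (\<Union>x\<in>S. ball x (e / 2))"
        using S disj emeasure_ball_finite by (intro measure_finite_Union[symmetric]) (auto simp: less_top)
      also have "\<dots> \<le> M" unfolding M_def
      proof (rule measure_mono_fmeasurable)
        show "(\<Union>x\<in>S. ball x (e / 2)) \<subseteq> ball p (R + e)"
        proof (intro UN_least subsetI)
          fix x y assume "x \<in> S" "y \<in> ball x (e / 2)"
          then have "dist p x \<le> R" "dist x y < e / 2" using S by auto
          then show "y \<in> ball p (R + e)" using dist_triangle[of p y x] e by simp
        qed
      qed (use emeasure_ball_finite S(1) in \<open>auto simp: fmeasurable_def intro!: sets.finite_UN\<close>)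
      finally show ?thesis using c by (simp add: field_simps)
    qed
    then have bound: "\<forall>S. sep S \<longrightarrow> card S \<le> nat \<lceil>M / c\<rceil>" by (metis nat_ceiling_le_eq of_nat_le_iff real_nat_ceiling_ge order_trans)
    have "sep {}" by (simp add: sep_def)
    moreover have "\<forall>S. sep S \<longrightarrow> card S < Suc (nat \<lceil>M / c\<rceil>)" using bound by auto
    ultimately have "\<exists>S. sep S \<and> (\<forall>T. sep T \<longrightarrow> card T \<le> card S)" by (rule ex_has_greatest_nat)
    then obtain S where S: "sep S" "\<And>T. sep T \<Longrightarrow> card T \<le> card S" by blast
    show "\<exists>k. finite k \<and> cball p R \<subseteq> (\<Union>x\<in>k. ball x e)"
    proof (intro exI[of _ S] conjI subsetI)
      show "finite S" using S by (simp add: sep_def)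
      fix y assume y: "y \<in> cball p R"
      show "y \<in> (\<Union>x\<in>S. ball x e)"
      proof (rule ccontr)
        assume n: "y \<notin> (\<Union>x\<in>S. ball x e)"
        then have "\<And>x. x \<in> S \<Longrightarrow> e \<le> dist x y" by auto
        then have "sep (insert y S)" using S y by (auto simp: sep_def dist_commute)
        moreover have "y \<notin> S" using n e by auto
        ultimately show False using S(2)[of "insert y S"] S(1) by (simp add: sep_def)
      qed
    qed
  qed
qed (simp add: not_le)

section \<open>Measure of images under flows\<close>

lemma line_flow_continuous: "geodesic_line \<gamma> \<Longrightarrow> 0 \<le> s \<Longrightarrow> continuous_on A (line_flow \<gamma> s :: 'a \<Rightarrow> 'a)"
  by (rule continuous_onI) (meson line_flow_nonexpansive less_imp_le order_trans)

text \<open>The approximating contractions carry \<open>K\<close> into closed sets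
  \<open>V n\<close> that decrease to the compact image of \<open>K\<close>, so continuity from
  above turns the estimates for \<open>V n\<close> into one for the image. Closedness of
  \<open>V n\<close> replaces the outer measure by the measure.\<close>

lemma emeasure_line_flow_image:
  assumes \<gamma>: "geodesic_line (\<gamma> :: real \<Rightarrow> 'a)" and s: "0 \<le> s" and K: "compact K"
  shows "emeasure m K \<le> emeasure m (line_flow \<gamma> s ` K)"
proof (cases "K = {}")
  case False
  let ?F = "line_flow \<gamma> s"
  obtain \<rho> where \<rho>: "K \<subseteq> cball (\<gamma> 0) \<rho>" using K compact_imp_bounded bounded_subset_ballD ball_subset_cball by (metis order_trans)
  have \<rho>0: "\<rho> \<ge> 0" using False \<rho> by (metis cball_eq_empty not_le subset_empty)
  have FK: "compact (?F ` K)" using K line_flow_continuous[OF \<gamma> s] by (intro compact_continuous_image)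
  have Kb: "bounded K" "K \<in> sets m" using K by (auto simp: compact_imp_bounded compact_imp_closed)
  \<comment> \<open>The neighbourhood radius is the approximation error at index
    \<open>n + 1\<close> for points of \<open>K\<close>; the ball contains these approximations and
    makes all measures finite.\<close>
  define V where "V n = {z. infdist z (?F ` K) \<le> s * \<rho> / real (Suc n)} \<inter> cball (\<gamma> 0) (\<rho> + s + s * \<rho>)" for n
  have Vclosed: "closed (V n)" for n unfolding V_def
    by (intro closed_Int closed_cball closed_Collect_le continuous_intros)
  have Vfin: "emeasure m (V n) < \<infinity>" for n
    by (rule emeasure_bounded_finite) (auto simp: V_def intro: bounded_subset[OF bounded_cball])
  have disp: "dist (\<gamma> 0) (?F x) \<le> \<rho> + s" if "x \<in> K" for x
    using dist_triangle[of "\<gamma> 0" "?F x" x] line_flow_bounded_displacement[OF \<gamma> s, of x] \<rho> that by fastforce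
  have lower: "(1 - s / real (Suc n)) powr N * measure m K \<le> measure m (V n)" if n: "s \<le> real (Suc n)" for n
  proof -
    let ?t = "1 - s / real (Suc n)"
    have t: "0 \<le> ?t" "?t \<le> 1" using n s by (auto simp: divide_le_eq)
    have sub: "intermediate_point (\<gamma> (real (Suc n))) ?t ` K \<subseteq> V n"
    proof (rule image_subsetI)
      fix x assume x: "x \<in> K"
      let ?z = "intermediate_point (\<gamma> (real (Suc n))) ?t x"
      have "dist ?z (?F x) \<le> s * dist x (\<gamma> 0) / real (Suc n)"
        using n by (intro dist_line_flow_approx[OF \<gamma> s]) auto
      also have "\<dots> \<le> s * \<rho> / real (Suc n)"
        using x \<rho> s by (intro divide_right_mono mult_left_mono) (auto simp: dist_commute)
      finally have 1: "dist ?z (?F x) \<le> s * \<rho> / real (Suc n)" .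
      also have "\<dots> \<le> s * \<rho>" using divide_left_mono[of 1 "real (Suc n)" "s * \<rho>"] mult_nonneg_nonneg[OF s \<rho>0] by simp
      finally have "dist (\<gamma> 0) ?z \<le> \<rho> + s + s * \<rho>"
        using disp[OF x] dist_triangle[of "\<gamma> 0" ?z "?F x"] by (simp add: dist_commute)
      moreover have "infdist ?z (?F ` K) \<le> s * \<rho> / real (Suc n)"
        using 1 x by (intro infdist_le2[of "?F x"]) auto
      ultimately show "?z \<in> V n" by (simp add: V_def)
    qed
    have "ennreal (?t powr N) * emeasure m K \<le> outer_measure_of m (intermediate_point (\<gamma> (real (Suc n))) ?t ` K)"
      using Kb emeasure_bounded_finite t by (intro mcp_outer) auto
    also have "\<dots> \<le> outer_measure_of m (V n)" using sub by (rule outer_measure_of_mono)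
    also have "\<dots> = emeasure m (V n)" using Vclosed by (intro outer_measure_of_eq) auto
    finally show ?thesis
      using emeasure_bounded_finite[OF Kb(1)] Vfin[of n]
      by (simp add: emeasure_eq_ennreal_measure less_top[symmetric] ennreal_mult[symmetric] ennreal_le_iff)
  qed
  have "(\<lambda>n. measure m (V n)) \<longlonglongrightarrow> measure m (\<Inter>n. V n)"
  proof (rule Lim_measure_decseq)
    have "s * \<rho> / real (Suc k) \<le> s * \<rho> / real (Suc n)" if "n \<le> k" for n k
      by (rule divide_left_mono) (use s \<rho>0 that in auto)
    then show "decseq V" unfolding decseq_def V_def by (blast intro: order_trans)
  qed (use Vclosed Vfin in \<open>auto simp: less_top\<close>)
  moreover have "(\<Inter>n. V n) = ?F ` K"
  proof (intro equalityI subsetI)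
    fix z assume z: "z \<in> (\<Inter>n. V n)"
    have "(\<lambda>n. s * \<rho> / real (Suc n)) \<longlonglongrightarrow> 0"
      using LIMSEQ_Suc[OF lim_const_over_n[of "s * \<rho>"]] .
    moreover have "infdist z (?F ` K) \<le> s * \<rho> / real (Suc n)" for n using z by (auto simp: V_def)
    ultimately have "infdist z (?F ` K) \<le> 0" by (intro tendsto_lowerbound) auto
    then have "infdist z (?F ` K) = 0" using infdist_nonneg[of z "?F ` K"] by simp
    then show "z \<in> ?F ` K"
      using in_closed_iff_infdist_zero[OF compact_imp_closed[OF FK], of z] False by simp
  next
    fix z assume "z \<in> ?F ` K"
    then obtain x where x: "x \<in> K" "z = ?F x" by blast
    have "infdist z (?F ` K) = 0" using x by simp
    moreover have "0 \<le> s * \<rho>" using s \<rho>0 by simp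
    moreover have "dist (\<gamma> 0) z \<le> \<rho> + s + s * \<rho>" using disp[OF x(1)] x(2) \<open>0 \<le> s * \<rho>\<close> by simp
    ultimately show "z \<in> (\<Inter>n. V n)" by (simp add: V_def)
  qed
  ultimately have lim: "(\<lambda>n. measure m (V n)) \<longlonglongrightarrow> measure m (?F ` K)" by simp
  have "(\<lambda>n. (1 - s / real (Suc n)) powr N * measure m K) \<longlonglongrightarrow> (1 - 0) powr N * measure m K"
    by (intro tendsto_intros LIMSEQ_Suc[OF lim_const_over_n]) simp
  then have lim': "(\<lambda>n. (1 - s / real (Suc n)) powr N * measure m K) \<longlonglongrightarrow> measure m K" by simp
  have "measure m K \<le> measure m (?F ` K)"
  proof (rule tendsto_le[OF _ lim lim'])
    show "\<forall>\<^sub>F n in sequentially. (1 - s / real (Suc n)) powr N * measure m K \<le> measure m (V n)"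
      using eventually_ge_at_top[of "nat \<lceil>s\<rceil>"] by eventually_elim (use lower in auto)
  qed simp
  moreover have "emeasure m (?F ` K) < \<infinity>" using FK by (intro emeasure_bounded_finite compact_imp_bounded)
  ultimately show ?thesis
    using emeasure_bounded_finite[OF Kb(1)]
    by (simp add: emeasure_eq_ennreal_measure less_top[symmetric] ennreal_le_iff)
qed simp

text \<open>A closed ball about the fixed point is mapped into itself with an image of full measure.
  The part of the open ball missed by the compact image is open and null, hence empty, and boundary
  points are limits of points on their segments from \<open>p\<close>. So the map is onto the closed
  ball, and compactness makes it isometric.\<close>

lemma nonexpansive_measure_expanding_imp_isometry:
  fixes G :: "'a \<Rightarrow> 'a"
  assumes le: "\<And>x y. dist (G x) (G y) \<le> dist x y" and p: "G p = p"
    and meas: "\<And>K. compact K \<Longrightarrow> emeasure m K \<le> emeasure m (G ` K)"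
  shows "dist (G x) (G y) = dist x y" and "surj G"
proof -
  have cont: "continuous_on A G" for A by (rule continuous_onI) (meson le less_imp_le order_trans)
  have onto: "G ` cball p r = cball p r" if r: "r > 0" for r
  proof (intro equalityI)
    show sub: "G ` cball p r \<subseteq> cball p r"
      using le[of p] unfolding p by (auto intro: order_trans[OF le[of p, unfolded p]])
    have cG: "compact (G ` cball p r)" using cont compact_cball by (rule compact_continuous_image)
    then have cl: "closed (G ` cball p r)" by (rule compact_imp_closed)
    have fin: "emeasure m (cball p r) < \<infinity>" by (rule emeasure_bounded_finite) simp
    have "emeasure m (cball p r - G ` cball p r) = emeasure m (cball p r) - emeasure m (G ` cball p r)"
      using fin sub cl emeasure_mono[OF sub, of m] by (intro emeasure_Diff) (auto simp: less_top)
    also have "\<dots> = 0" using meas[OF compact_cball, of p r] using fin by (intro diff_eq_0_ennreal) auto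
    finally have null: "emeasure m (cball p r - G ` cball p r) = 0" .
    have "emeasure m (ball p r - G ` cball p r) \<le> emeasure m (cball p r - G ` cball p r)"
      using cl by (intro emeasure_mono) auto
    then have "ball p r - G ` cball p r = {}"
      using null open_pos[of "ball p r - G ` cball p r"] cl by (metis leD open_Diff open_ball)
    then have sub': "ball p r \<subseteq> G ` cball p r" by blast
    show "cball p r \<subseteq> G ` cball p r"
    proof
      fix y assume y: "y \<in> cball p r"
      show "y \<in> G ` cball p r"
      proof (rule closed_sequentially[OF cl])
        let ?t = "\<lambda>n. 1 - 1 / real (Suc n)"
        have t: "0 \<le> ?t n" "?t n < 1" for n by auto
        show "intermediate_point p (?t n) y \<in> G ` cball p r" for n
        proof -
          have "dist p (intermediate_point p (?t n) y) = ?t n * dist p y"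
            using t[of n] by (intro dist_intermediate_left) auto
          also have "\<dots> \<le> ?t n * r" using y t[of n] by (intro mult_left_mono) auto
          also have "\<dots> < 1 * r" using t[of n] r by (intro mult_strict_right_mono) auto
          finally show ?thesis using sub' by auto
        qed
        have "(\<lambda>n. dist p y / real (Suc n)) \<longlonglongrightarrow> 0"
          by (rule LIMSEQ_Suc[OF lim_const_over_n])
        moreover have "dist (intermediate_point p (?t n) y) y = dist p y / real (Suc n)" for n
          using dist_intermediate_right[of "?t n" p y] t[of n] by auto
        ultimately show "(\<lambda>n. intermediate_point p (?t n) y) \<longlonglongrightarrow> y"
          unfolding tendsto_dist_iff[of _ y] by simp
      qed
    qed
  qed
  show "dist (G x) (G y) = dist x y"
  proof (rule compact_surjective_nonexpansive_imp_isometry[OF compact_cball[of p "1 + dist p x + dist p y"]])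
    show "G ` cball p (1 + dist p x + dist p y) = cball p (1 + dist p x + dist p y)"
      by (rule onto) (smt (verit) zero_le_dist)
  qed (auto intro: le simp: add_increasing)
  show "surj G"
  proof
    show "UNIV \<subseteq> range G"
    proof
      fix y
      have "y \<in> cball p (1 + dist p y)" by simp
      also have "\<dots> = G ` cball p (1 + dist p y)" by (rule onto[symmetric]) (smt (verit) zero_le_dist)
      finally show "y \<in> range G" by blast
    qed
  qed simp
qed

text \<open>Flowing forth and back along a line fixes its points, does not expand distances, and does not
  decrease the measure; so it maps balls about points of the line onto themselves.\<close>

lemma
  assumes \<gamma>: "geodesic_line (\<gamma> :: real \<Rightarrow> 'a)" and s: "0 \<le> s"
  shows line_flow_isometry: "dist (line_flow \<gamma> s x) (line_flow \<gamma> s y) = dist x y"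
    and line_flow_surj: "surj (line_flow \<gamma> s)"
proof -
  define \<gamma>' where "\<gamma>' t = \<gamma> (- t)" for t
  have \<gamma>': "geodesic_line \<gamma>'" unfolding \<gamma>'_def using \<gamma> by (rule geodesic_line_reverse)
  have fix': "line_flow \<gamma>' s (\<gamma> r) = \<gamma> (r - s)" for r
    using line_flow_line[OF \<gamma>' s, of "- r"] by (simp add: \<gamma>'_def)
  let ?F = "line_flow \<gamma> s" and ?F' = "line_flow \<gamma>' s"
  note le = line_flow_nonexpansive[OF \<gamma> s] and le' = line_flow_nonexpansive[OF \<gamma>' s]
  note me = emeasure_line_flow_image[OF \<gamma> s] and me' = emeasure_line_flow_image[OF \<gamma>' s]
  have c: "compact (?F ` K)" "compact (?F' ` K)" if "compact K" for K
    using that line_flow_continuous[OF \<gamma> s] line_flow_continuous[OF \<gamma>' s] by (auto intro: compact_continuous_image)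
  have 1: "dist ((?F' \<circ> ?F) x) ((?F' \<circ> ?F) y) = dist x y"
  proof (rule nonexpansive_measure_expanding_imp_isometry(1))
    show "(?F' \<circ> ?F) (\<gamma> 0) = \<gamma> 0" using \<gamma> s by (simp add: line_flow_line fix')
    show "dist ((?F' \<circ> ?F) x) ((?F' \<circ> ?F) y) \<le> dist x y" for x y
      using le le' order_trans unfolding comp_def by blast
    show "emeasure m K \<le> emeasure m ((?F' \<circ> ?F) ` K)" if "compact K" for K
      using me[OF that] me'[OF c(1)[OF that]] by (simp add: image_comp)
  qed
  \<comment> \<open>If the composite preserves a distance and neither factor increases it, the inner
    factor preserves it.\<close>
  show "dist (?F x) (?F y) = dist x y" using 1 le[of x y] le'[of "?F x" "?F y"] by simp
  \<comment> \<open>Surjectivity of \<open>?F\<close> needs it as the outer map, so the opposite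
    order is used.\<close>
  have "surj (?F \<circ> ?F')"
  proof (rule nonexpansive_measure_expanding_imp_isometry(2))
    show "(?F \<circ> ?F') (\<gamma> 0) = \<gamma> 0" using \<gamma> s by (simp add: line_flow_line fix')
    show "dist ((?F \<circ> ?F') x) ((?F \<circ> ?F') y) \<le> dist x y" for x y
      using le le' order_trans unfolding comp_def by blast
    show "emeasure m K \<le> emeasure m ((?F \<circ> ?F') ` K)" if "compact K" for K
      using me'[OF that] me[OF c(2)[OF that]] by (simp add: image_comp)
  qed
  then show "surj ?F" unfolding surj_def comp_def by blast
qed

end

section \<open>Translations\<close>

text \<open>In a normed space these are the maps adding a fixed vector: bounded displacement
  excludes rotations and reflections.\<close>

definition translation :: "('a::metric_space \<Rightarrow> 'a) \<Rightarrow> bool" where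
  "translation f \<longleftrightarrow> (\<forall>x y. dist (f x) (f y) = dist x y) \<and> surj f \<and> (\<exists>C. \<forall>x. dist x (f x) \<le> C)"

lemma translation_dist: "translation f \<Longrightarrow> dist (f x) (f y) = dist x y"
  by (simp add: translation_def)

lemma translation_bij: "translation f \<Longrightarrow> bij f"
  unfolding translation_def bij_def inj_def by (metis dist_eq_0_iff)

lemma translation_id: "translation id"
  by (auto simp: translation_def)

lemma translation_comp:
  assumes "translation f" "translation g"
  shows "translation (f \<circ> g)"
proof -
  obtain C D where "\<And>x. dist x (f x) \<le> C" "\<And>x. dist x (g x) \<le> D"
    using assms unfolding translation_def by blast
  then have "dist x (f (g x)) \<le> D + C" for x
    by (meson add_mono dist_triangle order_trans)
  moreover have "surj (f \<circ> g)" using assms unfolding translation_def by (intro comp_surj) auto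
  ultimately show ?thesis using assms unfolding translation_def comp_def by auto
qed

lemma translation_inv:
  assumes "translation f"
  shows "translation (inv f)"
proof -
  have b: "bij f" using assms by (rule translation_bij)
  obtain C where C: "\<And>x. dist x (f x) \<le> C" using assms unfolding translation_def by blast
  have "dist x (inv f x) \<le> C" for x
    using C[of "inv f x"] by (simp add: dist_commute surj_f_inv_f[OF bij_is_surj[OF b]])
  moreover have "dist (inv f x) (inv f y) = dist x y" for x y
    by (metis assms b bij_is_surj surj_f_inv_f translation_dist)
  ultimately show ?thesis unfolding translation_def using b bij_imp_bij_inv bij_is_surj by blast
qed

text \<open>This is all that the linear structure uses. Neither the measure nor \<open>N\<close>
  occurs, so the condition is a property of the type alone and can appear in a type
  definition.\<close>

locale translation_Busemann = complete_Busemann dummy for dummy :: "'a::metric_space itself" +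
  assumes line_translation:
    "geodesic_line (\<gamma> :: real \<Rightarrow> 'a) \<Longrightarrow> \<exists>f. translation f \<and> (\<forall>r. f (\<gamma> r) = \<gamma> (r + s))"
begin

lemma translation_line: "translation f \<Longrightarrow> geodesic_line (\<gamma> :: real \<Rightarrow> 'a) \<Longrightarrow> geodesic_line (\<lambda>t. f (\<gamma> t))"
  by (simp add: geodesic_line_def translation_dist)

text \<open>A line through two points and its image are at bounded distance, and their distance at
  equal parameters is the displacement. By convexity it does not increase from one point to the
  other; then exchange the points.\<close>

lemma translation_displacement:
  assumes f: "translation (f :: 'a \<Rightarrow> 'a)"
  shows "dist x (f x) = dist y (f y)"
proof -
  have "dist v (f v) \<le> dist u (f u)" if uv: "u \<noteq> v" for u v
  proof -
    obtain \<gamma> where \<gamma>: "geodesic_line \<gamma>" "\<gamma> 0 = u" "\<gamma> (dist u v) = v"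
      using uv by (rule geodesic_line_through)
    obtain C where C: "\<And>x. dist x (f x) \<le> C" using f unfolding translation_def by blast
    show ?thesis
      using asymptotic_geodesic_lines_antimono[OF \<gamma>(1) translation_line[OF f \<gamma>(1)], of 0 "dist u v" C] C \<gamma> by simp
  qed
  from this[of x y] this[of y x] show ?thesis by (cases "x = y") auto
qed

lemma translation_fixpoint: "translation (f :: 'a \<Rightarrow> 'a) \<Longrightarrow> f p = p \<Longrightarrow> f = id"
  by (rule ext) (metis dist_eq_0_iff id_apply translation_displacement)

lemma translation_eqI:
  assumes "translation (f :: 'a \<Rightarrow> 'a)" "translation g" "f p = g p"
  shows "f = g"
proof -
  have g: "bij g" using assms(2) by (rule translation_bij)
  have "(inv g \<circ> f) p = p" using assms(3) g by (simp add: inv_f_f bij_is_inj)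
  then have "inv g \<circ> f = id"
    using assms by (intro translation_fixpoint translation_comp translation_inv)
  then show ?thesis by (metis bij_is_surj comp_id fun.map_comp g surj_iff id_comp)
qed

text \<open>The shift by \<open>dist x (g x)\<close> along a line from \<open>x\<close> through
  \<open>g x\<close> is a translation that agrees with \<open>g\<close> at \<open>x\<close>, and one
  value determines a translation.\<close>

lemma translation_axis:
  assumes g: "translation (g :: 'a \<Rightarrow> 'a)" and ne: "g x \<noteq> x"
  obtains \<gamma> where "geodesic_line \<gamma>" "\<gamma> 0 = x" "\<And>r. g (\<gamma> r) = \<gamma> (r + dist x (g x))"
proof -
  obtain \<gamma> where \<gamma>: "geodesic_line \<gamma>" "\<gamma> 0 = x" "\<gamma> (dist x (g x)) = g x"
    using geodesic_line_through[of x "g x"] ne by metis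
  obtain f where f: "translation f" "\<And>r. f (\<gamma> r) = \<gamma> (r + dist x (g x))"
    using line_translation[OF \<gamma>(1)] by blast
  have "f x = g x" using f(2)[of 0] \<gamma> by simp
  then have "f = g" using f(1) g by (intro translation_eqI)
  then show ?thesis using that \<gamma> f by blast
qed

text \<open>If \<open>f\<close> and \<open>g\<close> are translations, then \<open>f\<close> maps an axis of \<open>g\<close> to a line at bounded distance
  from the axis of \<open>g\<close> with the same starting point; such lines coincide.\<close>

lemma translation_commute:
  assumes f: "translation (f :: 'a \<Rightarrow> 'a)" and g: "translation g"
  shows "f (g x) = g (f x)"
proof (cases "g x = x")
  case True
  then show ?thesis using translation_fixpoint[OF g True] by simp
next
  case False
  define c where "c = dist x (g x)"
  have c: "c = dist (f x) (g (f x))" unfolding c_def by (rule translation_displacement[OF g])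
  have "g (f x) \<noteq> f x" using c False by (auto simp: c_def)
  then obtain \<beta> where \<beta>: "geodesic_line \<beta>" "\<beta> 0 = f x" "\<And>r. g (\<beta> r) = \<beta> (r + c)"
    using translation_axis[OF g] c by metis
  obtain \<gamma> where \<gamma>: "geodesic_line \<gamma>" "\<gamma> 0 = x" "\<And>r. g (\<gamma> r) = \<gamma> (r + c)"
    using translation_axis[OF g False] unfolding c_def by metis
  have \<gamma>i: "\<gamma> (real i * c) = (g ^^ i) x" for i
  proof (induction i)
    case (Suc i)
    have "\<gamma> (real (Suc i) * c) = g (\<gamma> (real i * c))" unfolding \<gamma>(3) by (simp add: algebra_simps)
    then show ?case using Suc by simp
  qed (simp add: \<gamma>(2))
  have \<beta>i: "\<beta> (real i * c) = (g ^^ i) (f x)" for i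
  proof (induction i)
    case (Suc i)
    have "\<beta> (real (Suc i) * c) = g (\<beta> (real i * c))" unfolding \<beta>(3) by (simp add: algebra_simps)
    then show ?case using Suc by simp
  qed (simp add: \<beta>(2))
  have gi: "dist ((g ^^ i) u) ((g ^^ i) v) = dist u v" for i u v
    by (induction i) (auto simp: translation_dist[OF g])
  \<comment> \<open>At multiples of \<open>c\<close> both lines are given by powers of
    \<open>g\<close>, which preserve distances.\<close>
  have "dist (\<beta> (real i * c)) (f (\<gamma> (real i * c))) \<le> dist x (f x) + dist x (f x)" for i
  proof -
    have "dist (\<beta> (real i * c)) (f (\<gamma> (real i * c))) \<le>
        dist ((g ^^ i) (f x)) ((g ^^ i) x) + dist ((g ^^ i) x) (f ((g ^^ i) x))"
      unfolding \<gamma>i \<beta>i by (rule dist_triangle)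
    then show ?thesis using translation_displacement[OF f, of "(g ^^ i) x" x] by (simp add: gi dist_commute)
  qed
  \<comment> \<open>Both lines start at \<open>f x\<close>, so the right-hand side is
    \<open>0\<close> and they agree at \<open>c\<close>.\<close>
  then have "dist (\<beta> (0 + c)) (f (\<gamma> (0 + c))) \<le> dist (\<beta> 0) (f (\<gamma> 0))"
    by (intro asymptotic_geodesic_lines_antimono[OF \<beta>(1) translation_line[OF f \<gamma>(1)]]) simp
  then show ?thesis using \<beta> \<gamma> \<beta>(3)[of 0] \<gamma>(3)[of 0] by simp
qed

lemma translation_transitive: "\<exists>f. translation f \<and> f (p::'a) = q"
proof (cases "p = q")
  case False
  then obtain \<gamma> where \<gamma>: "geodesic_line \<gamma>" "\<gamma> 0 = p" "\<gamma> (dist p q) = q" by (rule geodesic_line_through)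
  obtain f where "translation f" "\<forall>r. f (\<gamma> r) = \<gamma> (r + dist p q)" using line_translation[OF \<gamma>(1)] by blast
  then show ?thesis using \<gamma> by (metis add_0)
qed (use translation_id in auto)

end

subsection \<open>The linear structure\<close>

text \<open>The arbitrary point \<open>undefined\<close> serves as origin. A point is identified
  with the translation that takes the origin to it, so that addition of vectors is
  composition.\<close>

definition translation_to :: "'a::metric_space \<Rightarrow> 'a \<Rightarrow> 'a" where
  "translation_to u = (THE f. translation f \<and> f undefined = u)"

text \<open>The chosen line does not depend on \<open>r\<close>, so all multiples of
  \<open>u\<close> lie on one line and can be added along it.\<close>

definition dilation :: "real \<Rightarrow> 'a::metric_space \<Rightarrow> 'a" where
  "dilation r u = (if u = undefined then u else
     (SOME \<gamma>. geodesic_line \<gamma> \<and> \<gamma> 0 = undefined \<and> \<gamma> (dist undefined u) = u) (r * dist undefined u))"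

context translation_Busemann
begin

lemma
  shows translation_translation_to: "translation (translation_to (u::'a))"
    and translation_to_origin: "translation_to u undefined = u"
proof -
  obtain f where f: "translation f" "f undefined = u" using translation_transitive by blast
  have "translation (translation_to u) \<and> translation_to u undefined = u"
    unfolding translation_to_def by (rule theI[of _ f]) (use f translation_eqI in auto)
  then show "translation (translation_to u)" "translation_to u undefined = u" by auto
qed

lemma translation_to_eqI: "translation (f :: 'a \<Rightarrow> 'a) \<Longrightarrow> f undefined = u \<Longrightarrow> translation_to u = f"
  using translation_eqI translation_translation_to translation_to_origin by metis

lemma translation_to_undefined: "translation_to (undefined :: 'a) = id"
  by (rule translation_to_eqI) (auto intro: translation_id)

lemma translation_to_comp: "translation_to (translation_to u v) = translation_to (u::'a) \<circ> translation_to v"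
  by (rule translation_to_eqI) (auto intro: translation_comp translation_translation_to simp: translation_to_origin)

lemma translation_to_commute: "translation_to (u::'a) v = translation_to v u"
  by (metis translation_to_origin translation_commute translation_translation_to)

lemma translation_to_inverse: "translation_to (inv (translation_to (u::'a)) undefined) u = undefined"
  by (metis bij_is_surj surj_f_inv_f translation_bij translation_to_commute translation_translation_to)

lemma dilation_line:
  assumes "(u::'a) \<noteq> undefined"
  obtains \<gamma> where "geodesic_line \<gamma>" "\<gamma> 0 = undefined" "\<gamma> (dist undefined u) = u"
    "\<And>r. dilation r u = \<gamma> (r * dist undefined u)"
proof -
  let ?P = "\<lambda>\<gamma>. geodesic_line \<gamma> \<and> \<gamma> 0 = undefined \<and> \<gamma> (dist undefined u) = u"
  have "\<exists>\<gamma>. ?P \<gamma>" using geodesic_line_through[of undefined u] assms by metis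
  then have "?P (SOME \<gamma>. ?P \<gamma>)" by (rule someI_ex)
  then show ?thesis using that[of "SOME \<gamma>. ?P \<gamma>"] assms by (simp add: dilation_def)
qed

lemma dilation_one: "dilation 1 (u::'a) = u"
  by (cases "u = undefined") (auto simp: dilation_def[of _ undefined] elim: dilation_line)

lemma dist_dilation: "dist undefined (dilation r (u::'a)) = \<bar>r\<bar> * dist undefined u"
proof (cases "u = undefined")
  case False
  then obtain \<gamma> where \<gamma>: "geodesic_line \<gamma>" "\<gamma> 0 = undefined" "dilation r u = \<gamma> (r * dist undefined u)"
    by (metis dilation_line)
  then show ?thesis using geodesic_lineD[OF \<gamma>(1), of 0 "r * dist undefined u"] by (simp add: abs_mult)
qed (simp add: dilation_def)

text \<open>The shift by \<open>r * dist undefined u\<close> along the chosen line takes the origin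
  to \<open>dilation r u\<close>; by uniqueness it is the translation to that point.\<close>

lemma dilation_add: "dilation (r + s) (u::'a) = translation_to (dilation r u) (dilation s u)"
proof (cases "u = undefined")
  case False
  then obtain \<gamma> where \<gamma>: "geodesic_line \<gamma>" "\<gamma> 0 = undefined" "\<And>r. dilation r u = \<gamma> (r * dist undefined u)"
    by (metis dilation_line)
  obtain f where f: "translation f" "\<And>t. f (\<gamma> t) = \<gamma> (t + r * dist undefined u)"
    using line_translation[OF \<gamma>(1)] by blast
  have "translation_to (dilation r u) = f"
    by (rule translation_to_eqI) (use f(1) f(2)[of 0] \<gamma> in auto)
  then show ?thesis using f \<gamma> by (simp add: algebra_simps)
qed (simp add: dilation_def translation_to_undefined)

end

text \<open>The linear structure needs a type of its own. Where translations act transitively, the new type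
  is a copy of the space with origin \<^term>\<open>undefined\<close>; elsewhere it is a point, so that it is a
  normed space unconditionally.\<close>

typedef (overloaded) 'a translation_space =
  "if translation_Busemann TYPE('a::metric_space) then UNIV else {undefined :: 'a}"
  morphisms point_of vector_of by (rule exI[of _ undefined]) auto

lemma point_of_vector_of: "translation_Busemann TYPE('a) \<Longrightarrow> point_of (vector_of (x::'a::metric_space)) = x"
  by (simp add: vector_of_inverse)

lemma point_of_trivial: "\<not> translation_Busemann TYPE('a) \<Longrightarrow> point_of (v :: 'a::metric_space translation_space) = undefined"
  using point_of[of v] by simp

instantiation translation_space :: (metric_space) ab_group_add
begin

definition "0 = vector_of (undefined::'a)"
definition "v + w = vector_of (translation_to (point_of v) (point_of (w :: 'a translation_space)))"
definition "- v = vector_of (inv (translation_to (point_of (v :: 'a translation_space))) undefined)"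
definition "v - w = v + - (w :: 'a translation_space)"

instance
proof
  fix u v w :: "'a translation_space"
  have triv: "a = b" if "\<not> translation_Busemann TYPE('a)" for a b :: "'a translation_space"
    using point_of_trivial[OF that] by (metis point_of_inject)
  show "u + v + w = u + (v + w)"
  proof (cases "translation_Busemann TYPE('a)")
    case True
    then interpret translation_Busemann "TYPE('a)" .
    show ?thesis by (simp add: plus_translation_space_def point_of_vector_of[OF True] translation_to_comp)
  qed (rule triv)
  show "u + v = v + u"
  proof (cases "translation_Busemann TYPE('a)")
    case True
    then interpret translation_Busemann "TYPE('a)" .
    show ?thesis by (simp add: plus_translation_space_def translation_to_commute)
  qed (rule triv)
  show "0 + u = u"
  proof (cases "translation_Busemann TYPE('a)")
    case True
    then interpret translation_Busemann "TYPE('a)" .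
    show ?thesis
      by (simp add: plus_translation_space_def zero_translation_space_def point_of_vector_of[OF True]
          translation_to_undefined point_of_inverse)
  qed (rule triv)
  show "- u + u = 0"
  proof (cases "translation_Busemann TYPE('a)")
    case True
    then interpret translation_Busemann "TYPE('a)" .
    show ?thesis
      by (simp add: plus_translation_space_def zero_translation_space_def uminus_translation_space_def
          point_of_vector_of[OF True] translation_to_inverse)
  qed (rule triv)
qed (simp add: minus_translation_space_def)

end

instantiation translation_space :: (metric_space) scaleR
begin

definition "r *\<^sub>R v = vector_of (dilation r (point_of (v :: 'a translation_space)))"
instance ..

end

abbreviation radius :: "'a::metric_space translation_space \<Rightarrow> real" where
  "radius v \<equiv> dist undefined (point_of v)"

text \<open>Adding \<open>w\<close> is an isometry; it carries \<open>v - w\<close> to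
  \<open>v\<close> and zero to \<open>w\<close>.\<close>

lemma translation_space_dist_diff:
  "dist (point_of v) (point_of (w :: 'a::metric_space translation_space)) = radius (v - w)"
proof (cases "translation_Busemann TYPE('a)")
  case True
  then interpret translation_Busemann "TYPE('a)" .
  have "dist (point_of v) (point_of w) = dist (point_of (w + (v - w))) (point_of (w + 0))" by simp
  also have "\<dots> = dist (point_of (v - w)) (point_of (0 :: 'a translation_space))"
    by (simp only: plus_translation_space_def point_of_vector_of[OF True] translation_dist[OF translation_translation_to])
  finally show ?thesis
    by (simp add: zero_translation_space_def point_of_vector_of[OF True] dist_commute)
qed (simp add: point_of_trivial)

text \<open>These are the laws that live on a single line or come from the triangle inequality.
  Distributivity over vector sums and associativity of scaling are obtained afterwards from
  uniqueness of additive maps.\<close>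

lemma
  fixes v w :: "'a::metric_space translation_space"
  shows translation_space_radius_eq_0: "radius v = 0 \<longleftrightarrow> v = 0"
    and translation_space_radius_triangle: "radius (v + w) \<le> radius v + radius w"
    and translation_space_radius_scaleR: "radius (r *\<^sub>R v) = \<bar>r\<bar> * radius v"
    and translation_space_scaleR_add_left: "(r + s) *\<^sub>R v = r *\<^sub>R v + s *\<^sub>R v"
    and translation_space_scaleR_one: "1 *\<^sub>R v = v"
proof -
  show n0: "radius v = 0 \<longleftrightarrow> v = 0" for v :: "'a translation_space"
    using translation_space_dist_diff[of v 0] translation_space_dist_diff[of 0 0]
    by (auto simp: point_of_inject[symmetric])
  show "radius (v + w) \<le> radius v + radius w"
    using dist_triangle[of "point_of v" "point_of (- w)" "point_of 0"]
      translation_space_dist_diff[of v "- w"] translation_space_dist_diff[of v 0]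
      translation_space_dist_diff[of 0 "- w"] by simp
  have triv: "a = b" if "\<not> translation_Busemann TYPE('a)" for a b :: "'a translation_space"
    using point_of_trivial[OF that] by (metis point_of_inject)
  show "radius (r *\<^sub>R v) = \<bar>r\<bar> * radius v"
  proof (cases "translation_Busemann TYPE('a)")
    case True
    then interpret translation_Busemann "TYPE('a)" .
    show ?thesis by (simp add: scaleR_translation_space_def point_of_vector_of[OF True] dist_dilation)
  qed (use triv[of _ 0] n0 in \<open>metis mult_zero_right\<close>)
  show "(r + s) *\<^sub>R v = r *\<^sub>R v + s *\<^sub>R v"
  proof (cases "translation_Busemann TYPE('a)")
    case True
    then interpret translation_Busemann "TYPE('a)" .
    show ?thesis by (simp add: plus_translation_space_def scaleR_translation_space_def point_of_vector_of[OF True] dilation_add)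
  qed (rule triv)
  show "1 *\<^sub>R v = v"
  proof (cases "translation_Busemann TYPE('a)")
    case True
    then interpret translation_Busemann "TYPE('a)" .
    show ?thesis by (simp add: scaleR_translation_space_def dilation_one point_of_inverse)
  qed (rule triv)
qed

text \<open>The difference of the two maps is additive and \<open>1\<close>-periodic, hence bounded, hence zero.\<close>

lemma translation_space_additive_unique:
  fixes \<phi> \<psi> :: "real \<Rightarrow> 'a::metric_space translation_space"
  assumes "\<And>a b. \<phi> (a + b) = \<phi> a + \<phi> b" "\<And>a b. \<psi> (a + b) = \<psi> a + \<psi> b"
    and "\<And>a. radius (\<phi> a) \<le> C * \<bar>a\<bar>" "\<And>a. radius (\<psi> a) \<le> D * \<bar>a\<bar>"
    and "\<phi> 1 = \<psi> 1"
  shows "\<phi> r = \<psi> r"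
proof -
  define \<delta> where "\<delta> a = \<phi> a + - \<psi> a" for a
  have add: "\<delta> (a + b) = \<delta> a + \<delta> b" for a b by (simp add: \<delta>_def assms)
  have \<delta>0: "\<delta> 0 = 0" using add[of 0 0] by simp
  have \<delta>1: "\<delta> 1 = 0" by (simp add: \<delta>_def assms)
  have \<delta>m: "\<delta> (- a) = - \<delta> a" for a using add[of a "- a"] \<delta>0 by (simp add: add_eq_0_iff)
  have nm: "radius (- v) = radius v" for v :: "'a translation_space"
    using translation_space_dist_diff[of 0 v] translation_space_dist_diff[of v 0] by (simp add: dist_commute)
  have bound: "radius (\<delta> a) \<le> C * \<bar>a\<bar> + D * \<bar>a\<bar>" for a
    unfolding \<delta>_def using translation_space_radius_triangle[of "\<phi> a" "- \<psi> a"] assms(3,4)[of a] by (simp add: nm)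
  have CD: "0 \<le> C + D" using order_trans[OF zero_le_dist bound[of 1]] by simp
  have nat0: "\<delta> (real k) = 0" for k by (induction k) (auto simp: \<delta>0 \<delta>1 add)
  have int0: "\<delta> (of_int k) = 0" for k
    using nat0[of "nat k"] nat0[of "nat (- k)"] \<delta>m[of "real (nat (- k))"] by (cases "k \<ge> 0") auto
  have bounded: "radius (\<delta> a) \<le> C + D" for a
  proof -
    have "\<delta> a = \<delta> (of_int \<lfloor>a\<rfloor>) + \<delta> (frac a)" by (simp add: frac_def flip: add)
    then have "radius (\<delta> a) \<le> (C + D) * frac a" using bound[of "frac a"] int0 by (simp add: algebra_simps frac_ge_0)
    also have "\<dots> \<le> (C + D) * 1" using CD by (intro mult_left_mono) (auto intro: less_imp_le frac_lt_1)
    finally show ?thesis by simp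
  qed
  \<comment> \<open>Natural multiples are enough for the Archimedean argument, and for them
    additivity in the scalar suffices.\<close>
  have scale: "real k *\<^sub>R v = \<delta> (real k * a)" if "v = \<delta> a" for k v a
  proof (induction k)
    case 0
    have "radius (0 *\<^sub>R v) = 0" by (simp add: translation_space_radius_scaleR)
    then show ?case unfolding translation_space_radius_eq_0 by (simp add: \<delta>0)
  next
    case (Suc k)
    then show ?case using that
      by (simp add: add translation_space_scaleR_add_left translation_space_scaleR_one distrib_right)
  qed
  have "radius (\<delta> r) = 0"
  proof (rule ccontr)
    assume "radius (\<delta> r) \<noteq> 0"
    then have "radius (\<delta> r) > 0" by (simp add: )
    then obtain k :: nat where "C + D < real k * radius (\<delta> r)" using reals_Archimedean3 by blast
    also have "\<dots> = radius (\<delta> (real k * r))"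
      using scale[OF refl, of k r] translation_space_radius_scaleR[of "real k" "\<delta> r"] by simp
    finally show False using bounded[of "real k * r"] by simp
  qed
  then have "\<delta> r = 0" unfolding translation_space_radius_eq_0 .
  then show ?thesis by (simp add: \<delta>_def)
qed

instantiation translation_space :: (metric_space) real_normed_vector
begin

definition "norm = (radius :: 'a translation_space \<Rightarrow> real)"
definition "dist v w = norm (v - (w :: 'a translation_space))"
definition "uniformity = (INF e\<in>{0<..}. principal {(x, y :: 'a translation_space). dist x y < e})"
definition "open (U :: 'a translation_space set) \<longleftrightarrow> (\<forall>x\<in>U. \<forall>\<^sub>F (x', y) in uniformity. x' = x \<longrightarrow> y \<in> U)"
definition "sgn (v :: 'a translation_space) = v /\<^sub>R norm v"

instance
proof
  fix u v :: "'a translation_space" and r s :: real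
  note scaleR = translation_space_scaleR_add_left translation_space_scaleR_one translation_space_radius_scaleR
  show "r *\<^sub>R (u + v) = r *\<^sub>R u + r *\<^sub>R v"
  \<comment> \<open>Both sides are additive in the scalar, bounded by a multiple of its absolute
    value, and equal at \<open>1\<close>.\<close>
  proof (rule translation_space_additive_unique[of "\<lambda>r. r *\<^sub>R (u + v)" "\<lambda>r. r *\<^sub>R u + r *\<^sub>R v"])
    show "radius (a *\<^sub>R u + a *\<^sub>R v) \<le> (radius u + radius v) * \<bar>a\<bar>" for a
      using translation_space_radius_triangle[of "a *\<^sub>R u" "a *\<^sub>R v"] by (simp add: scaleR algebra_simps)
  qed (auto simp: scaleR algebra_simps intro: eq_refl)
  show "r *\<^sub>R s *\<^sub>R u = (r * s) *\<^sub>R u"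
    by (rule translation_space_additive_unique[of "\<lambda>r. r *\<^sub>R s *\<^sub>R u" "\<lambda>r. (r * s) *\<^sub>R u" "radius (s *\<^sub>R u)" "radius (s *\<^sub>R u)"])
       (auto simp: scaleR algebra_simps abs_mult)
qed (auto simp: dist_translation_space_def norm_translation_space_def uniformity_translation_space_def open_translation_space_def
    sgn_translation_space_def translation_space_scaleR_add_left translation_space_scaleR_one
    translation_space_radius_eq_0[simplified] translation_space_radius_triangle translation_space_radius_scaleR)

end

lemma dist_point_of: "dist (point_of v) (point_of (w :: 'a::metric_space translation_space)) = dist v w"
  by (simp add: dist_translation_space_def norm_translation_space_def translation_space_dist_diff)

section \<open>Invariance of the measure under translations\<close>

context MCP_Busemann
begin

lemma translation_line_flow: "geodesic_line (\<gamma> :: real \<Rightarrow> 'a) \<Longrightarrow> 0 \<le> s \<Longrightarrow> translation (line_flow \<gamma> s)"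
  unfolding translation_def
  by (intro conjI allI exI[of _ s] line_flow_isometry line_flow_surj line_flow_bounded_displacement)

text \<open>Flows provide the shifts by \<open>s \<ge> 0\<close>, flows of the reversed line the
  others.\<close>

sublocale translation_Busemann dummy
proof
  fix \<gamma> :: "real \<Rightarrow> 'a" and s
  assume \<gamma>: "geodesic_line \<gamma>"
  show "\<exists>f. translation f \<and> (\<forall>r. f (\<gamma> r) = \<gamma> (r + s))"
  proof (cases "s \<ge> 0")
    case True
    then show ?thesis using \<gamma> translation_line_flow line_flow_line by blast
  next
    case False
    let ?\<eta> = "\<lambda>t. \<gamma> (- t)"
    have \<eta>: "geodesic_line ?\<eta>" using \<gamma> by (rule geodesic_line_reverse)
    have "line_flow ?\<eta> (- s) (\<gamma> r) = \<gamma> (r + s)" for r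
      using line_flow_line[OF \<eta>, of "- s" "- r"] False by (simp add: add.commute)
    then show ?thesis using translation_line_flow[OF \<eta>, of "- s"] False by auto
  qed
qed

text \<open>A nontrivial translation agrees at the origin with the flow along its axis, hence
  everywhere. This brings the measure estimate for flows to all translations.\<close>

lemma translation_is_line_flow:
  assumes f: "translation (f :: 'a \<Rightarrow> 'a)"
  shows "f = id \<or> (\<exists>\<gamma> s. geodesic_line \<gamma> \<and> 0 \<le> s \<and> f = line_flow \<gamma> s)"
proof (cases "f undefined = undefined")
  case True
  then show ?thesis using translation_fixpoint[OF f] by blast
next
  case False
  obtain \<gamma> where \<gamma>: "geodesic_line \<gamma>" "\<gamma> 0 = undefined" "\<And>r. f (\<gamma> r) = \<gamma> (r + dist undefined (f undefined))"
    by (rule translation_axis[OF f False]) blast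
  have "f (\<gamma> 0) = line_flow \<gamma> (dist undefined (f undefined)) (\<gamma> 0)"
    unfolding \<gamma>(3) using \<gamma>(1) by (simp add: line_flow_line)
  then have "f = line_flow \<gamma> (dist undefined (f undefined))"
    by (rule translation_eqI[OF f translation_line_flow[OF \<gamma>(1)], rotated]) simp
  then show ?thesis using \<gamma>(1) zero_le_dist by blast
qed

lemma translation_continuous: "translation (f :: 'a \<Rightarrow> 'a) \<Longrightarrow> continuous_on A f"
  by (rule continuous_onI) (metis less_imp_le translation_dist)

lemma translation_emeasure_compact:
  assumes f: "translation (f :: 'a \<Rightarrow> 'a)" and K: "compact K"
  shows "emeasure m (f ` K) = emeasure m K"
proof -
  have le: "emeasure m L \<le> emeasure m (g ` L)" if "translation g" "compact L" for g :: "'a \<Rightarrow> 'a" and L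
    using translation_is_line_flow[OF that(1)] emeasure_line_flow_image[OF _ _ that(2)] by auto
  have "compact (f ` K)" using K translation_continuous[OF f] by (intro compact_continuous_image)
  then have "emeasure m (f ` K) \<le> emeasure m (inv f ` f ` K)"
    by (intro le translation_inv f)
  also have "inv f ` f ` K = K" using translation_bij[OF f] by (simp add: bij_is_inj image_inv_f_f)
  finally show ?thesis using le[OF f K] by simp
qed

text \<open>Closed balls being compact, the compact sets form an intersection-stable generator of
  the Borel sets and exhaust the space by sets of finite measure.\<close>

lemma translation_distr:
  assumes f: "translation (f :: 'a \<Rightarrow> 'a)"
  shows "distr m borel f = m"
proof -
  have meas: "f \<in> measurable m borel"
    unfolding measurable_cong_sets[OF sets_m refl]
    by (rule borel_measurable_continuous_onI[OF translation_continuous[OF f]])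
  have em: "emeasure (distr m borel f) K = emeasure m K" if "compact K" for K
  proof -
    have "f -` K = inv f ` K" using translation_bij[OF f] by (simp add: bij_vimage_eq_inv_image)
    then have "emeasure (distr m borel f) K = emeasure m (inv f ` K)"
      using meas that by (simp add: emeasure_distr compact_imp_closed borel_closed)
    then show ?thesis using translation_emeasure_compact[OF translation_inv[OF f] that] by simp
  qed
  have gen: "sets borel = sigma_sets UNIV (Collect compact :: 'a set set)"
  proof -
    have "sets borel = sigma_sets UNIV (Collect closed :: 'a set set)" by (simp add: borel_eq_closed)
    also have "\<dots> = sigma_sets UNIV (Collect compact)"
    proof (rule sigma_sets_eqI)
      fix C :: "'a set" assume "C \<in> Collect closed"
      then have "C \<inter> cball undefined (real i) \<in> sigma_sets UNIV (Collect compact)" for i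
        using compact_cball by (intro sigma_sets.Basic) (auto intro: closed_Int_compact)
      then have "(\<Union>i. C \<inter> cball undefined (real i)) \<in> sigma_sets UNIV (Collect compact)"
        by (rule sigma_sets.Union)
      moreover have "(\<Union>i. C \<inter> cball undefined (real i)) = C" using real_arch_simple by auto
      ultimately show "C \<in> sigma_sets UNIV (Collect compact)" by simp
    qed (auto intro: sigma_sets.Basic compact_imp_closed)
    finally show ?thesis .
  qed
  show ?thesis
  proof (rule measure_eqI_generator_eq[where \<Omega> = UNIV and E = "Collect compact" and A = "\<lambda>i. cball undefined (real i)"])
    show "Int_stable (Collect compact :: 'a set set)"
      by (auto simp: Int_stable_def compact_Int)
    show "(\<Union>i. cball (undefined::'a) (real i)) = UNIV" using real_arch_simple by auto
    show "emeasure (distr m borel f) (cball undefined (real i)) \<noteq> \<infinity>" for i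
      using emeasure_bounded_finite[of "cball undefined (real i)"] em[OF compact_cball] by (simp add: less_top)
  qed (use em gen compact_cball in auto)
qed

end

section \<open>Finite-dimensional normed spaces\<close>

definition lincomb :: "(nat \<Rightarrow> 'b::real_normed_vector) \<Rightarrow> nat \<Rightarrow> (nat \<Rightarrow> real) \<Rightarrow> 'b" where
  "lincomb e n v = (\<Sum>i<n. v i *\<^sub>R e i)"

text \<open>Linear independence in quantitative form: coefficients are controlled by the norm of the
  combination. The constant later separates lattice points and makes coordinates continuous.\<close>

definition frame :: "(nat \<Rightarrow> 'b::real_normed_vector) \<Rightarrow> nat \<Rightarrow> bool" where
  "frame e n \<longleftrightarrow> (\<exists>c>0. \<forall>v. c * (\<Sum>i<n. \<bar>v i\<bar>) \<le> norm (lincomb e n v))"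

lemma lincomb_add: "lincomb e n (\<lambda>i. v i + w i) = lincomb e n v + lincomb e n w"
  by (simp add: lincomb_def scaleR_add_left sum.distrib)

lemma lincomb_diff: "lincomb e n (\<lambda>i. v i - w i) = lincomb e n v - lincomb e n w"
  by (simp add: lincomb_def scaleR_diff_left sum_subtractf)

lemma lincomb_scale: "lincomb e n (\<lambda>i. r * v i) = r *\<^sub>R lincomb e n v"
  by (simp add: lincomb_def scaleR_sum_right)

lemma norm_lincomb_le: "norm (lincomb e n v) \<le> (\<Sum>i<n. \<bar>v i\<bar> * norm (e i))"
  unfolding lincomb_def by (rule order_trans[OF norm_sum]) simp

text \<open>The span of a frame is closed: along a convergent sequence of combinations the frame
  bound makes each coefficient Cauchy.\<close>

lemma frame_dist_range:
  assumes "frame e n" "x \<notin> range (lincomb e n)"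
  obtains \<delta> where "\<delta> > 0" "\<And>v. \<delta> \<le> norm (x - lincomb e n v)"
proof (rule ccontr)
  assume no: "\<not> thesis"
  obtain c where c: "c > 0" "\<And>v. c * (\<Sum>i<n. \<bar>v i\<bar>) \<le> norm (lincomb e n v)"
    using assms(1) unfolding frame_def by blast
  have "\<exists>v. norm (x - lincomb e n v) < 1 / real (Suc k)" for k
    using no that[of "1 / real (Suc k)"] by (meson not_less of_nat_0_less_iff zero_less_Suc zero_less_divide_1_iff)
  then obtain v where v: "\<And>k. norm (x - lincomb e n (v k)) < 1 / real (Suc k)" by metis
  have lim: "(\<lambda>k. lincomb e n (v k)) \<longlonglongrightarrow> x"
  proof (rule LIM_zero_cancel, rule Lim_null_comparison)
    show "\<forall>\<^sub>F k in sequentially. norm (lincomb e n (v k) - x) \<le> 1 / real (Suc k)"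
      using v by (auto simp: norm_minus_commute less_imp_le)
    show "(\<lambda>k. 1 / real (Suc k)) \<longlonglongrightarrow> 0" by (rule LIMSEQ_Suc[OF lim_1_over_n])
  qed
  have coord: "convergent (\<lambda>k. v k i)" if i: "i < n" for i
  proof -
    have "Cauchy (\<lambda>k. v k i)"
    proof (rule metric_CauchyI)
      fix \<epsilon> :: real assume \<epsilon>: "\<epsilon> > 0"
      have "Cauchy (\<lambda>k. lincomb e n (v k))" using lim by (rule LIMSEQ_imp_Cauchy)
      from metric_CauchyD[OF this, of "c * \<epsilon>"] obtain M where
        M: "\<And>k l. k \<ge> M \<Longrightarrow> l \<ge> M \<Longrightarrow> dist (lincomb e n (v k)) (lincomb e n (v l)) < c * \<epsilon>"
        using c(1) \<epsilon> by auto
      have "dist (v k i) (v l i) < \<epsilon>" if "k \<ge> M" "l \<ge> M" for k l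
      proof -
        have "c * \<bar>v k i - v l i\<bar> \<le> c * (\<Sum>i<n. \<bar>v k i - v l i\<bar>)"
          using i c(1) member_le_sum[of i "{..<n}" "\<lambda>i. \<bar>v k i - v l i\<bar>"] by (intro mult_left_mono) auto
        also have "\<dots> \<le> norm (lincomb e n (v k) - lincomb e n (v l))"
          using c(2)[of "\<lambda>i. v k i - v l i"] by (simp add: lincomb_diff)
        also have "\<dots> < c * \<epsilon>" using M[OF that] by (simp add: dist_norm)
        finally show ?thesis using c(1) by (simp add: dist_real_def)
      qed
      then show "\<exists>M. \<forall>k\<ge>M. \<forall>l\<ge>M. dist (v k i) (v l i) < \<epsilon>" by blast
    qed
    then show ?thesis by (rule real_Cauchy_convergent)
  qed
  define l where "l i = lim (\<lambda>k. v k i)" for i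
  have "(\<lambda>k. lincomb e n (v k)) \<longlonglongrightarrow> lincomb e n l"
    unfolding lincomb_def l_def using coord
    by (intro tendsto_sum tendsto_scaleR tendsto_const) (auto simp: convergent_LIMSEQ_iff)
  then have "x = lincomb e n l" using lim LIMSEQ_unique by blast
  then show False using assms(2) by blast
qed

lemma frame_extend:
  assumes "frame e n" "x \<notin> range (lincomb e n)"
  shows "frame (e(n := x)) (Suc n)"
proof -
  obtain c where c: "c > 0" "\<And>v. c * (\<Sum>i<n. \<bar>v i\<bar>) \<le> norm (lincomb e n v)"
    using assms(1) unfolding frame_def by blast
  obtain \<delta> where \<delta>: "\<delta> > 0" "\<And>v. \<delta> \<le> norm (x - lincomb e n v)"
    using frame_dist_range[OF assms] by blast
  \<comment> \<open>Let \<open>u\<close> be the full combination. The last coefficient is at most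
    \<open>norm u / \<delta>\<close>; removing its term leaves a vector of norm at most
    \<open>norm u * (1 + norm x / \<delta>)\<close>, and the old frame bound divides this by
    \<open>c\<close>.\<close>
  define K where "K = (1 + norm x / \<delta>) / c + 1 / \<delta>"
  have K: "K > 0" using c \<delta> by (simp add: K_def add_pos_pos add_nonneg_pos)
  show ?thesis unfolding frame_def
  proof (intro exI[of _ "1 / K"] conjI allI)
    fix v
    define w where "w = lincomb e n v"
    define u where "u = lincomb (e(n := x)) (Suc n) v"
    have u: "u = w + v n *\<^sub>R x" by (simp add: u_def w_def lincomb_def)
    have 1: "\<bar>v n\<bar> * \<delta> \<le> norm u"
    proof (cases "v n = 0")
      case False
      \<comment> \<open>Factor out \<open>v n\<close>: what remains is \<open>x\<close> minus a
        vector of the span.\<close>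
      have "\<bar>v n\<bar> * \<delta> \<le> \<bar>v n\<bar> * norm (x - lincomb e n (\<lambda>i. (- 1 / v n) * v i))"
        using \<delta>(2) by (intro mult_left_mono) auto
      also have "\<dots> = norm (v n *\<^sub>R (x - (- 1 / v n) *\<^sub>R w))" by (simp only: lincomb_scale w_def norm_scaleR)
      also have "v n *\<^sub>R (x - (- 1 / v n) *\<^sub>R w) = u" using False by (simp add: u algebra_simps)
      finally show ?thesis .
    qed simp
    have vn: "\<bar>v n\<bar> \<le> norm u / \<delta>" using 1 \<delta>(1) by (simp add: field_simps)
    have "norm w \<le> norm u + \<bar>v n\<bar> * norm x"
      using norm_triangle_ineq4[of u "v n *\<^sub>R x"] by (simp add: u)
    also have "\<dots> \<le> norm u + norm u / \<delta> * norm x" using vn by (intro add_left_mono mult_right_mono) auto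
    finally have "c * (\<Sum>i<n. \<bar>v i\<bar>) \<le> norm u * (1 + norm x / \<delta>)"
      using c(2)[of v] by (simp add: w_def algebra_simps)
    then have "(\<Sum>i<n. \<bar>v i\<bar>) \<le> norm u * (1 + norm x / \<delta>) / c" using c(1) by (simp add: field_simps)
    then have "(\<Sum>i<Suc n. \<bar>v i\<bar>) \<le> norm u * (1 + norm x / \<delta>) / c + norm u / \<delta>" using vn by simp
    also have "\<dots> = K * norm u" by (simp add: K_def algebra_simps add_divide_distrib)
    finally show "1 / K * (\<Sum>i<Suc n. \<bar>v i\<bar>) \<le> norm u" using K by (simp add: field_simps)
  qed (use K in simp)
qed

section \<open>Translation-invariant measures\<close>

locale invariant_measure =
  fixes M :: "'b::real_normed_vector measure"
  assumes sets_M [measurable_cong, simp]: "sets M = sets borel"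
    and invariant: "A \<in> sets borel \<Longrightarrow> emeasure M ((+) a ` A) = emeasure M A"
    and emeasure_ball_finite: "emeasure M (ball x r) < \<infinity>"
begin

lemma space_M [simp]: "space M = UNIV"
  using sets_eq_imp_space_eq[OF sets_M] by simp

lemma emeasure_ball: "emeasure M (ball x r) = emeasure M (ball 0 r)"
proof -
  have "(+) x ` ball 0 r = ball x r" by simp
  then show ?thesis using invariant[of "ball 0 r" x] by simp
qed

lemma emeasure_bounded_finite: "bounded A \<Longrightarrow> emeasure M A < \<infinity>"
  by (metis bounded_subset_ballD emeasure_ball_finite emeasure_mono le_less_trans sets_M borel_open open_ball)

lemma sigma_finite: "sigma_finite_measure M"
proof
  have "(\<Union>i. ball (0::'b) (real i)) = UNIV" using reals_Archimedean2 by auto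
  then show "\<exists>A. countable A \<and> A \<subseteq> sets M \<and> \<Union> A = space M \<and> (\<forall>a\<in>A. emeasure M a \<noteq> \<infinity>)"
    using emeasure_ball_finite by (intro exI[of _ "range (\<lambda>i::nat. ball 0 (real i))"]) (auto simp: less_top)
qed

end

text \<open>Separability is given by dense sets, not by a type class. An open subset of the product
  is a countable union of products of balls with dense centres and rational radii, hence belongs to
  the product sigma-algebra.\<close>

lemma continuous_borel_measurable_pair:
  fixes f :: "'b::metric_space \<times> 'c::metric_space \<Rightarrow> 'd::topological_space"
  assumes f: "continuous_on UNIV f"
    and D: "countable (D :: 'b set)" "closure D = UNIV" and E: "countable (E :: 'c set)" "closure E = UNIV"
  shows "f \<in> borel_measurable (borel \<Otimes>\<^sub>M borel)"
proof (rule borel_measurableI)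
  fix S :: "'d set" assume "open S"
  define W where "W = f -` S"
  have W: "open W" unfolding W_def using \<open>open S\<close> f by (simp add: open_vimage)
  define F where "F = {(d, a, q). d \<in> D \<and> a \<in> E \<and> q \<in> \<rat> \<and> ball d q \<times> ball a q \<subseteq> W}"
  have "F \<subseteq> D \<times> E \<times> \<rat>" by (auto simp: F_def)
  then have cF: "countable F" by (rule countable_subset) (intro countable_SIGMA D E countable_rat)
  have "W = (\<Union>(d, a, q)\<in>F. ball d q \<times> ball a q)"
  proof (intro equalityI subsetI)
    fix z assume z: "z \<in> W"
    obtain x y where xy: "z = (x, y)" by (cases z)
    obtain r where r: "r > 0" "ball z r \<subseteq> W" using W z open_contains_ball by blast
    obtain q where q: "q \<in> \<rat>" "0 < q" "q < r / 4" using Rats_dense_in_real[of 0 "r/4"] r by auto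
    obtain d where d: "d \<in> D" "dist d x < q" using D(2) q closure_approachable by (metis UNIV_I)
    obtain a where a: "a \<in> E" "dist a y < q" using E(2) q closure_approachable by (metis UNIV_I)
    have "ball d q \<times> ball a q \<subseteq> ball z r"
    proof
      fix p assume "p \<in> ball d q \<times> ball a q"
      then obtain x' y' where p: "p = (x', y')" "dist d x' < q" "dist a y' < q" by auto
      have "dist x x' < r / 2" "dist y y' < r / 2"
        using dist_triangle2[of x x' d] dist_triangle2[of y y' a] p d a q by (auto simp: dist_commute)
      moreover have "dist z p \<le> dist x x' + dist y y'"
        unfolding xy p dist_Pair_Pair by (rule sqrt_sum_squares_le_sum) auto
      ultimately show "p \<in> ball z r" by simp
    qed
    then have "(d, a, q) \<in> F" using d a q r by (auto simp: F_def)
    moreover have "z \<in> ball d q \<times> ball a q" using xy d a by simp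
    ultimately show "z \<in> (\<Union>(d, a, q)\<in>F. ball d q \<times> ball a q)" by blast
  qed (auto simp: F_def)
  also have "\<dots> \<in> sets (borel \<Otimes>\<^sub>M borel)"
    using cF by (intro sets.countable_UN') auto
  finally show "f -` S \<inter> space (borel \<Otimes>\<^sub>M borel) \<in> sets (borel \<Otimes>\<^sub>M borel)"
    by (simp add: W_def space_pair_measure)
qed

text \<open>Both sides equal the integral of \<open>1\<^sub>A (x + y) 1\<^sub>B y\<close> over \<open>\<mu> \<times> \<nu>\<close>, where \<open>B\<close> is the ball about
  the origin.\<close>

lemma invariant_measure_unique:
  fixes \<mu> \<nu> :: "'b::real_normed_vector measure"
  assumes "invariant_measure \<mu>" "invariant_measure \<nu>"
    and D: "countable (D :: 'b set)" "closure D = UNIV" and A: "A \<in> sets borel"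
  shows "emeasure \<mu> A * emeasure \<nu> (ball 0 r) = emeasure \<nu> A * emeasure \<mu> (ball 0 r)"
proof -
  interpret \<mu>: invariant_measure \<mu> by fact
  interpret \<nu>: invariant_measure \<nu> by fact
  interpret s\<mu>: sigma_finite_measure \<mu> by (rule \<mu>.sigma_finite)
  interpret s\<nu>: sigma_finite_measure \<nu> by (rule \<nu>.sigma_finite)
  interpret pair_sigma_finite \<mu> \<nu> ..
  let ?B = "ball (0::'b) r"
  have sub: "{x \<in> S. x + y \<in> A} \<in> sets borel" if "S \<in> sets borel" for S y
  proof -
    have [measurable]: "(\<lambda>x. x + y) \<in> borel_measurable borel"
      by (intro borel_measurable_continuous_onI continuous_intros)
    show ?thesis using A that by measurable
  qed
  have [measurable]: "(\<lambda>(x, y). x + y) \<in> borel_measurable (borel \<Otimes>\<^sub>M (borel :: 'b measure))"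
    by (rule continuous_borel_measurable_pair[OF _ D D]) (auto simp: case_prod_beta' intro!: continuous_intros)
  have [measurable]: "(\<lambda>(x, y). y - x) \<in> borel_measurable (borel \<Otimes>\<^sub>M (borel :: 'b measure))"
    by (rule continuous_borel_measurable_pair[OF _ D D]) (auto simp: case_prod_beta' intro!: continuous_intros)
  have [measurable]: "A \<in> sets borel" "?B \<in> sets borel" using A by auto
  have "emeasure \<mu> A * emeasure \<nu> ?B = (\<integral>\<^sup>+y. emeasure \<mu> A * indicator ?B y \<partial>\<nu>)"
    by (simp add: nn_integral_cmult_indicator)
  also have "\<dots> = (\<integral>\<^sup>+y. (\<integral>\<^sup>+x. indicator A (x + y) * indicator ?B y \<partial>\<mu>) \<partial>\<nu>)"
  proof (rule nn_integral_cong)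
    fix y
    have "(\<integral>\<^sup>+x. indicator A (x + y) \<partial>\<mu>) = (\<integral>\<^sup>+x. indicator {x \<in> UNIV. x + y \<in> A} x \<partial>\<mu>)"
      by (intro nn_integral_cong) (auto simp: indicator_def)
    also have "\<dots> = emeasure \<mu> {x \<in> UNIV. x + y \<in> A}" using sub[of UNIV y] by (intro nn_integral_indicator) simp
    also have "{x \<in> UNIV. x + y \<in> A} = (+) (- y) ` A" by (auto simp: image_iff algebra_simps)
    also have "emeasure \<mu> \<dots> = emeasure \<mu> A" by (rule \<mu>.invariant) (rule A)
    finally show "emeasure \<mu> A * indicator ?B y = (\<integral>\<^sup>+x. indicator A (x + y) * indicator ?B y \<partial>\<mu>)"
      by (cases "y \<in> ?B") auto
  qed
  also have "\<dots> = (\<integral>\<^sup>+x. (\<integral>\<^sup>+y. indicator A (x + y) * indicator ?B y \<partial>\<nu>) \<partial>\<mu>)"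
    by (rule Fubini') measurable
  \<comment> \<open>For fixed \<open>x\<close> substitute \<open>y - x\<close> for \<open>y\<close>,
    using invariance of \<nu>.\<close>
  also have "\<dots> = (\<integral>\<^sup>+x. (\<integral>\<^sup>+y. indicator A y * indicator ?B (y - x) \<partial>\<nu>) \<partial>\<mu>)"
  proof (rule nn_integral_cong)
    fix x
    let ?C = "{y \<in> ?B. y + x \<in> A}"
    have C: "?C \<in> sets borel" by (rule sub) simp
    have "(\<integral>\<^sup>+y. indicator A (x + y) * indicator ?B y \<partial>\<nu>) = (\<integral>\<^sup>+y. indicator ?C y \<partial>\<nu>)"
      by (intro nn_integral_cong) (auto simp: indicator_def add.commute)
    also have "\<dots> = emeasure \<nu> ?C" using C by (intro nn_integral_indicator) simp
    also have "\<dots> = emeasure \<nu> ((+) x ` ?C)" by (rule \<nu>.invariant[symmetric, OF C])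
    also have "(+) x ` ?C = A \<inter> ball x r"
      by (auto simp: image_iff dist_norm norm_minus_commute add.commute intro!: exI[of _ "_ - x"])
    also have "emeasure \<nu> \<dots> = (\<integral>\<^sup>+y. indicator (A \<inter> ball x r) y \<partial>\<nu>)"
      using A by (intro nn_integral_indicator[symmetric]) auto
    also have "\<dots> = (\<integral>\<^sup>+y. indicator A y * indicator ?B (y - x) \<partial>\<nu>)"
      by (intro nn_integral_cong) (auto simp: indicator_def dist_norm norm_minus_commute)
    finally show "(\<integral>\<^sup>+y. indicator A (x + y) * indicator ?B y \<partial>\<nu>) = \<dots>" .
  qed
  also have "\<dots> = (\<integral>\<^sup>+y. (\<integral>\<^sup>+x. indicator A y * indicator ?B (y - x) \<partial>\<mu>) \<partial>\<nu>)"
    by (rule Fubini'[symmetric]) measurable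
  \<comment> \<open>By symmetry of \<open>?B\<close>, the factor depending on \<open>x\<close> is
    the indicator of \<open>ball y r\<close>, whose measure does not depend on
    \<open>y\<close>.\<close>
  also have "\<dots> = (\<integral>\<^sup>+y. emeasure \<mu> ?B * indicator A y \<partial>\<nu>)"
  proof (rule nn_integral_cong)
    fix y
    have "(\<integral>\<^sup>+x. indicator ?B (y - x) \<partial>\<mu>) = (\<integral>\<^sup>+x. indicator (ball y r) x \<partial>\<mu>)"
      by (intro nn_integral_cong) (auto simp: indicator_def dist_norm norm_minus_commute)
    also have "\<dots> = emeasure \<mu> ?B" using \<mu>.emeasure_ball by (simp add: nn_integral_indicator)
    finally show "(\<integral>\<^sup>+x. indicator A y * indicator ?B (y - x) \<partial>\<mu>) = emeasure \<mu> ?B * indicator A y"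
      by (cases "y \<in> A") auto
  qed
  also have "\<dots> = emeasure \<nu> A * emeasure \<mu> ?B"
    using A nn_integral_cmult_indicator[of A \<nu> "emeasure \<mu> ?B"] by (simp add: mult.commute)
  finally show ?thesis .
qed

context invariant_measure
begin

text \<open>The \<open>j ^ n\<close> combinations with natural coefficients below \<open>j\<close>
  are \<open>c\<close>-separated, so balls of radius \<open>c / 2\<close> about them are disjoint,
  and they fit into a ball of radius linear in \<open>j\<close>. Comparing measures gives
  \<open>j ^ n \<le> (C / \<rho> * j + 1) powr N\<close> for every \<open>j\<close>, which fails for
  large \<open>j\<close> if \<open>n > N\<close>.\<close>

lemma frame_dimension_le:
  assumes fr: "frame (e :: nat \<Rightarrow> 'b) n" and pos: "\<And>r. r > 0 \<Longrightarrow> measure M (ball 0 r) > 0" and N: "0 \<le> N"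
    and growth: "\<And>r R. 0 < r \<Longrightarrow> r \<le> R \<Longrightarrow> (r / R) powr N * measure M (ball 0 R) \<le> measure M (ball 0 r)"
  shows "real n \<le> N"
proof (rule ccontr)
  assume "\<not> real n \<le> N"
  then have gt: "real n - N > 0" by simp
  obtain c where c: "c > 0" "\<And>v. c * (\<Sum>i<n. \<bar>v i\<bar>) \<le> norm (lincomb e n v)"
    using fr unfolding frame_def by blast
  define \<rho> C where "\<rho> = c / 2" and "C = (\<Sum>i<n. norm (e i))"
  have \<rho>: "\<rho> > 0" and C: "C \<ge> 0" using c by (auto simp: \<rho>_def C_def intro: sum_nonneg)
  have count: "real j ^ n \<le> (C / \<rho> * real j + 1) powr N" for j :: nat
  proof -
    define I where "I = PiE {..<n} (\<lambda>_. {..<j})"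
    define x where "x k = lincomb e n (\<lambda>i. real (k i))" for k :: "nat \<Rightarrow> nat"
    have fI: "finite I" and cI: "card I = j ^ n" by (auto simp: I_def card_PiE finite_PiE)
    have disj: "disjoint_family_on (\<lambda>k. ball (x k) \<rho>) I"
      unfolding disjoint_family_on_def
    proof (intro ballI impI)
      fix k l assume kl: "k \<in> I" "l \<in> I" "k \<noteq> l"
      then obtain i where i: "i < n" "k i \<noteq> l i" unfolding I_def by (metis PiE_ext lessThan_iff)
      have "c * 1 \<le> c * \<bar>real (k i) - real (l i)\<bar>" using i c(1) by (intro mult_left_mono) auto
      also have "\<dots> \<le> c * (\<Sum>i<n. \<bar>real (k i) - real (l i)\<bar>)"
        using i c(1) member_le_sum[of i "{..<n}" "\<lambda>i. \<bar>real (k i) - real (l i)\<bar>"] by (intro mult_left_mono) auto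
      also have "\<dots> \<le> dist (x k) (x l)"
        using c(2)[of "\<lambda>i. real (k i) - real (l i)"] by (simp add: x_def lincomb_diff dist_norm)
      finally show "ball (x k) \<rho> \<inter> ball (x l) \<rho> = {}" by (intro disjoint_ballI) (simp add: \<rho>_def)
    qed
    have sub: "(\<Union>k\<in>I. ball (x k) \<rho>) \<subseteq> ball 0 (C * real j + \<rho>)"
    proof (intro UN_least subsetI)
      fix k y assume k: "k \<in> I" and y: "y \<in> ball (x k) \<rho>"
      have "norm (x k) \<le> (\<Sum>i<n. \<bar>real (k i)\<bar> * norm (e i))" unfolding x_def by (rule norm_lincomb_le)
      also have "\<dots> \<le> (\<Sum>i<n. real j * norm (e i))"
        using k by (intro sum_mono mult_right_mono) (auto simp: I_def PiE_def Pi_def less_imp_le)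
      also have "\<dots> = C * real j" by (simp add: C_def sum_distrib_left mult.commute)
      finally have "norm (x k) \<le> C * real j" .
      moreover have "norm (y - x k) < \<rho>" using y by (simp add: dist_norm norm_minus_commute)
      ultimately show "y \<in> ball 0 (C * real j + \<rho>)" using norm_triangle_sub[of y "x k"] by simp
    qed
    have "real j ^ n * measure M (ball 0 \<rho>) = (\<Sum>k\<in>I. measure M (ball (x k) \<rho>))"
    proof -
      have "measure M (ball (x k) \<rho>) = measure M (ball 0 \<rho>)" for k
        using emeasure_ball[of "x k" \<rho>] by (simp add: measure_def)
      then show ?thesis by (simp add: cI)
    qed
    also have "\<dots> = measure M (\<Union>k\<in>I. ball (x k) \<rho>)"
      using fI disj emeasure_ball_finite by (intro measure_finite_Union[symmetric]) (auto simp: less_top)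
    also have "\<dots> \<le> measure M (ball 0 (C * real j + \<rho>))"
      using sub emeasure_ball_finite fI by (intro measure_mono_fmeasurable) (auto simp: fmeasurable_def intro!: sets.finite_UN)
    also have "\<dots> \<le> (C / \<rho> * real j + 1) powr N * measure M (ball 0 \<rho>)"
    proof -
      define R where "R = C * real j + \<rho>"
      have R: "R \<ge> \<rho>" "R > 0" using C \<rho> by (auto simp: R_def add_nonneg_pos)
      have "(\<rho> / R) powr N * measure M (ball 0 R) \<le> measure M (ball 0 \<rho>)"
        using growth[of \<rho> R] \<rho> R by simp
      then have "(R / \<rho>) powr N * ((\<rho> / R) powr N * measure M (ball 0 R)) \<le> (R / \<rho>) powr N * measure M (ball 0 \<rho>)"
        by (rule mult_left_mono) simp
      moreover have "(R / \<rho>) powr N * (\<rho> / R) powr N = 1"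
        using R \<rho> by (simp flip: powr_mult)
      moreover have "R / \<rho> = C / \<rho> * real j + 1" using \<rho> by (simp add: R_def add_divide_distrib)
      ultimately show ?thesis unfolding R_def[symmetric] by (simp flip: mult.assoc)
    qed
    finally show ?thesis using pos[OF \<rho>] by simp
  qed
  define D where "D = C / \<rho> + 1"
  have D: "D > 0" using C \<rho> by (simp add: D_def add_nonneg_pos)
  \<comment> \<open>The inequality to refute is \<open>j powr (n - N) \<le> D powr N\<close>; the
    threshold solves it for \<open>j\<close>.\<close>
  obtain j :: nat where j: "real j > max 1 ((D powr N) powr (1 / (real n - N)))" using reals_Archimedean2 by blast
  have "real j powr real n \<le> (C / \<rho> * real j + 1) powr N" using count[of j] j by (simp add: powr_realpow)
  also have "\<dots> \<le> (D * real j) powr N"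
    using C \<rho> j N by (intro powr_mono2) (auto simp: D_def algebra_simps)
  also have "\<dots> = D powr N * real j powr N" using D by (simp add: powr_mult)
  finally have "real j powr (real n - N) \<le> D powr N"
    using j by (simp add: powr_diff field_simps)
  moreover have "((D powr N) powr (1 / (real n - N))) powr (real n - N) < real j powr (real n - N)"
    using j gt by (intro powr_less_mono2) auto
  ultimately show False using gt D by (simp add: powr_powr)
qed

end

text \<open>The empty frame exists and sizes are bounded; a frame of largest size spans, since
  otherwise \<open>frame_extend\<close> would enlarge it.\<close>

lemma frame_basis_exists:
  assumes "\<And>(e :: nat \<Rightarrow> 'b::real_normed_vector) n. frame e n \<Longrightarrow> real n \<le> N"
  obtains e :: "nat \<Rightarrow> 'b::real_normed_vector" and n where "frame e n" "surj (lincomb e n)"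
proof -
  define P where "P n \<longleftrightarrow> (\<exists>e :: nat \<Rightarrow> 'b. frame e n)" for n
  have "P 0" by (auto simp: P_def frame_def intro: exI[of _ 1])
  moreover have "\<forall>n. P n \<longrightarrow> n < Suc (nat \<lceil>N\<rceil>)" using assms by (fastforce simp: P_def less_Suc_eq_le le_nat_iff le_ceiling_iff)
  ultimately obtain n where n: "P n" "\<And>k. P k \<Longrightarrow> k \<le> n"
    using ex_has_greatest_nat[of P 0 id "Suc (nat \<lceil>N\<rceil>)"] by auto
  then obtain e :: "nat \<Rightarrow> 'b" where e: "frame e n" by (auto simp: P_def)
  have "surj (lincomb e n)"
  proof (rule ccontr)
    assume "\<not> surj (lincomb e n)"
    then obtain x where "x \<notin> range (lincomb e n)" by blast
    then have "P (Suc n)" using frame_extend[OF e] by (auto simp: P_def)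
    then show False using n(2)[of "Suc n"] by simp
  qed
  then show ?thesis using that e by blast
qed

section \<open>Hausdorff measures\<close>

text \<open>The last condition, superadditivity on sets at positive distance, is what makes Borel
  sets measurable in the sense of Caratheodory.\<close>

locale metric_outer_measure =
  fixes \<mu> :: "'a::metric_space set \<Rightarrow> ennreal"
  assumes empty [simp]: "\<mu> {} = 0"
    and mono: "A \<subseteq> B \<Longrightarrow> \<mu> A \<le> \<mu> B"
    and countably_subadditive: "\<mu> (\<Union>i. F i) \<le> (\<Sum>i::nat. \<mu> (F i))"
    and separated: "0 < e \<Longrightarrow> (\<And>a b. a \<in> A \<Longrightarrow> b \<in> B \<Longrightarrow> e \<le> dist a b) \<Longrightarrow> \<mu> A + \<mu> B \<le> \<mu> (A \<union> B)"
begin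

lemma subadditive: "\<mu> (A \<union> B) \<le> \<mu> A + \<mu> B"
  using countably_subadditive[of "binaryset A B"] suminf_binaryset_eq[of \<mu> A B] by (simp add: UN_binaryset_eq)

text \<open>Caratheodory's argument: the layers of \<open>T - C\<close> at distance about \<open>1 / k\<close> from \<open>C\<close>
  with even \<open>k\<close> are separated from each other, as are those with odd \<open>k\<close>, so their measures are summable and the layers close to
  \<open>C\<close> are negligible.\<close>

lemma closed_caratheodory:
  assumes C: "closed C"
  shows "\<mu> (T \<inter> C) + \<mu> (T - C) = \<mu> T"
proof (rule antisym)
  show "\<mu> T \<le> \<mu> (T \<inter> C) + \<mu> (T - C)"
    using subadditive[of "T \<inter> C" "T - C"] by (simp add: Int_Diff_Un)
  show "\<mu> (T \<inter> C) + \<mu> (T - C) \<le> \<mu> T"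
  proof (cases "C = {} \<or> \<mu> T = top")
    case False
    then have Cne: "C \<noteq> {}" and fin: "\<mu> T < top" by (auto simp: less_top)
    define d where "d x = infdist x C" for x
    define R where "R j = {x \<in> T. 1 / real (j + 2) \<le> d x \<and> d x < 1 / real (j + 1)}" for j
    define S where "S k = {x \<in> T. 1 / real (k + 1) \<le> d x}" for k
    have d_diff: "d x - d y \<le> dist x y" for x y using infdist_triangle[of x C y] by (simp add: d_def)
    have alt: "(\<Sum>k<K. \<mu> (R (2 * k + p))) \<le> \<mu> (\<Union>k<K. R (2 * k + p))" for K p
    proof (induction K)
      case (Suc K)
      have sep: "\<mu> (\<Union>k<K. R (2 * k + p)) + \<mu> (R (2 * K + p)) \<le> \<mu> ((\<Union>k<K. R (2 * k + p)) \<union> R (2 * K + p))"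
      proof (cases "K = 0")
        case False
        let ?q = "2 * K + p"
        show ?thesis
        proof (rule separated)
          \<comment> \<open>Earlier layers of the same parity have \<open>d \<ge> 1 / ?q\<close>,
            since \<open>2 * k + p + 2 \<le> ?q\<close>, while the new one has
            \<open>d < 1 / (?q + 1)\<close>. \<open>K \<noteq> 0\<close> excludes the division by
            \<open>?q = 0\<close>.\<close>
          show "0 < 1 / real ?q - 1 / real (?q + 1)" using False frac_less2[of 1 1 "real ?q" "real (?q + 1)"] by simp
          fix x y assume "x \<in> (\<Union>k<K. R (2 * k + p))" and y: "y \<in> R ?q"
          then obtain k where k: "k < K" "x \<in> R (2 * k + p)" by blast
          have "1 / real ?q \<le> 1 / real (2 * k + p + 2)"
            using k(1) by (intro divide_left_mono) (auto intro!: mult_pos_pos)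
          then have "1 / real ?q \<le> d x" "d y < 1 / real (?q + 1)" using k(2) y by (auto simp: R_def)
          then show "1 / real ?q - 1 / real (?q + 1) \<le> dist x y" using d_diff[of x y] by linarith
        qed
      qed simp
      have "(\<Sum>k<Suc K. \<mu> (R (2 * k + p))) \<le> \<mu> (\<Union>k<K. R (2 * k + p)) + \<mu> (R (2 * K + p))"
        using Suc by (simp add: add_right_mono)
      also have "\<dots> \<le> \<mu> ((\<Union>k<K. R (2 * k + p)) \<union> R (2 * K + p))" by (rule sep)
      also have "(\<Union>k<K. R (2 * k + p)) \<union> R (2 * K + p) = (\<Union>k<Suc K. R (2 * k + p))"
        by (auto simp: lessThan_Suc)
      finally show ?case .
    qed simp
    have altT: "(\<Sum>k<K. \<mu> (R (2 * k + p))) \<le> \<mu> T" for K p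
      using alt[of p K] mono[of "\<Union>k<K. R (2 * k + p)" T] by (auto simp: R_def intro: order_trans)
    have "(\<Sum>j<K. \<mu> (R j)) \<le> \<mu> T + \<mu> T" for K
    proof -
      have "(\<Sum>j<2 * K. \<mu> (R j)) = (\<Sum>k<K. \<mu> (R (2 * k + 0))) + (\<Sum>k<K. \<mu> (R (2 * k + 1)))" for K
        by (induction K) (auto simp: algebra_simps)
      then have "(\<Sum>j<2 * K. \<mu> (R j)) \<le> \<mu> T + \<mu> T" using altT[where p = 0] altT[where p = 1] by (metis add_mono)
      moreover have "(\<Sum>j<K. \<mu> (R j)) \<le> (\<Sum>j<2 * K. \<mu> (R j))" by (intro sum_mono2) auto
      ultimately show ?thesis by simp
    qed
    then have "(\<Sum>j. \<mu> (R j)) \<le> \<mu> T + \<mu> T" by (intro suminf_le_const) auto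
    then have sfin: "(\<Sum>j. \<mu> (R j)) < top" using fin by (simp add: le_less_trans)
    define g where "g j = enn2real (\<mu> (R j))" for j
    have "\<mu> (R j) < top" for j using mono[of "R j" T] fin by (auto simp: R_def intro: le_less_trans)
    then have g: "\<mu> (R j) = ennreal (g j)" "0 \<le> g j" for j by (auto simp: g_def)
    have sg: "summable g" using sfin g by (intro summable_suminf_not_top) (auto simp: less_top)
    show ?thesis
    proof (rule ennreal_le_epsilon)
      fix e :: real assume e: "0 < e"
      have "(\<lambda>n. \<Sum>k. g (k + n)) \<longlonglongrightarrow> 0" using sg by (rule suminf_exist_split2)
      then have "\<forall>\<^sub>F n in sequentially. (\<Sum>k. g (k + n)) < e" using e by (rule order_tendstoD)
      then obtain n where n: "(\<Sum>k. g (k + n)) < e" by (meson eventually_happens sequentially_bot)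
      have tail: "(\<Sum>k. \<mu> (R (k + n))) \<le> ennreal e"
        using n sg g by (simp add: suminf_ennreal2 summable_ignore_initial_segment ennreal_leI)
      have TC: "T - C \<subseteq> S n \<union> (\<Union>k. R (k + n))"
      proof
        fix x assume x: "x \<in> T - C"
        then have "d x > 0" using infdist_pos_not_in_closed[OF C Cne] by (simp add: d_def)
        then obtain k :: nat where k: "1 / real (k + 1) < d x" using nat_approx_posE by (metis Suc_eq_plus1)
        \<comment> \<open>This index decides where \<open>x\<close> lies: in \<open>S n\<close> if
          \<open>k0 \<le> n\<close>, otherwise in the layer \<open>k0 - 1\<close>, which belongs to
          the tail.\<close>
        define k0 where "k0 = (LEAST k. 1 / real (k + 1) \<le> d x)"
        have k0: "1 / real (k0 + 1) \<le> d x" unfolding k0_def by (rule LeastI[of _ k]) (use k in simp)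
        show "x \<in> S n \<union> (\<Union>k. R (k + n))"
        proof (cases "k0 \<le> n")
          case True
          then have "1 / real (n + 1) \<le> 1 / real (k0 + 1)" by (intro divide_left_mono) auto
          then show ?thesis using k0 x by (auto simp: S_def)
        next
          case False
          then have "d x < 1 / real ((k0 - 1) + 1)"
            using not_less_Least[of "k0 - 1" "\<lambda>k. 1 / real (k + 1) \<le> d x"] unfolding k0_def[symmetric] by simp
          then have "x \<in> R (k0 - 1)" using k0 x False by (auto simp: R_def)
          moreover have "k0 - 1 = (k0 - 1 - n) + n" using False by simp
          ultimately show ?thesis by (metis UNIV_I UN_iff UnI2)
        qed
      qed
      have "\<mu> (T - C) \<le> \<mu> (S n) + \<mu> (\<Union>k. R (k + n))"
        using mono[OF TC] subadditive order_trans by blast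
      also have "\<dots> \<le> \<mu> (S n) + ennreal e"
        using countably_subadditive[of "\<lambda>k. R (k + n)"] tail by (intro add_left_mono) (rule order_trans)
      finally have 1: "\<mu> (T - C) \<le> \<mu> (S n) + ennreal e" .
      have "\<mu> (T \<inter> C) + \<mu> (S n) \<le> \<mu> ((T \<inter> C) \<union> S n)"
      proof (rule separated[of "1 / real (n + 1)"])
        fix a b assume "a \<in> T \<inter> C" "b \<in> S n"
        then show "1 / real (n + 1) \<le> dist a b"
          using infdist_le[of a C b] by (auto simp: S_def d_def dist_commute)
      qed simp
      also have "\<dots> \<le> \<mu> T" by (rule mono) (auto simp: S_def)
      finally show "\<mu> (T \<inter> C) + \<mu> (T - C) \<le> \<mu> T + ennreal e"
        using add_left_mono[OF 1, of "\<mu> (T \<inter> C)"] by (metis (no_types, opaque_lifting) add.assoc add_right_mono order_trans)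
    qed
  qed auto
qed

text \<open>The sets that split every set additively form a sigma-algebra on which \<mu> is
  countably additive, and it contains the closed sets. Countable additivity is what lets
  \<open>measure_of\<close> return \<mu>.\<close>

lemma emeasure_borel:
  assumes "A \<in> sets borel"
  shows "emeasure (measure_of UNIV (sets borel) \<mu>) A = \<mu> A"
proof -
  define L where "L = lambda_system UNIV (UNIV :: 'a set set) \<mu>"
  have "outer_measure_space (UNIV :: 'a set set) \<mu>"
    by (auto simp: outer_measure_space_def positive_def increasing_def countably_subadditive_def mono countably_subadditive)
  then have ms: "measure_space UNIV L \<mu>" unfolding L_def
    using sigma_algebra.caratheodory_lemma[OF sigma_algebra_Pow[of UNIV], of \<mu>] by simp
  then have sL: "sigma_algebra UNIV L" and ca: "countably_additive L \<mu>" by (auto simp: measure_space_def)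
  interpret alg: algebra UNIV "UNIV :: 'a set set" using algebra_Pow[of UNIV] by simp
  have "Collect closed \<subseteq> L"
    using closed_caratheodory by (auto simp: L_def alg.lambda_system_eq)
  then have "sigma_sets UNIV (Collect closed) \<subseteq> L" using sL by (simp add: sigma_algebra.sigma_sets_subset)
  then have "sets borel \<subseteq> L" by (simp add: borel_eq_closed)
  then have "countably_additive (sets borel) \<mu>"
    using ca unfolding countably_additive_def by blast
  then show ?thesis using assms
    using sets.sigma_algebra_axioms[of "borel :: 'a measure"]
    by (intro emeasure_measure_of_sigma) (auto simp: positive_def)
qed

end

section \<open>Premeasures at a fixed scale and their limit\<close>

lemma diameter_leI:
  fixes S :: "'a::metric_space set"
  assumes "0 \<le> \<delta>" "\<And>x y. x \<in> S \<Longrightarrow> y \<in> S \<Longrightarrow> dist x y \<le> \<delta>"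
  shows "diameter S \<le> \<delta>"
  using assms by (auto simp: diameter_def intro: cSUP_least)

definition hausdorff_weight :: "nat \<Rightarrow> 'a::metric_space set \<Rightarrow> ennreal" where
  "hausdorff_weight n U = (if U = {} then 0 else ennreal (diameter U ^ n))"

definition hausdorff_cover :: "real \<Rightarrow> 'a::metric_space set \<Rightarrow> (nat \<Rightarrow> 'a set) \<Rightarrow> bool" where
  "hausdorff_cover \<delta> A U \<longleftrightarrow> A \<subseteq> (\<Union>i. U i) \<and> (\<forall>i. bounded (U i) \<and> diameter (U i) \<le> \<delta>)"

lemma hausdorff_premeasure_eq:
  "hausdorff_premeasure n \<delta> A = (INF U \<in> Collect (hausdorff_cover \<delta> A). \<Sum>i. hausdorff_weight n (U i))"
  unfolding hausdorff_premeasure_def hausdorff_cover_def[abs_def] hausdorff_weight_def ..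

lemma hausdorff_premeasure_le:
  "hausdorff_cover \<delta> A U \<Longrightarrow> hausdorff_premeasure n \<delta> A \<le> (\<Sum>i. hausdorff_weight n (U i))"
  unfolding hausdorff_premeasure_eq by (rule INF_lower) simp

lemma hausdorff_premeasure_ge:
  "(\<And>U. hausdorff_cover \<delta> A U \<Longrightarrow> x \<le> (\<Sum>i. hausdorff_weight n (U i))) \<Longrightarrow> x \<le> hausdorff_premeasure n \<delta> A"
  unfolding hausdorff_premeasure_eq by (rule INF_greatest) simp

lemma hausdorff_weight_mono: "V \<subseteq> U \<Longrightarrow> bounded U \<Longrightarrow> hausdorff_weight n V \<le> hausdorff_weight n U"
  by (auto simp: hausdorff_weight_def intro!: ennreal_leI power_mono diameter_subset diameter_ge_0 intro: bounded_subset)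

lemma hausdorff_cover_mono: "hausdorff_cover \<delta> B U \<Longrightarrow> A \<subseteq> B \<Longrightarrow> \<delta> \<le> \<delta>' \<Longrightarrow> hausdorff_cover \<delta>' A U"
  unfolding hausdorff_cover_def by (meson order_trans)

lemma hausdorff_premeasure_mono: "A \<subseteq> B \<Longrightarrow> hausdorff_premeasure n \<delta> A \<le> hausdorff_premeasure n \<delta> B"
  unfolding hausdorff_premeasure_eq by (rule INF_superset_mono) (auto elim: hausdorff_cover_mono)

lemma hausdorff_premeasure_antimono: "\<delta> \<le> \<delta>' \<Longrightarrow> hausdorff_premeasure n \<delta>' A \<le> hausdorff_premeasure n \<delta> A"
  unfolding hausdorff_premeasure_eq by (rule INF_superset_mono) (auto elim: hausdorff_cover_mono)

lemma hausdorff_premeasure_empty: "0 \<le> \<delta> \<Longrightarrow> hausdorff_premeasure n \<delta> {} = 0"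
  using hausdorff_premeasure_le[of \<delta> "{}" "\<lambda>_. {}" n] by (simp add: hausdorff_cover_def hausdorff_weight_def)

text \<open>Covers of the \<open>A i\<close> that are optimal up to \<open>e / 2 ^ (i + 1)\<close>
  are merged into one sequence by a pairing of natural numbers; the errors add up to
  \<open>e\<close>.\<close>

lemma hausdorff_premeasure_countably_subadditive:
  "hausdorff_premeasure n \<delta> (\<Union>i. A i) \<le> (\<Sum>i::nat. hausdorff_premeasure n \<delta> (A i))"
proof (rule ennreal_le_epsilon)
  fix e :: real assume e: "0 < e" and fin: "(\<Sum>i. hausdorff_premeasure n \<delta> (A i)) < top"
  have "\<exists>U. hausdorff_cover \<delta> (A i) U \<and>
      (\<Sum>j. hausdorff_weight n (U j)) < hausdorff_premeasure n \<delta> (A i) + e * (1/2)^Suc i" for i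
  proof -
    have "hausdorff_premeasure n \<delta> (A i) < hausdorff_premeasure n \<delta> (A i) + e * (1/2)^Suc i"
      using e fin by (auto simp add: less_top dest!: ennreal_suminf_lessD)
    then show ?thesis unfolding hausdorff_premeasure_eq[of n \<delta> "A i"] INF_less_iff by auto
  qed
  then obtain U where U: "\<And>i. hausdorff_cover \<delta> (A i) (U i)"
      "\<And>i. (\<Sum>j. hausdorff_weight n (U i j)) < hausdorff_premeasure n \<delta> (A i) + e * (1/2)^Suc i" by metis
  define W where "W = case_prod U \<circ> prod_decode"
  have "(\<Union>i. A i) \<subseteq> (\<Union>i. W i)"
  proof
    fix x assume "x \<in> (\<Union>i. A i)"
    then obtain i j where "x \<in> U i j" using U(1) by (auto simp: hausdorff_cover_def) blast
    then have "x \<in> W (prod_encode (i, j))" by (simp add: W_def)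
    then show "x \<in> (\<Union>i. W i)" by blast
  qed
  then have "hausdorff_cover \<delta> (\<Union>i. A i) W"
    using U(1) by (auto simp: hausdorff_cover_def W_def split_def)
  then have "hausdorff_premeasure n \<delta> (\<Union>i. A i) \<le> (\<Sum>i. hausdorff_weight n (W i))"
    by (rule hausdorff_premeasure_le)
  also have "\<dots> = (\<Sum>i. \<Sum>j. hausdorff_weight n (U i j))"
    using suminf_ennreal_2dimen[of _ "\<lambda>p. hausdorff_weight n (case_prod U p)"] by (simp add: W_def)
  also have "\<dots> \<le> (\<Sum>i. hausdorff_premeasure n \<delta> (A i) + e * (1/2)^Suc i)"
    using U(2) by (intro suminf_le allI less_imp_le) auto
  also have "\<dots> = (\<Sum>i. hausdorff_premeasure n \<delta> (A i)) + (\<Sum>i. ennreal e * ennreal ((1/2) ^ Suc i))"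
    using e by (subst suminf_add[symmetric]) (auto simp del: ennreal_suminf_cmult simp add: ennreal_mult[symmetric])
  also have "\<dots> = (\<Sum>i. hausdorff_premeasure n \<delta> (A i)) + e"
    unfolding ennreal_suminf_cmult by (subst suminf_ennreal_eq[OF zero_le_power power_half_series]) auto
  finally show "hausdorff_premeasure n \<delta> (\<Union>i. A i) \<le> (\<Sum>i. hausdorff_premeasure n \<delta> (A i)) + e" .
qed

lemma hausdorff_premeasure_le_measure: "0 < \<delta> \<Longrightarrow> hausdorff_premeasure n \<delta> A \<le> hausdorff_measure n A"
  unfolding hausdorff_measure_def by (rule SUP_upper) simp

text \<open>The scales \<open>1 / (k + 1)\<close> are cofinal, and along them the premeasures
  increase, so that suprema for two sets can be added termwise.\<close>

lemma hausdorff_measure_sequential: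
  "hausdorff_measure n A = (SUP k. hausdorff_premeasure n (1 / real (Suc k)) A)"
proof (rule antisym)
  show "hausdorff_measure n A \<le> (SUP k. hausdorff_premeasure n (1 / real (Suc k)) A)"
    unfolding hausdorff_measure_def
  proof (rule SUP_least)
    fix \<delta> :: real assume "\<delta> \<in> {0<..}"
    then obtain k where "1 / real (Suc k) < \<delta>" using nat_approx_posE by (metis greaterThan_iff)
    then show "hausdorff_premeasure n \<delta> A \<le> (SUP k. hausdorff_premeasure n (1 / real (Suc k)) A)"
      by (intro SUP_upper2[of k] hausdorff_premeasure_antimono) auto
  qed
  show "(SUP k. hausdorff_premeasure n (1 / real (Suc k)) A) \<le> hausdorff_measure n A"
    by (intro SUP_least hausdorff_premeasure_le_measure) simp
qed

text \<open>At a scale below \<open>e\<close> no covering set meets both \<open>A\<close> and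
  \<open>B\<close>, so a cover of the union splits into two covers without counting any weight
  twice.\<close>

lemma hausdorff_premeasure_separated:
  assumes \<delta>: "\<delta> < e" and sep: "\<And>a b. a \<in> A \<Longrightarrow> b \<in> B \<Longrightarrow> e \<le> dist a b"
  shows "hausdorff_premeasure n \<delta> A + hausdorff_premeasure n \<delta> B \<le> hausdorff_premeasure n \<delta> (A \<union> B)"
proof (rule hausdorff_premeasure_ge)
  fix U assume U: "hausdorff_cover \<delta> (A \<union> B) U"
  have b: "bounded (U i)" "diameter (U i) \<le> \<delta>" for i using U by (auto simp: hausdorff_cover_def)
  have sub: "hausdorff_cover \<delta> C (\<lambda>i. U i \<inter> C)" if "C \<subseteq> A \<union> B" for C
    using that U b diameter_subset[of "U _ \<inter> C" "U _"]
    by (auto simp: hausdorff_cover_def intro: order_trans[OF diameter_subset])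
  have "hausdorff_premeasure n \<delta> A + hausdorff_premeasure n \<delta> B
      \<le> (\<Sum>i. hausdorff_weight n (U i \<inter> A)) + (\<Sum>i. hausdorff_weight n (U i \<inter> B))"
    by (intro add_mono hausdorff_premeasure_le sub) auto
  also have "\<dots> = (\<Sum>i. hausdorff_weight n (U i \<inter> A) + hausdorff_weight n (U i \<inter> B))"
    by (rule suminf_add) auto
  also have "\<dots> \<le> (\<Sum>i. hausdorff_weight n (U i))"
  proof (rule suminf_le)
    fix i
    have "U i \<inter> A = {} \<or> U i \<inter> B = {}"
    proof (rule ccontr)
      assume "\<not> ?thesis"
      then obtain x y where xy: "x \<in> U i" "x \<in> A" "y \<in> U i" "y \<in> B" by blast
      then show False using sep[of x y] diameter_bounded_bound[OF b(1)[of i], of x y] b(2)[of i] \<delta> by simp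
    qed
    then show "hausdorff_weight n (U i \<inter> A) + hausdorff_weight n (U i \<inter> B) \<le> hausdorff_weight n (U i)"
      using hausdorff_weight_mono[of "U i \<inter> A" "U i" n] hausdorff_weight_mono[of "U i \<inter> B" "U i" n] b(1)[of i]
      by (auto simp: hausdorff_weight_def[of _ "{}"])
  qed auto
  finally show "hausdorff_premeasure n \<delta> A + hausdorff_premeasure n \<delta> B \<le> (\<Sum>i. hausdorff_weight n (U i))" .
qed

interpretation hausdorff: metric_outer_measure "hausdorff_measure n :: 'a::metric_space set \<Rightarrow> ennreal" for n
proof
  show "hausdorff_measure n {} = 0" for n
    by (simp add: hausdorff_measure_sequential hausdorff_premeasure_empty)
  show "hausdorff_measure n A \<le> hausdorff_measure n B" if "A \<subseteq> B" for n and A B :: "'a set"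
    unfolding hausdorff_measure_def using that by (intro SUP_mono) (auto intro: hausdorff_premeasure_mono)
  show "hausdorff_measure n (\<Union>i. A i) \<le> (\<Sum>i. hausdorff_measure n (A i))" for n and A :: "nat \<Rightarrow> 'a set"
    unfolding hausdorff_measure_def[of n "\<Union>i. A i"]
  proof (rule SUP_least)
    fix \<delta> :: real assume "\<delta> \<in> {0<..}"
    then have "(\<Sum>i. hausdorff_premeasure n \<delta> (A i)) \<le> (\<Sum>i. hausdorff_measure n (A i))"
      by (intro suminf_le hausdorff_premeasure_le_measure) auto
    then show "hausdorff_premeasure n \<delta> (\<Union>i. A i) \<le> (\<Sum>i. hausdorff_measure n (A i))"
      using hausdorff_premeasure_countably_subadditive order_trans by blast
  qed
  show "hausdorff_measure n A + hausdorff_measure n B \<le> hausdorff_measure n (A \<union> B)"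
    if e: "0 < e" and sep: "\<And>a b. a \<in> A \<Longrightarrow> b \<in> B \<Longrightarrow> e \<le> dist a b" for n e and A B :: "'a set"
  proof -
    have inc: "incseq (\<lambda>k. hausdorff_premeasure n (1 / real (Suc k)) A)" for A :: "'a set"
      by (intro incseq_SucI hausdorff_premeasure_antimono divide_left_mono) auto
    have "hausdorff_measure n A + hausdorff_measure n B
       = (SUP k. hausdorff_premeasure n (1 / real (Suc k)) A + hausdorff_premeasure n (1 / real (Suc k)) B)"
      unfolding hausdorff_measure_sequential using inc inc by (rule ennreal_SUP_add[symmetric])
    also have "\<dots> \<le> hausdorff_measure n (A \<union> B)"
    proof (rule SUP_least)
      fix k
      obtain l where l: "1 / real (Suc l) < e" using nat_approx_posE[OF e] by metis
      \<comment> \<open>Fine enough for the separation and no coarser than the given scale.\<close>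
      define \<delta> where "\<delta> = 1 / real (Suc (max k l))"
      have "\<delta> \<le> 1 / real (Suc k)" "\<delta> \<le> 1 / real (Suc l)" by (auto simp: \<delta>_def intro!: divide_left_mono)
      then have "hausdorff_premeasure n (1 / real (Suc k)) A + hausdorff_premeasure n (1 / real (Suc k)) B
        \<le> hausdorff_premeasure n \<delta> A + hausdorff_premeasure n \<delta> B"
        by (intro add_mono hausdorff_premeasure_antimono)
      also have "\<dots> \<le> hausdorff_premeasure n \<delta> (A \<union> B)"
        using l \<open>\<delta> \<le> 1 / real (Suc l)\<close> sep by (intro hausdorff_premeasure_separated[of \<delta> e]) auto
      also have "\<dots> \<le> hausdorff_measure n (A \<union> B)"
        by (rule hausdorff_premeasure_le_measure) (simp add: \<delta>_def)
      finally show "hausdorff_premeasure n (1 / real (Suc k)) A + hausdorff_premeasure n (1 / real (Suc k)) B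
        \<le> hausdorff_measure n (A \<union> B)" .
    qed
    finally show ?thesis .
  qed
qed

lemma hausdorff_measure_isometry_le:
  fixes f :: "'a::metric_space \<Rightarrow> 'b::metric_space"
  assumes f: "\<And>x y. dist (f x) (f y) = dist x y"
  shows "hausdorff_measure n (f ` A) \<le> hausdorff_measure n A"
  unfolding hausdorff_measure_def
proof (intro SUP_mono bexI)
  fix \<delta> :: real assume \<delta>: "\<delta> \<in> {0<..}"
  show "hausdorff_premeasure n \<delta> (f ` A) \<le> hausdorff_premeasure n \<delta> A"
  proof (rule hausdorff_premeasure_ge)
    fix U assume U: "hausdorff_cover \<delta> A U"
    have b: "bounded (U i)" "diameter (U i) \<le> \<delta>" for i using U by (auto simp: hausdorff_cover_def)
    have d: "diameter (f ` U i) \<le> diameter (U i)" for i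
      using b(1)[of i] by (intro diameter_leI) (auto simp: f diameter_ge_0 diameter_bounded_bound)
    have "bounded (f ` U i)" for i
      using b(1)[of i] unfolding bounded_def by (metis (no_types, lifting) f imageE)
    then have "hausdorff_cover \<delta> (f ` A) (\<lambda>i. f ` U i)"
      using U order_trans[OF d b(2)] unfolding hausdorff_cover_def by blast
    then have "hausdorff_premeasure n \<delta> (f ` A) \<le> (\<Sum>i. hausdorff_weight n (f ` U i))"
      by (rule hausdorff_premeasure_le)
    also have "\<dots> \<le> (\<Sum>i. hausdorff_weight n (U i))"
      using d \<open>\<And>i. bounded (f ` U i)\<close>
      by (intro suminf_le) (auto simp: hausdorff_weight_def intro!: ennreal_leI power_mono diameter_ge_0)
    finally show "hausdorff_premeasure n \<delta> (f ` A) \<le> (\<Sum>i. hausdorff_weight n (U i))" .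
  qed
qed

lemma hausdorff_measure_isometry:
  fixes f :: "'a::metric_space \<Rightarrow> 'b::metric_space"
  assumes f: "\<And>x y. dist (f x) (f y) = dist x y" and "surj f"
  shows "hausdorff_measure n (f ` A) = hausdorff_measure n A"
proof (rule antisym)
  show "hausdorff_measure n (f ` A) \<le> hausdorff_measure n A" using f by (rule hausdorff_measure_isometry_le)
  have inj: "inj f" unfolding inj_def using f by (metis dist_eq_0_iff)
  have "dist (inv f x) (inv f y) = dist x y" for x y using f assms(2) by (metis surj_f_inv_f)
  then have "hausdorff_measure n (inv f ` f ` A) \<le> hausdorff_measure n (f ` A)" by (rule hausdorff_measure_isometry_le)
  then show "hausdorff_measure n A \<le> hausdorff_measure n (f ` A)" using inj by (simp add: image_inv_f_f)
qed

lemma hausdorff_premeasure_finite_cover: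
  assumes I: "finite I" and A: "A \<subseteq> (\<Union>k\<in>I. F k)"
    and F: "\<And>k. k \<in> I \<Longrightarrow> bounded (F k) \<and> diameter (F k) \<le> \<delta>" and \<delta>: "0 \<le> \<delta>"
  shows "hausdorff_premeasure n \<delta> A \<le> (\<Sum>k\<in>I. hausdorff_weight n (F k))"
proof -
  obtain h where h: "bij_betw h {..<card I} I" using ex_bij_betw_nat_finite[OF I] by (auto simp: lessThan_atLeast0)
  \<comment> \<open>Padding with empty sets is free because their weight is \<open>0\<close> even
    for \<open>n = 0\<close>.\<close>
  define U where "U i = (if i < card I then F (h i) else {})" for i
  have hI: "h i \<in> I" if "i < card I" for i using h that by (auto simp: bij_betw_def)
  have "A \<subseteq> (\<Union>i. U i)"
  proof
    fix x assume "x \<in> A"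
    then obtain k where k: "k \<in> I" "x \<in> F k" using A by blast
    then obtain i where "i < card I" "k = h i" using h by (auto simp: bij_betw_def)
    then show "x \<in> (\<Union>i. U i)" using k by (auto simp: U_def)
  qed
  then have "hausdorff_cover \<delta> A U" using F hI \<delta> by (auto simp: hausdorff_cover_def U_def)
  then have "hausdorff_premeasure n \<delta> A \<le> (\<Sum>i. hausdorff_weight n (U i))" by (rule hausdorff_premeasure_le)
  also have "\<dots> = (\<Sum>i<card I. hausdorff_weight n (U i))"
    by (rule suminf_finite) (auto simp: U_def hausdorff_weight_def)
  also have "\<dots> = (\<Sum>i<card I. hausdorff_weight n (F (h i)))" by (simp add: U_def)
  also have "\<dots> = (\<Sum>k\<in>I. hausdorff_weight n (F k))" using h by (rule sum.reindex_bij_betw)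
  finally show ?thesis .
qed

section \<open>Coordinates with respect to a frame\<close>

locale frame_basis =
  fixes e :: "nat \<Rightarrow> 'b::real_normed_vector" and n :: nat and c :: real
  assumes c_pos: "0 < c" and frame_bound: "c * (\<Sum>i<n. \<bar>v i\<bar>) \<le> norm (lincomb e n v)"
    and surj_lincomb: "surj (lincomb e n)"
begin

text \<open>The entries below \<open>n\<close> of a preimage are determined by the frame bound; the
  value \<open>0\<close> from \<open>n\<close> on places the result in
  \<open>coord_space n\<close>.\<close>

definition coords :: "'b \<Rightarrow> nat \<Rightarrow> real" where
  "coords x i = (if i < n then inv (lincomb e n) x i else 0)"

lemma lincomb_coords: "lincomb e n (coords x) = x"
proof -
  have "lincomb e n (coords x) = lincomb e n (inv (lincomb e n) x)"
    unfolding lincomb_def[of e n "coords x"] lincomb_def[of e n "inv (lincomb e n) x"]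
    by (intro sum.cong) (auto simp: coords_def)
  then show ?thesis using surj_lincomb by (simp add: surj_f_inv_f)
qed

lemma coord_le: "i < n \<Longrightarrow> c * \<bar>v i\<bar> \<le> norm (lincomb e n v)"
  using frame_bound[of v] c_pos member_le_sum[of i "{..<n}" "\<lambda>i. \<bar>v i\<bar>"]
  by (auto intro: order_trans[OF mult_left_mono])

lemma coords_lincomb: "i < n \<Longrightarrow> coords (lincomb e n v) i = v i"
  using coord_le[of i "\<lambda>i. coords (lincomb e n v) i - v i"] c_pos
  by (simp add: lincomb_diff lincomb_coords mult_le_0_iff)

lemma coords_add: "i < n \<Longrightarrow> coords (x + y) i = coords x i + coords y i"
  using coords_lincomb[of i "\<lambda>i. coords x i + coords y i"] by (simp add: lincomb_add lincomb_coords)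

lemma coords_diff: "i < n \<Longrightarrow> coords (x - y) i = coords x i - coords y i"
  using coords_lincomb[of i "\<lambda>i. coords x i - coords y i"] by (simp add: lincomb_diff lincomb_coords)

lemma abs_coords_le: "i < n \<Longrightarrow> \<bar>coords x i\<bar> \<le> norm x / c"
  using coord_le[of i "coords x"] c_pos by (simp add: lincomb_coords field_simps)

lemma continuous_coords: "continuous_on A (\<lambda>x. coords x i)"
proof (cases "i < n")
  case True
  show ?thesis
  proof (rule continuous_onI)
    fix x and \<epsilon> :: real assume "0 < \<epsilon>"
    show "\<exists>d>0. \<forall>x'\<in>A. dist x' x < d \<longrightarrow> dist (coords x' i) (coords x i) \<le> \<epsilon>"
    proof (intro exI[of _ "\<epsilon> * c"] conjI ballI impI)
      fix x' assume "dist x' x < \<epsilon> * c"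
      then have "norm (x' - x) / c < \<epsilon>" using c_pos by (simp add: dist_norm field_simps)
      then show "dist (coords x' i) (coords x i) \<le> \<epsilon>"
        using abs_coords_le[OF True, of "x' - x"] True by (simp add: dist_norm coords_diff)
    qed (use \<open>0 < \<epsilon>\<close> c_pos in simp)
  qed
qed (simp add: coords_def)

lemma coords_measurable [measurable]: "(\<lambda>x. coords x i) \<in> borel_measurable borel"
  by (intro borel_measurable_continuous_onI continuous_coords)

section \<open>Boxes and grids in coordinates\<close>

definition box_at :: "(nat \<Rightarrow> nat) \<Rightarrow> real \<Rightarrow> 'b set" where
  "box_at k t = {x. \<forall>i<n. real (k i) * t \<le> coords x i \<and> coords x i < (real (k i) + 1) * t}"

abbreviation unit_box :: "'b set" where "unit_box \<equiv> box_at (\<lambda>_. 0) 1"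

definition edge_sum :: real where "edge_sum = (\<Sum>i<n. norm (e i))"

lemma edge_sum_nonneg: "0 \<le> edge_sum"
  unfolding edge_sum_def by (intro sum_nonneg) simp

lemma box_at_borel [measurable]: "box_at k t \<in> sets borel"
  unfolding box_at_def by measurable

lemma box_at_translate: "(+) (lincomb e n (\<lambda>i. real (k i) * t)) ` box_at (\<lambda>_. 0) t = box_at k t"
proof (intro equalityI subsetI)
  fix x assume "x \<in> box_at k t"
  then show "x \<in> (+) (lincomb e n (\<lambda>i. real (k i) * t)) ` box_at (\<lambda>_. 0) t"
    by (intro image_eqI[of _ _ "x - lincomb e n (\<lambda>i. real (k i) * t)"])
       (auto simp: box_at_def coords_diff coords_lincomb algebra_simps)
qed (auto simp: box_at_def coords_add coords_lincomb algebra_simps)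

lemma dist_box_at:
  assumes "x \<in> box_at k t" "y \<in> box_at k t" "0 \<le> t"
  shows "dist x y \<le> t * edge_sum"
proof -
  have "dist x y = norm (lincomb e n (\<lambda>i. coords x i - coords y i))" by (simp add: lincomb_diff lincomb_coords dist_norm)
  also have "\<dots> \<le> (\<Sum>i<n. \<bar>coords x i - coords y i\<bar> * norm (e i))" by (rule norm_lincomb_le)
  also have "\<dots> \<le> (\<Sum>i<n. t * norm (e i))"
  proof (intro sum_mono mult_right_mono)
    fix i assume "i \<in> {..<n}"
    then have "real (k i) * t \<le> coords x i" "coords x i < (real (k i) + 1) * t"
      "real (k i) * t \<le> coords y i" "coords y i < (real (k i) + 1) * t" using assms by (auto simp: box_at_def)
    then show "\<bar>coords x i - coords y i\<bar> \<le> t" by (simp add: algebra_simps)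
  qed simp
  also have "\<dots> = t * edge_sum" by (simp add: edge_sum_def sum_distrib_left)
  finally show ?thesis .
qed

lemma bounded_box_at: "0 \<le> t \<Longrightarrow> bounded (box_at k t)"
  unfolding bounded_def using dist_box_at by blast

definition grid :: "nat \<Rightarrow> (nat \<Rightarrow> nat) set" where "grid j = PiE {..<n} (\<lambda>_. {..<j})"

lemma finite_grid: "finite (grid j)" and card_grid: "card (grid j) = j ^ n"
  by (auto simp: grid_def card_PiE finite_PiE)

lemma box_grid:
  assumes t: "0 < t"
  shows "box_at (\<lambda>_. 0) (real j * t) = (\<Union>k\<in>grid j. box_at k t)"
proof (intro equalityI subsetI)
  fix x assume x: "x \<in> box_at (\<lambda>_. 0) (real j * t)"
  define k where "k = (\<lambda>i\<in>{..<n}. nat \<lfloor>coords x i / t\<rfloor>)"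
  have k: "real (k i) * t \<le> coords x i \<and> coords x i < (real (k i) + 1) * t \<and> k i < j" if i: "i < n" for i
  proof -
    have b: "0 \<le> coords x i" "coords x i < real j * t" using x i by (auto simp: box_at_def)
    then have "0 \<le> coords x i / t" using t by simp
    then have r: "real (k i) = of_int \<lfloor>coords x i / t\<rfloor>" using i by (simp add: k_def)
    have "real (k i) \<le> coords x i / t" "coords x i / t < real (k i) + 1" unfolding r by linarith+
    then have 1: "real (k i) * t \<le> coords x i" "coords x i < (real (k i) + 1) * t"
      using t by (auto simp: field_simps)
    then have "real (k i) * t < real j * t" using b by simp
    then show ?thesis using 1 t by simp
  qed
  have "k \<in> grid j" unfolding grid_def
  proof (rule PiE_I)
    show "k i \<in> {..<j}" if "i \<in> {..<n}" for i using k that by simp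
  qed (simp add: k_def)
  moreover have "x \<in> box_at k t" using k by (simp add: box_at_def)
  ultimately show "x \<in> (\<Union>k\<in>grid j. box_at k t)" by blast
next
  fix x assume "x \<in> (\<Union>k\<in>grid j. box_at k t)"
  then obtain k where k: "k \<in> grid j" "x \<in> box_at k t" by blast
  have "0 \<le> coords x i \<and> coords x i < real j * t" if i: "i < n" for i
  proof -
    have "k i < j" using k(1) i by (auto simp: grid_def)
    then have "(real (k i) + 1) * t \<le> real j * t" using t by (intro mult_right_mono) auto
    moreover have "0 \<le> real (k i) * t" using t by simp
    moreover have "real (k i) * t \<le> coords x i" "coords x i < (real (k i) + 1) * t" using k(2) i by (auto simp: box_at_def)
    ultimately show ?thesis by linarith
  qed
  then show "x \<in> box_at (\<lambda>_. 0) (real j * t)" by (simp add: box_at_def)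
qed

lemma disjoint_grid: "0 < t \<Longrightarrow> disjoint_family_on (\<lambda>k. box_at k t) (grid j)"
  unfolding disjoint_family_on_def
proof (intro ballI impI)
  fix k l assume t: "0 < t" and kl: "k \<in> grid j" "l \<in> grid j" "k \<noteq> l"
  then obtain i where i: "i < n" "k i \<noteq> l i" unfolding grid_def by (metis PiE_ext lessThan_iff)
  show "box_at k t \<inter> box_at l t = {}"
  proof (rule ccontr)
    assume "box_at k t \<inter> box_at l t \<noteq> {}"
    then obtain x where "real (k i) * t \<le> coords x i" "coords x i < (real (k i) + 1) * t"
      "real (l i) * t \<le> coords x i" "coords x i < (real (l i) + 1) * t" using i by (auto simp: box_at_def)
    then have "real (k i) * t < (real (l i) + 1) * t" "real (l i) * t < (real (k i) + 1) * t" by linarith+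
    then have "real (k i) < real (l i) + 1" "real (l i) < real (k i) + 1" using t by auto
    then show False using i by linarith
  qed
qed

text \<open>Coordinates of points within \<open>d\<close> of \<open>u\<close> differ from those of
  \<open>u\<close> by at most \<open>d / c < s\<close>, so the set lies in the box of side
  \<open>2 * s\<close> centred at \<open>u\<close>, whose lower corner is the translation vector.
  The inequality is strict because boxes are half-open.\<close>

lemma small_set_in_box:
  assumes S: "\<And>x. x \<in> S \<Longrightarrow> dist u x \<le> d" and s: "d / c < s"
  shows "S \<subseteq> (+) (u - lincomb e n (\<lambda>_. s)) ` box_at (\<lambda>_. 0) (2 * s)"
proof
  fix x assume x: "x \<in> S"
  have "\<bar>coords (x - u) i\<bar> < s" if "i < n" for i
  proof -
    have "norm (x - u) / c \<le> d / c" using S[OF x] c_pos by (intro divide_right_mono) (auto simp: dist_norm norm_minus_commute)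
    then show ?thesis using abs_coords_le[OF that, of "x - u"] s by simp
  qed
  then have "x - (u - lincomb e n (\<lambda>_. s)) \<in> box_at (\<lambda>_. 0) (2 * s)"
    by (auto simp: box_at_def coords_diff coords_lincomb abs_less_iff less_imp_le)
       (smt (verit) coords_diff)+
  then show "x \<in> (+) (u - lincomb e n (\<lambda>_. s)) ` box_at (\<lambda>_. 0) (2 * s)"
    by (intro image_eqI[of _ _ "x - (u - lincomb e n (\<lambda>_. s))"]) auto
qed

text \<open>The unit box consists of \<open>j ^ n\<close> cells of diameter at most
  \<open>edge_sum / j\<close>, of total weight at most \<open>edge_sum ^ n\<close> whatever the
  scale.\<close>

lemma hausdorff_unit_box_finite: "hausdorff_measure n unit_box < \<infinity>"
proof -
  have "hausdorff_measure n unit_box \<le> ennreal (edge_sum ^ n)"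
    unfolding hausdorff_measure_def
  proof (rule SUP_least)
    fix \<delta> :: real assume \<delta>: "\<delta> \<in> {0<..}"
    obtain j :: nat where j: "real j > max 0 (edge_sum / \<delta>)" using reals_Archimedean2 by blast
    then have j0: "j > 0" "edge_sum / real j \<le> \<delta>" using \<delta> by (auto simp: field_simps)
    have diam: "diameter (box_at k (1 / real j)) \<le> edge_sum / real j" for k
      using dist_box_at[of _ k "1 / real j"] edge_sum_nonneg by (intro diameter_leI) auto
    have "hausdorff_premeasure n \<delta> unit_box \<le> (\<Sum>k\<in>grid j. hausdorff_weight n (box_at k (1 / real j)))"
    proof (rule hausdorff_premeasure_finite_cover)
      show "unit_box \<subseteq> (\<Union>k\<in>grid j. box_at k (1 / real j))" using box_grid[of "1 / real j" j] j0 by simp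
      show "bounded (box_at k (1 / real j)) \<and> diameter (box_at k (1 / real j)) \<le> \<delta>" for k
        using bounded_box_at diam[of k] j0(2) by auto
    qed (use finite_grid \<delta> in auto)
    also have "\<dots> \<le> (\<Sum>k\<in>grid j. ennreal ((edge_sum / real j) ^ n))"
      using diam by (intro sum_mono) (auto simp: hausdorff_weight_def intro!: ennreal_leI power_mono diameter_ge_0 bounded_box_at)
    also have "\<dots> = ennreal (edge_sum ^ n)"
      using j0 edge_sum_nonneg
      by (simp add: card_grid power_divide ennreal_of_nat_eq_real_of_nat flip: ennreal_mult')
    finally show "hausdorff_premeasure n \<delta> unit_box \<le> ennreal (edge_sum ^ n)" .
  qed
  then show ?thesis by (simp add: le_less_trans[OF _ ennreal_less_top])
qed

text \<open>A set of diameter \<open>d\<close> fits into a box of side \<open>2 * s\<close> for any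
  \<open>s > d / c\<close>, and a box of side \<open>t \<le> 1\<close> has at most
  \<open>(2 * t) ^ n\<close> times the measure of the unit box. The two factors 2 give
  \<open>4 / c\<close>, and \<open>diameter U < c / 2\<close> leaves room for
  \<open>2 * s \<le> 1\<close>. The closure is taken to have a Borel set.\<close>

lemma emeasure_small_set_le:
  assumes M: "invariant_measure (M :: 'b measure)" and U: "bounded U" "U \<noteq> {}" "diameter U < c / 2"
  shows "emeasure M (closure U) \<le> ennreal ((4 / c * diameter U) ^ n) * emeasure M unit_box"
proof -
  interpret invariant_measure M by fact
  define M1 where "M1 = measure M unit_box"
  have fin: "emeasure M S < \<infinity>" if "bounded S" for S using that by (rule emeasure_bounded_finite)
  have M1: "emeasure M unit_box = ennreal M1" "0 \<le> M1"
    using fin[OF bounded_box_at[of 1]] by (auto simp: M1_def emeasure_eq_ennreal_measure less_top)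
  have inv: "emeasure M (box_at k t) = emeasure M (box_at (\<lambda>_. 0) t)" for k t
    unfolding box_at_translate[of k t, symmetric] by (rule invariant[OF box_at_borel])
  have grid_measure: "real j ^ n * measure M (box_at (\<lambda>_. 0) (1 / real j)) = M1" if "j > 0" for j
  proof -
    have "M1 = measure M (\<Union>k\<in>grid j. box_at k (1 / real j))"
      using box_grid[of "1 / real j" j] that by (simp add: M1_def)
    also have "\<dots> = (\<Sum>k\<in>grid j. measure M (box_at k (1 / real j)))"
      using that fin[OF bounded_box_at] by (intro measure_finite_Union finite_grid disjoint_grid) (auto simp: less_top)
    also have "\<dots> = real j ^ n * measure M (box_at (\<lambda>_. 0) (1 / real j))"
    proof -
      have "measure M (box_at k (1 / real j)) = measure M (box_at (\<lambda>_. 0) (1 / real j))" for k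
        using inv[of k "1 / real j"] by (simp add: measure_def)
      then have "(\<Sum>k\<in>grid j. measure M (box_at k (1 / real j))) = (\<Sum>k\<in>grid j. measure M (box_at (\<lambda>_. 0) (1 / real j)))"
        by (intro sum.cong refl)
      then show ?thesis by (simp add: card_grid)
    qed
    finally show ?thesis by simp
  qed
  have small: "measure M (box_at (\<lambda>_. 0) t) \<le> (2 * t) ^ n * M1" if t: "0 < t" "t \<le> 1" for t
  proof -
    \<comment> \<open>\<open>1 / j\<close> is the least reciprocal of an integer that is at least
      \<open>t\<close>, and it is at most \<open>2 * t\<close>; boxes of side \<open>1 / j\<close>
      tile the unit box.\<close>
    define j where "j = nat \<lfloor>1 / t\<rfloor>"
    have "1 \<le> 1 / t" using t by simp
    then have "\<lfloor>1 / t\<rfloor> \<ge> 1" by linarith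
    then have "real j = of_int \<lfloor>1 / t\<rfloor>" "real j \<ge> 1" unfolding j_def by linarith+
    then have j: "real j \<ge> 1" "real j \<le> 1 / t" "1 / t < real j + 1" by linarith+
    have "1 / t < 2 * real j" using j by linarith
    then have tj: "t \<le> 1 / real j" "1 / real j \<le> 2 * t" using t j(1,2) by (simp_all add: field_simps)
    have "box_at (\<lambda>_. 0) t \<subseteq> box_at (\<lambda>_. 0) (1 / real j)" using tj by (auto simp: box_at_def)
    then have "measure M (box_at (\<lambda>_. 0) t) \<le> measure M (box_at (\<lambda>_. 0) (1 / real j))"
      using fin[OF bounded_box_at] by (intro measure_mono_fmeasurable) (auto simp: fmeasurable_def)
    also have "\<dots> = (1 / real j) ^ n * M1" using grid_measure[of j] j(1) by (simp add: field_simps)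
    also have "\<dots> \<le> (2 * t) ^ n * M1" using tj M1 by (intro mult_right_mono power_mono) auto
    finally show ?thesis .
  qed
  obtain u where u: "u \<in> U" using U by blast
  define d where "d = diameter U"
  have d: "0 \<le> d" "d / c < 1 / 2" using U c_pos by (auto simp: d_def diameter_ge_0 field_simps)
  have cl: "dist u x \<le> d" if "x \<in> closure U" for x
    using diameter_bounded_bound[of "closure U" u x] that u U by (auto simp: d_def diameter_closure closure_subset[THEN subsetD])
  have bound: "measure M (closure U) \<le> (4 * s) ^ n * M1" if s: "d / c < s" "s \<le> 1 / 2" for s
  proof -
    have s0: "0 < s" using s(1) d(1) c_pos by (smt (verit) divide_nonneg_pos)
    let ?a = "u - lincomb e n (\<lambda>_. s)"
    have eq: "emeasure M ((+) ?a ` box_at (\<lambda>_. 0) (2 * s)) = emeasure M (box_at (\<lambda>_. 0) (2 * s))"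
      by (intro invariant) simp
    have "emeasure M (closure U) \<le> emeasure M ((+) ?a ` box_at (\<lambda>_. 0) (2 * s))"
    proof (rule emeasure_mono)
      show "closure U \<subseteq> (+) ?a ` box_at (\<lambda>_. 0) (2 * s)"
        using cl s(1) by (rule small_set_in_box)
      have "(+) ?a ` box_at (\<lambda>_. 0) (2 * s) = (\<lambda>x. x - ?a) -` box_at (\<lambda>_. 0) (2 * s) \<inter> space borel"
        by (auto simp: image_iff intro!: bexI[of _ "_ - ?a"])
      also have "\<dots> \<in> sets borel"
        by (intro measurable_sets[OF _ box_at_borel] borel_measurable_continuous_onI continuous_intros)
      finally show "(+) ?a ` box_at (\<lambda>_. 0) (2 * s) \<in> sets M" by simp
    qed
    then have "measure M (closure U) \<le> measure M (box_at (\<lambda>_. 0) (2 * s))"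
      unfolding eq measure_def using fin[OF bounded_box_at, of "2 * s"] s0 by (intro enn2real_mono) auto
    also have "\<dots> \<le> (2 * (2 * s)) ^ n * M1" using s s0 by (intro small) auto
    finally show ?thesis by simp
  qed
  \<comment> \<open>Half-open boxes require \<open>s > d / c\<close>, so the bound is reached as a
    limit, also for \<open>d = 0\<close>.\<close>
  have "measure M (closure U) \<le> (4 * (d / c)) ^ n * M1"
  proof (rule tendsto_lowerbound)
    have "(\<lambda>k. (4 * (d / c + 1 / real k)) ^ n * M1) \<longlonglongrightarrow> (4 * (d / c + 0)) ^ n * M1"
      by (intro tendsto_intros lim_1_over_n)
    then show "(\<lambda>k. (4 * (d / c + 1 / real k)) ^ n * M1) \<longlonglongrightarrow> (4 * (d / c)) ^ n * M1" by simp
    have "(\<lambda>k. 1 / real k) \<longlonglongrightarrow> 0" by (rule lim_1_over_n)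
    then have "\<forall>\<^sub>F k in sequentially. 1 / real k < 1 / 2 - d / c" using d(2) by (intro order_tendstoD) auto
    then show "\<forall>\<^sub>F k in sequentially. measure M (closure U) \<le> (4 * (d / c + 1 / real k)) ^ n * M1"
      using eventually_gt_at_top[of 0] by eventually_elim (intro bound, auto)
  qed simp
  moreover have "emeasure M (closure U) = ennreal (measure M (closure U))"
    using fin[of "closure U"] U by (intro emeasure_eq_ennreal_measure) (auto simp: less_top)
  ultimately show ?thesis
    using M1 d c_pos by (simp add: d_def ennreal_leI mult.commute mult.left_commute flip: ennreal_mult')
qed

text \<open>Mass distribution: in a cover by sets of diameter at most \<open>c / 4\<close>, the
  measure of each set is at most a constant times its weight, and together they carry the positive
  finite measure of the unit box.\<close>

lemma hausdorff_unit_box_pos: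
  assumes M: "invariant_measure (M :: 'b measure)" and pos: "\<And>U. open U \<Longrightarrow> U \<noteq> {} \<Longrightarrow> 0 < emeasure M U"
  shows "0 < hausdorff_measure n unit_box"
proof -
  interpret invariant_measure M by fact
  \<comment> \<open>The open unit cube, since positivity is known for open sets.\<close>
  define W where "W = (\<Inter>i<n. {x. 0 < coords x i} \<inter> {x. coords x i < 1})"
  have "open W" unfolding W_def
    by (auto intro!: open_INT open_Int open_Collect_less continuous_coords)
  moreover have "lincomb e n (\<lambda>_. 1 / 2) \<in> W" by (auto simp: W_def coords_lincomb)
  ultimately have "0 < emeasure M W" using pos by blast
  also have "\<dots> \<le> emeasure M unit_box" by (rule emeasure_mono) (auto simp: W_def box_at_def less_imp_le)
  finally have M1: "0 < emeasure M unit_box" .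
  have M1fin: "emeasure M unit_box < \<infinity>" by (intro emeasure_bounded_finite bounded_box_at) simp
  have "ennreal ((c / 4) ^ n) \<le> hausdorff_premeasure n (c / 4) unit_box"
  proof (rule hausdorff_premeasure_ge)
    fix U assume U: "hausdorff_cover (c / 4) unit_box U"
    then have b: "bounded (U i)" "diameter (U i) \<le> c / 4" for i by (auto simp: hausdorff_cover_def)
    have "emeasure M unit_box \<le> emeasure M (\<Union>i. closure (U i))"
    proof (rule emeasure_mono)
      show "unit_box \<subseteq> (\<Union>i. closure (U i))" using U closure_subset unfolding hausdorff_cover_def by blast
    qed auto
    also have "\<dots> \<le> (\<Sum>i. emeasure M (closure (U i)))" by (rule emeasure_subadditive_countably) auto
    also have "\<dots> \<le> (\<Sum>i. ennreal ((4 / c) ^ n) * emeasure M unit_box * hausdorff_weight n (U i))"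
    proof (rule suminf_le)
      fix i
      show "emeasure M (closure (U i)) \<le> ennreal ((4 / c) ^ n) * emeasure M unit_box * hausdorff_weight n (U i)"
      proof (cases "U i = {}")
        case False
        have "emeasure M (closure (U i)) \<le> ennreal ((4 / c * diameter (U i)) ^ n) * emeasure M unit_box"
          using M b[of i] False c_pos by (intro emeasure_small_set_le) auto
        also have "ennreal ((4 / c * diameter (U i)) ^ n) = ennreal ((4 / c) ^ n) * hausdorff_weight n (U i)"
          using False c_pos diameter_ge_0[OF b(1)[of i]]
          by (simp only: power_mult_distrib hausdorff_weight_def if_False) (intro ennreal_mult, auto)
        finally show ?thesis by (simp add: ac_simps)
      qed simp
    qed auto
    also have "\<dots> = ennreal ((4 / c) ^ n) * emeasure M unit_box * (\<Sum>i. hausdorff_weight n (U i))"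
      by (rule ennreal_suminf_cmult)
    finally have "emeasure M unit_box * 1 \<le> emeasure M unit_box * (ennreal ((4 / c) ^ n) * (\<Sum>i. hausdorff_weight n (U i)))"
      by (simp add: ac_simps)
    then have "1 \<le> ennreal ((4 / c) ^ n) * (\<Sum>i. hausdorff_weight n (U i))"
      using M1 M1fin by (subst (asm) ennreal_mult_le_mult_iff) auto
    then have "ennreal ((c / 4) ^ n) * 1 \<le> ennreal ((c / 4) ^ n) * (ennreal ((4 / c) ^ n) * (\<Sum>i. hausdorff_weight n (U i)))"
      by (rule mult_left_mono) simp
    also have "\<dots> = ennreal ((c / 4) ^ n * (4 / c) ^ n) * (\<Sum>i. hausdorff_weight n (U i))"
      using c_pos by (simp add: ennreal_mult mult.assoc)
    also have "(c / 4) ^ n * (4 / c) ^ n = 1" using c_pos by (simp flip: power_mult_distrib)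
    finally show "ennreal ((c / 4) ^ n) \<le> (\<Sum>i. hausdorff_weight n (U i))" by simp
  qed
  also have "\<dots> \<le> hausdorff_measure n unit_box" using c_pos by (intro hausdorff_premeasure_le_measure) simp
  finally show ?thesis using c_pos by (auto intro: less_le_trans[rotated])
qed

text \<open>Adding a vector is a surjective isometry, which gives invariance. A ball lies in a
  translated box made of finitely many unit boxes, which gives finiteness.\<close>

lemma hausdorff_invariant_measure: "invariant_measure (measure_of UNIV (sets borel) (hausdorff_measure n :: 'b set \<Rightarrow> ennreal))"
proof -
  define H where "H = measure_of UNIV (sets borel) (hausdorff_measure n :: 'b set \<Rightarrow> ennreal)"
  have sH [measurable_cong, simp]: "sets H = sets borel"
    unfolding H_def using sets.sets_measure_of_eq[of "borel :: 'b measure"] by simp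
  have eH: "emeasure H A = hausdorff_measure n A" if "A \<in> sets borel" for A
    unfolding H_def using that by (rule hausdorff.emeasure_borel)
  have inv: "hausdorff_measure n ((+) a ` A) = hausdorff_measure n A" for a and A :: "'b set"
    by (rule hausdorff_measure_isometry) (auto simp: dist_norm)
  have fin: "hausdorff_measure n (ball x r) < \<infinity>" for x :: 'b and r
  proof -
    obtain j :: nat where j: "real j > max 0 (2 * (r / c))" using reals_Archimedean2 by blast
    \<comment> \<open>The side \<open>2 * s\<close> is an integer, so that unit boxes tile the
      box.\<close>
    define s where "s = real j / 2"
    have "ball x r \<subseteq> (+) (x - lincomb e n (\<lambda>_. s)) ` box_at (\<lambda>_. 0) (2 * s)"
      by (rule small_set_in_box[where d = r]) (use j in \<open>auto simp: s_def mult.commute\<close>)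
    then have "hausdorff_measure n (ball x r) \<le> hausdorff_measure n (box_at (\<lambda>_. 0) (2 * s))"
      using hausdorff.mono inv by metis
    also have "\<dots> = emeasure H (\<Union>k\<in>grid j. box_at k 1)"
      using box_grid[of 1 j] eH[OF box_at_borel, of "\<lambda>_. 0" "2 * s"] by (simp add: s_def)
    also have "\<dots> \<le> (\<Sum>k\<in>grid j. emeasure H (box_at k 1))"
      by (rule emeasure_subadditive_finite) (auto simp: finite_grid)
    also have "\<dots> = (\<Sum>k\<in>grid j. hausdorff_measure n unit_box)"
    proof (rule sum.cong)
      show "emeasure H (box_at k 1) = hausdorff_measure n unit_box" for k
        using inv[of "lincomb e n (\<lambda>i. real (k i) * 1)" unit_box] box_at_translate[of k 1] by (simp add: eH)
    qed simp
    also have "\<dots> < \<infinity>" using hausdorff_unit_box_finite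
      by (simp add: ennreal_mult_less_top of_nat_less_top)
    finally show ?thesis .
  qed
  have "invariant_measure H"
  proof
    fix A :: "'b set" and a assume A: "A \<in> sets borel"
    have "(+) a ` A = (\<lambda>x. x - a) -` A \<inter> space borel" by (auto simp: image_iff intro!: bexI[of _ "_ - a"])
    also have "\<dots> \<in> sets borel"
      by (intro measurable_sets[OF _ A] borel_measurable_continuous_onI continuous_intros)
    finally show "emeasure H ((+) a ` A) = emeasure H A" using A by (simp add: eH inv)
  qed (auto simp: eH fin[simplified])
  then show ?thesis by (simp add: H_def)
qed

text \<open>The measures are proportional, with the ratio of their values on one ball as factor. The
  ball contains the unit box so that its Hausdorff measure is positive.\<close>

lemma invariant_measure_eq_hausdorff:
  assumes M: "invariant_measure (M :: 'b measure)" and pos: "\<And>U. open U \<Longrightarrow> U \<noteq> {} \<Longrightarrow> 0 < emeasure M U"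
    and D: "countable (D :: 'b set)" "closure D = UNIV"
  obtains C :: real where "0 < C" "\<And>A. A \<in> sets borel \<Longrightarrow> emeasure M A = ennreal C * hausdorff_measure n A"
proof -
  interpret invariant_measure M by fact
  define H where "H = measure_of UNIV (sets borel) (hausdorff_measure n :: 'b set \<Rightarrow> ennreal)"
  have H: "invariant_measure H" unfolding H_def by (rule hausdorff_invariant_measure)
  interpret H: invariant_measure H by (rule H)
  have eH: "emeasure H A = hausdorff_measure n A" if "A \<in> sets borel" for A
    unfolding H_def using that by (rule hausdorff.emeasure_borel)
  obtain R where R: "0 < R" "unit_box \<subseteq> ball 0 R"
    using bounded_subset_ballD[OF bounded_box_at[of 1 "\<lambda>_. 0"], of 0] by auto
  have "0 < emeasure H unit_box" using hausdorff_unit_box_pos[OF M pos] by (simp add: eH)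
  also have "\<dots> \<le> emeasure H (ball 0 R)" using R by (intro emeasure_mono) auto
  finally have Hpos: "0 < emeasure H (ball 0 R)" .
  have Mpos: "0 < emeasure M (ball 0 R)" using R by (intro pos) auto
  define a b where "a = measure M (ball 0 R)" and "b = measure H (ball 0 R)"
  have a: "emeasure M (ball 0 R) = ennreal a" and b: "emeasure H (ball 0 R) = ennreal b"
    using emeasure_ball_finite[of 0 R] H.emeasure_ball_finite[of 0 R]
    by (auto simp: a_def b_def emeasure_eq_ennreal_measure less_top)
  have ab: "0 < a" "0 < b" using Mpos Hpos a b by (auto simp: ennreal_less_zero_iff)
  show ?thesis
  proof
    show "0 < a / b" using ab by simp
    fix A :: "'b set" assume A: "A \<in> sets borel"
    have "emeasure M A * ennreal b = hausdorff_measure n A * ennreal a"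
      using invariant_measure_unique[OF M H D A, of R] A by (simp add: a b eH)
    then have "emeasure M A * ennreal b * ennreal (1 / b) = hausdorff_measure n A * ennreal a * ennreal (1 / b)" by simp
    moreover have "ennreal b * ennreal (1 / b) = 1" using ab by (simp flip: ennreal_mult')
    moreover have "ennreal a * ennreal (1 / b) = ennreal (a / b)" using ab by (simp flip: ennreal_mult')
    ultimately show "emeasure M A = ennreal (a / b) * hausdorff_measure n A"
      by (metis mult.assoc mult.commute mult.right_neutral)
  qed
qed

end

section \<open>Linearization of the metric measure space\<close>

context MCP_Busemann
begin

lemma translation_Busemann: "translation_Busemann TYPE('a)"
  by unfold_locales (rule line_translation)

lemma point_of_vector [simp]: "point_of (vector_of (x::'a)) = x"
  by (rule point_of_vector_of[OF translation_Busemann])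

lemma dist_vector_of: "dist (vector_of x) (vector_of (y::'a)) = dist x y"
  using dist_point_of[of "vector_of x" "vector_of y"] by simp

lemma point_of_zero: "point_of (0 :: 'a translation_space) = undefined"
  by (simp add: zero_translation_space_def)

lemma vector_of_continuous: "continuous_on A (vector_of :: 'a \<Rightarrow> _)"
  by (rule continuous_onI) (auto simp: dist_vector_of intro: less_imp_le)

lemma point_of_continuous: "continuous_on A (point_of :: _ \<Rightarrow> 'a)"
  by (rule continuous_onI) (auto simp: dist_point_of intro: less_imp_le)

definition linear_measure :: "'a translation_space measure" where
  "linear_measure = distr m borel vector_of"

lemma vector_of_measurable: "vector_of \<in> measurable m borel"
  unfolding measurable_cong_sets[OF sets_m refl] by (rule borel_measurable_continuous_onI[OF vector_of_continuous])

lemma emeasure_linear_measure: "A \<in> sets borel \<Longrightarrow> emeasure linear_measure A = emeasure m (vector_of -` A)"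
  unfolding linear_measure_def by (simp add: emeasure_distr vector_of_measurable)

lemma vector_of_vimage_ball: "vector_of -` ball v r = ball (point_of v :: 'a) r"
  using dist_point_of[of v "vector_of _"] by auto

text \<open>Adding \<open>a\<close> corresponds under \<open>vector_of\<close> to the translation
  taking the origin to \<open>point_of a\<close>, and translations preserve
  \<open>m\<close>.\<close>

lemma linear_measure_invariant: "invariant_measure linear_measure"
proof
  show "sets linear_measure = sets borel" by (simp add: linear_measure_def)
  show "emeasure linear_measure (ball x r) < \<infinity>" for x r
    using emeasure_ball_finite by (simp add: emeasure_linear_measure vector_of_vimage_ball)
  fix A :: "'a translation_space set" and a assume A: "A \<in> sets borel"
  have "(+) a ` A = (\<lambda>x. x - a) -` A \<inter> space borel" by (auto simp: image_iff intro!: bexI[of _ "_ - a"])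
  also have "\<dots> \<in> sets borel"
    by (intro measurable_sets[OF _ A] borel_measurable_continuous_onI continuous_intros)
  finally have aA: "(+) a ` A \<in> sets borel" .
  let ?f = "translation_to (point_of a)"
  have f: "translation ?f" by (rule translation_translation_to)
  have "vector_of -` A = ?f -` (vector_of -` ((+) a ` A))"
  proof -
    have "vector_of (?f x) = a + vector_of x" for x
      by (simp add: plus_translation_space_def)
    then show ?thesis by (auto simp: image_iff)
  qed
  then have "emeasure linear_measure A = emeasure m (?f -` (vector_of -` ((+) a ` A)))"
    using A by (simp add: emeasure_linear_measure)
  also have "\<dots> = emeasure (distr m borel ?f) (vector_of -` ((+) a ` A))"
  proof (subst emeasure_distr)
    show "?f \<in> measurable m borel"
      unfolding measurable_cong_sets[OF sets_m refl] by (rule borel_measurable_continuous_onI[OF translation_continuous[OF f]])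
    show "vector_of -` ((+) a ` A) \<in> sets borel"
      using measurable_sets[OF vector_of_measurable aA] by simp
  qed simp
  also have "\<dots> = emeasure linear_measure ((+) a ` A)"
    using aA by (simp add: translation_distr[OF f] emeasure_linear_measure)
  finally show "emeasure linear_measure ((+) a ` A) = emeasure linear_measure A" ..
qed

lemma linear_measure_pos: "open U \<Longrightarrow> U \<noteq> {} \<Longrightarrow> 0 < emeasure linear_measure U"
proof -
  assume U: "open U" "U \<noteq> {}"
  then obtain v where "v \<in> U" by blast
  then have "point_of v \<in> vector_of -` U" by (simp add: point_of_inverse)
  moreover have "open (vector_of -` U :: 'a set)" using U(1) vector_of_continuous by (simp add: open_vimage)
  ultimately show ?thesis using open_pos U(1) by (auto simp: emeasure_linear_measure)
qed

lemma translation_space_dense: obtains D :: "'a translation_space set" where "countable D" "closure D = UNIV"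
proof -
  obtain D :: "'a set" where D: "countable D" "\<And>x e. e > 0 \<Longrightarrow> \<exists>y\<in>D. dist y x < e"
    by (rule countable_dense) blast
  show ?thesis
  proof
    show "countable (vector_of ` D)" using D(1) by simp
    have "v \<in> closure (vector_of ` D)" for v :: "'a translation_space"
      unfolding closure_approachable
    proof (intro allI impI)
      fix e :: real assume "0 < e"
      then obtain y where y: "y \<in> D" "dist y (point_of v) < e" using D(2) by blast
      have "dist (vector_of y) v < e" using y(2) dist_point_of[of "vector_of y" v] by simp
      then show "\<exists>y\<in>vector_of ` D. dist y v < e" using y(1) by blast
    qed
    then show "closure (vector_of ` D) = UNIV" by blast
  qed
qed

lemma frame_dimension_le_N:
  assumes "0 \<le> N" and fr: "frame (e :: nat \<Rightarrow> 'a translation_space) n"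
  shows "real n \<le> N"
proof -
  interpret L: invariant_measure linear_measure by (rule linear_measure_invariant)
  have ball: "measure linear_measure (ball 0 r) = measure m (ball undefined r)" for r
    by (simp add: measure_def emeasure_linear_measure vector_of_vimage_ball point_of_zero)
  show ?thesis
    by (rule L.frame_dimension_le[OF fr _ assms(1)]) (auto simp: ball measure_ball_pos Bishop_Gromov)
qed

text \<open>If \<open>norm (v + w) = 2\<close>, then \<open>v\<close> and \<open>w\<close> are both
  midpoints of \<open>0\<close> and \<open>v + w\<close>, being at distance 1 from either
  end.\<close>

lemma translation_space_strictly_convex:
  fixes v w :: "'a translation_space"
  assumes "norm v = 1" "norm w = 1" "2 \<le> norm (v + w)"
  shows "v = w"
proof -
  have vw: "norm (v + w) = 2" using assms norm_triangle_ineq[of v w] by simp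
  have mid: "intermediate_point (point_of 0) (1 / 2) (point_of (v + w)) = point_of u"
    if "norm u = 1" "norm (v + w - u) = 1" for u
    by (rule intermediate_point_eqI) (use that vw in \<open>auto simp: dist_point_of dist_norm norm_minus_commute add.commute[of w v]\<close>)
  have "point_of v = point_of w" using mid[of v] mid[of w] assms by simp
  then show ?thesis by (simp add: point_of_inject)
qed

end

context frame_basis
begin

lemma coords_in_coord_space: "coords x \<in> coord_space n"
  by (simp add: coord_space_def coords_def)

lemma coords_lincomb_eq: "v \<in> coord_space n \<Longrightarrow> coords (lincomb e n v) = v"
  by (rule ext) (metis (mono_tags, lifting) coord_space_def coords_def coords_lincomb linorder_not_less mem_Collect_eq)

lemma norm_dist_lincomb: "norm_dist (\<lambda>v. norm (lincomb e n v)) v w = dist (lincomb e n v) (lincomb e n w)"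
  by (simp add: norm_dist_def lincomb_diff dist_norm)

lemma norm_on_lincomb: "norm_on n (\<lambda>v. norm (lincomb e n v))"
  unfolding norm_on_def
proof (intro conjI ballI allI)
  fix v assume v: "v \<in> coord_space n"
  have "lincomb e n (\<lambda>i. 0) = 0" by (simp add: lincomb_def)
  moreover have "v = coords (lincomb e n v)" "(\<lambda>i. 0) = coords (lincomb e n (\<lambda>i. 0))"
    using v coords_lincomb_eq[of "\<lambda>i. 0"] by (auto simp: coords_lincomb_eq coord_space_def)
  ultimately show "norm (lincomb e n v) = 0 \<longleftrightarrow> v = (\<lambda>i. 0)" by (metis norm_eq_zero)
qed (auto simp: lincomb_scale lincomb_add norm_triangle_ineq)

lemma banach_norm_on_lincomb:
  assumes "complete (UNIV :: 'b set)"
  shows "banach_norm_on n (\<lambda>v. norm (lincomb e n v))"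
proof -
  let ?d = "norm_dist (\<lambda>v. norm (lincomb e n v))"
  interpret Metric_space "coord_space n" ?d
  proof
    show "?d x y = 0 \<longleftrightarrow> x = y" if "x \<in> coord_space n" "y \<in> coord_space n" for x y
      using that coords_lincomb_eq by (metis norm_dist_lincomb dist_eq_0_iff)
  qed (auto simp: norm_dist_lincomb dist_commute dist_triangle)
  have mcomplete unfolding mcomplete_def
  proof (intro allI impI)
    fix \<sigma> assume \<sigma>: "MCauchy \<sigma>"
    then have "Cauchy (\<lambda>i. lincomb e n (\<sigma> i))"
      unfolding MCauchy_def norm_dist_lincomb by (auto intro!: metric_CauchyI)
    then obtain x where x: "(\<lambda>i. lincomb e n (\<sigma> i)) \<longlonglongrightarrow> x"
      using assms unfolding complete_def by blast
    have "limitin mtopology \<sigma> (coords x) sequentially"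
      unfolding limit_metric_sequentially
    proof (intro conjI allI impI coords_in_coord_space)
      fix \<epsilon> :: real assume "0 < \<epsilon>"
      then obtain K where "\<forall>i\<ge>K. dist (lincomb e n (\<sigma> i)) x < \<epsilon>" using x metric_LIMSEQ_D by blast
      then show "\<exists>K. \<forall>i\<ge>K. \<sigma> i \<in> coord_space n \<and> ?d (\<sigma> i) (coords x) < \<epsilon>"
        using \<sigma> by (intro exI[of _ K]) (auto simp: MCauchy_def norm_dist_lincomb lincomb_coords)
    qed
    then show "\<exists>x. limitin mtopology \<sigma> x sequentially" by blast
  qed
  then show ?thesis using norm_on_lincomb by (simp add: banach_norm_on_def)
qed

end

theorem theorem1p1:
  fixes N :: real and m :: "'a::metric_space measure"
  assumes "1 \<le> N"
    and "busemann_space TYPE('a)"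
    and "geodesically_complete TYPE('a)"
    and "metric_measure_space m"
    and "MCP0 N m"
  shows "\<exists>(n::nat) \<nu>. real n \<le> N \<and>
           banach_norm_on n \<nu> \<and> strictly_convex_norm_on n \<nu> \<and> isometric_to_normed TYPE('a) n \<nu> \<and>
           (\<exists>c::real. 0 < c \<and>
              (\<forall>A\<in>sets m. emeasure m A = ennreal c * hausdorff_measure n A))"
proof -
  interpret MCP_Busemann "TYPE('a)" m N
    by unfold_locales (use assms in auto)
  have N: "0 \<le> N" using assms(1) by simp
  obtain e :: "nat \<Rightarrow> 'a translation_space" and n where e: "frame e n" "surj (lincomb e n)"
    using frame_basis_exists[of N] frame_dimension_le_N[OF N] by metis
  then obtain c where "frame_basis e n c"
    unfolding frame_def frame_basis_def by blast
  then interpret frame_basis e n c .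
  let ?\<nu> = "\<lambda>v. norm (lincomb e n v)"
  have complete: "complete (UNIV :: 'a translation_space set)"
    unfolding complete_def
  proof (intro allI impI)
    fix \<sigma> :: "nat \<Rightarrow> 'a translation_space" assume "(\<forall>i. \<sigma> i \<in> UNIV) \<and> Cauchy \<sigma>"
    then have "Cauchy (\<lambda>i. point_of (\<sigma> i))" by (simp add: Cauchy_def dist_point_of)
    then obtain x where "(\<lambda>i. point_of (\<sigma> i)) \<longlonglongrightarrow> x" using complete_UNIV unfolding complete_def by blast
    then have "\<sigma> \<longlonglongrightarrow> vector_of x"
      unfolding lim_sequentially using dist_point_of[of "\<sigma> _" "vector_of x"] by simp
    then show "\<exists>l\<in>UNIV. \<sigma> \<longlonglongrightarrow> l" by blast
  qed
  have "strictly_convex_norm_on n ?\<nu>"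
    unfolding strictly_convex_norm_on_def
  proof (intro ballI impI, rule ccontr)
    fix v w assume vw: "v \<in> coord_space n" "w \<in> coord_space n" "?\<nu> v = 1" "?\<nu> w = 1" "v \<noteq> w"
      and "\<not> ?\<nu> (\<lambda>i. (v i + w i) / 2) < 1"
    \<comment> \<open>So failure of strict convexity means that the sum of the two unit vectors has
      norm at least 2.\<close>
    moreover have "lincomb e n (\<lambda>i. (v i + w i) / 2) = (1 / 2) *\<^sub>R (lincomb e n v + lincomb e n w)"
      using lincomb_scale[of e n "1 / 2" "\<lambda>i. v i + w i"] by (simp add: lincomb_add)
    ultimately have "lincomb e n v = lincomb e n w" by (intro translation_space_strictly_convex) auto
    then show False using vw coords_lincomb_eq by metis
  qed
  moreover have "isometric_to_normed TYPE('a) n ?\<nu>"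
    unfolding isometric_to_normed_def
  proof (intro exI[of _ "\<lambda>x. coords (vector_of x)"] conjI allI)
    show "bij_betw (\<lambda>x. coords (vector_of (x::'a))) UNIV (coord_space n)"
      by (rule bij_betw_byWitness[where f' = "\<lambda>v. point_of (lincomb e n v)"])
         (auto simp: lincomb_coords coords_lincomb_eq coords_in_coord_space point_of_inverse)
  qed (simp add: norm_dist_lincomb lincomb_coords dist_vector_of)
  moreover have "\<exists>C::real. 0 < C \<and> (\<forall>A\<in>sets m. emeasure m A = ennreal C * hausdorff_measure n A)"
  proof -
    obtain D :: "'a translation_space set" where D: "countable D" "closure D = UNIV"
      by (rule translation_space_dense)
    obtain C :: real where C: "0 < C" "\<And>A. A \<in> sets borel \<Longrightarrow> emeasure linear_measure A = ennreal C * hausdorff_measure n A"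
      using invariant_measure_eq_hausdorff[OF linear_measure_invariant linear_measure_pos D] by metis
    have "emeasure m A = ennreal C * hausdorff_measure n A" if A: "A \<in> sets m" for A
    proof -
      have "point_of -` A \<inter> space borel \<in> sets (borel :: 'a translation_space measure)"
        using A by (intro measurable_sets[of point_of borel borel] borel_measurable_continuous_onI point_of_continuous) auto
      then have B: "point_of -` A \<in> sets (borel :: 'a translation_space measure)" by simp
      have "emeasure m A = emeasure linear_measure (point_of -` A)"
        using B by (simp add: emeasure_linear_measure vimage_def)
      also have "\<dots> = ennreal C * hausdorff_measure n (point_of -` A :: 'a translation_space set)" using B by (rule C(2))
      \<comment> \<open>\<open>point_of\<close> is a surjective isometry, so the Hausdorff measures
        on the two types correspond.\<close>
      also have "hausdorff_measure n (point_of -` A) = hausdorff_measure n (point_of ` (point_of -` A))"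
        by (rule hausdorff_measure_isometry[symmetric]) (auto simp: dist_point_of intro!: surjI[of _ vector_of])
      also have "point_of ` (point_of -` A) = A" by (intro surj_image_vimage_eq surjI[of _ vector_of]) simp
      finally show ?thesis .
    qed
    then show ?thesis using C(1) by blast
  qed
  ultimately show ?thesis
    using frame_dimension_le_N[OF N e(1)] banach_norm_on_lincomb[OF complete] by blast
qed

end
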